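(* Let $0<p\le\infty$, and let $s>1/4$ if $p\le4$ and $s>1/2-1/p$ if $p>4$ (with $1/\infty=0$). Let $R_s(x)=\sum_{n=1}^\infty n^{-2s}e^{2\pi i n^2x}$ and, for $N\in\mathbb N$, $(R_s)_{\ge N}(x)=\sum_{n\ge1,\,n^2\ge N}n^{-2s}e^{2\pi i n^2x}$. Then for all sufficiently large $N$, \[ \|(R_s)_{\ge N}\|_{L^p(\mathbb T)}\simeq_{s,p}\begin{cases}N^{1/4-s}, & p<4,\\ N^{1/4-s}(\log N)^{1/4}, & p=4,\\ N^{1/2-1/p-s}, & p>4,\end{cases} \] interpreting $1/p=0$ when $p=\infty$.
   Context: $\mathbb T=\mathbb R/\mathbb Z$. The series are understood as limits in $L^p(\mathbb T)$ of their partial sums. $\simeq_{s,p}$ means two-sided bounds with constants depending only on $s,p$ (not on $N$). *)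

theory Defs
  imports "HOL-Analysis.Analysis"
begin

text \<open>Functions on the torus T = R/Z are represented by functions real => complex,
  of which only the values on the fundamental domain [0,1] matter.
  The exponent p ranges over (0, infinity], encoded as an ennreal.\<close>

definition inv_exp :: "ennreal \<Rightarrow> real" where
  "inv_exp p = (if p = \<infinity> then 0 else 1 / enn2real p)"

definition Lp_norm :: "ennreal \<Rightarrow> (real \<Rightarrow> complex) \<Rightarrow> ennreal" where
  "Lp_norm p f =
     (if p = \<infinity> then
        Inf {C :: ennreal. AE x in lebesgue_on {0..1}. ennreal (norm (f x)) \<le> C}
      else
        (let I = (\<integral>\<^sup>+ x. ennreal (norm (f x) powr enn2real p) \<partial>(lebesgue_on {0..1}))
         in if I = \<infinity> then \<infinity> else ennreal (enn2real I powr (1 / enn2real p))))"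

definition tail_partial :: "real \<Rightarrow> nat \<Rightarrow> nat \<Rightarrow> real \<Rightarrow> complex" where
  "tail_partial s N M x =
     (\<Sum>n\<in>{n. 1 \<le> n \<and> n \<le> M \<and> N \<le> n^2}.
        complex_of_real (real n powr (-2 * s)) * cis (2 * pi * real (n^2) * x))"

definition is_tail_limit :: "ennreal \<Rightarrow> real \<Rightarrow> nat \<Rightarrow> (real \<Rightarrow> complex) \<Rightarrow> bool" where
  "is_tail_limit p s N f \<longleftrightarrow>
     f \<in> borel_measurable lebesgue \<and>
     ((\<lambda>M. Lp_norm p (\<lambda>x. tail_partial s N M x - f x)) \<longlonglongrightarrow> 0)"

definition rate :: "ennreal \<Rightarrow> real \<Rightarrow> nat \<Rightarrow> real" where
  "rate p s N =
     (if p < 4 then real N powr (1/4 - s)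
      else if p = 4 then real N powr (1/4 - s) * ln (real N) powr (1/4)
      else real N powr (1/2 - inv_exp p - s))"

end

theory Submission
  imports Defs "HOL-Number_Theory.Number_Theory"
begin

text \<open>
  Upper bounds. For a weight that is Lipschitz at scale \<open>L\<close> with second differences summing to
  \<open>O(1/L)\<close>, Weyl differencing followed by two summations by parts bounds the square of the
  exponential sum over a window of length \<open>L\<close> by \<open>C / (q (L\<^sup>-\<^sup>2 + |x - a/q|))\<close> when \<open>a/q\<close> is a Dirichlet
  approximation to \<open>x\<close> of level \<open>16 L\<close>; the smoothness of the weight is what prevents a logarithmic loss.
  Summing the integrals of the majorant over all \<open>a/q\<close> gives the sharp \<open>L\<^sup>r\<close> norm for every \<open>r \<ge> 3\<close>.
  A sharp cutoff is a telescoping sum of such weights at dyadic scales, so it obeys the same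
  bound, and partial summation inserts the coefficients \<open>n powr (-2 s)\<close>.

  Lower bounds. For \<open>p < 4\<close>, interpolate the exact \<open>L\<^sup>2\<close> norm between \<open>L\<^sup>p\<close> and \<open>L\<^sup>3\<close>. For \<open>p = 4\<close>,
  count solutions of \<open>n\<^sub>1\<^sup>2 + n\<^sub>2\<^sup>2 = n\<^sub>3\<^sup>2 + n\<^sub>4\<^sup>2\<close>. For \<open>4 < p < \<infinity>\<close>, test against a Fejer kernel, and for
  \<open>p = \<infinity>\<close> evaluate at \<open>0\<close>.
\<close>

subsection \<open>Power means over the unit interval\<close>

text \<open>Estimates are phrased through r-th power integrals rather than norms: for p < 1 there is
  no Minkowski inequality, and comparing powers by splitting at a height needs no roots. Minkowski
  is applied only at exponents r >= 3; smaller exponents are reached afterwards. The three regimes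
  come from the fractions a/q with q up to a multiple of L. Heuristically a window of length L has
  size q^(-1/2) L on an arc of width L^(-2) about each of them, so the r-th power integral is about
  L^(r-2) times the sum of q^(1-r/2). That sum is dominated by q ~ L for r < 4, by bounded q for r >
  4, and is harmonic at r = 4. The logarithm at p = 4 is thus genuine, and no step may create a
  further one: this dictates the smooth weights and a geometric gain from each dyadic scale to the
  next. The exponent 3 is a fixed choice between 2 and 4, where the growth is still a square root.
  For the series, the decay of the coefficients makes a whole tail comparable to its initial part,
  uniformly in the upper end, so the estimates pass to the limit.\<close>

definition Lp_integral :: "real \<Rightarrow> (real \<Rightarrow> complex) \<Rightarrow> real" where
  "Lp_integral r g = integral {0..1} (\<lambda>x. norm (g x) powr r)"

lemma continuous_on_norm_powr:
  assumes "continuous_on S g" "0 < r"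
  shows "continuous_on S (\<lambda>x. norm (g x) powr r)"
  using assms by (intro continuous_on_powr' continuous_intros) auto

lemma norm_powr_integrable:
  fixes g :: "real \<Rightarrow> complex"
  assumes "continuous_on {0..1} g" "0 < r"
  shows "(\<lambda>x. norm (g x) powr r) integrable_on {0..1}"
  using assms by (intro integrable_continuous_real continuous_on_norm_powr)

lemma Lp_integral_cmult:
  "Lp_integral r (\<lambda>x. c * g x) = norm c powr r * Lp_integral r g"
  unfolding Lp_integral_def by (simp add: norm_mult powr_mult)

text \<open>The endpoint 0 is included because convexity is applied to moduli, which may vanish;
  there the claim reduces to t powr p <= t for 0 < t < 1.\<close>

lemma powr_convex_nonneg:
  assumes "(p::real) \<ge> 1" shows "convex_on {0..} (\<lambda>x::real. x powr p)"
proof (rule convex_on_linorderI)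
  fix t x y :: real
  assume t: "0 < t" "t < 1" and xy: "x \<in> {0..}" "y \<in> {0..}" "x < y"
  show "((1 - t) *\<^sub>R x + t *\<^sub>R y) powr p \<le> (1 - t) * x powr p + t * y powr p"
  proof (cases "x = 0")
    case True
    have "t powr p \<le> t powr 1" using t assms by (intro powr_mono') auto
    then show ?thesis using True t xy by (auto simp: powr_mult intro!: mult_right_mono)
  next
    case False
    then show ?thesis using convex_onD[OF powr_convex[OF assms], of t x y] t xy by auto
  qed
qed auto

text \<open>Minkowski's inequality in terms of prescribed bounds \<open>B i\<close>: Jensen's
  inequality with the weights \<open>B i / S\<close>, applied to |g_i| / B_i and then integrated. No
  root of an integral has to be taken.\<close>

lemma Lp_integral_sum_le:
  assumes fin: "finite I" and r: "r \<ge> 1"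
    and cont: "\<And>i. i \<in> I \<Longrightarrow> continuous_on {0..1} (g i)"
    and B: "\<And>i. i \<in> I \<Longrightarrow> B i > 0"
    and J: "\<And>i. i \<in> I \<Longrightarrow> Lp_integral r (g i) \<le> B i powr r"
  shows "Lp_integral r (\<lambda>x. \<Sum>i\<in>I. g i x) \<le> (\<Sum>i\<in>I. B i) powr r"
proof (cases "I = {}")
  case True then show ?thesis by (simp add: Lp_integral_def)
next
  case False
  define S where "S = (\<Sum>i\<in>I. B i)"
  have S: "S > 0" unfolding S_def using fin False B by (intro sum_pos) auto
  have int: "(\<lambda>x. norm (g i x) powr r) integrable_on {0..1}" if "i \<in> I" for i
    using cont[OF that] r by (intro norm_powr_integrable) auto
  have pw: "norm (\<Sum>i\<in>I. g i x) powr r \<le> S powr r * (\<Sum>i\<in>I. B i / S * (norm (g i x) powr r / B i powr r))" for x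
  proof -
    have "norm (\<Sum>i\<in>I. g i x) \<le> (\<Sum>i\<in>I. norm (g i x))" by (rule norm_sum)
    also have "\<dots> = S * (\<Sum>i\<in>I. (B i / S) *\<^sub>R (norm (g i x) / B i))"
      using S B by (auto simp: sum_distrib_left intro!: sum.cong) (metis less_irrefl)
    finally have "norm (\<Sum>i\<in>I. g i x) powr r \<le> (S * (\<Sum>i\<in>I. (B i / S) *\<^sub>R (norm (g i x) / B i))) powr r"
      using r by (intro powr_mono2) auto
    also have "\<dots> = S powr r * (\<Sum>i\<in>I. (B i / S) *\<^sub>R (norm (g i x) / B i)) powr r"
      using S B by (intro powr_mult)
    also have "(\<Sum>i\<in>I. (B i / S) *\<^sub>R (norm (g i x) / B i)) powr r \<le> (\<Sum>i\<in>I. B i / S * (norm (g i x) / B i) powr r)"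
    proof (rule convex_on_sum[OF fin False powr_convex_nonneg[OF r]])
      show "(\<Sum>i\<in>I. B i / S) = 1" using S by (simp add: S_def flip: sum_divide_distrib)
    qed (use B S in \<open>auto intro!: divide_nonneg_pos simp: less_imp_le\<close>)
    also have "\<dots> = (\<Sum>i\<in>I. B i / S * (norm (g i x) powr r / B i powr r))"
      using B by (intro sum.cong) (auto simp: powr_divide less_imp_le)
    finally show ?thesis using S by (simp add: mult_left_mono)
  qed
  have "Lp_integral r (\<lambda>x. \<Sum>i\<in>I. g i x)
      \<le> integral {0..1} (\<lambda>x. S powr r * (\<Sum>i\<in>I. B i / S * (norm (g i x) powr r / B i powr r)))"
    unfolding Lp_integral_def using pw fin r
    by (intro integral_le norm_powr_integrable continuous_on_sum cont
        integrable_on_mult_right integrable_sum integrable_on_divide int) auto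
  also have "\<dots> = S powr r * (\<Sum>i\<in>I. B i / S * (Lp_integral r (g i) / B i powr r))"
    unfolding Lp_integral_def using fin
    by (simp add: integral_sum int integrable_on_mult_right integrable_on_divide)
  also have "\<dots> \<le> S powr r * (\<Sum>i\<in>I. B i / S * 1)"
    using S B J by (intro mult_left_mono sum_mono) (auto simp: divide_le_eq less_imp_le)
  also have "(\<Sum>i\<in>I. B i / S * 1) = 1" using S by (simp add: S_def flip: sum_divide_distrib)
  finally show ?thesis by (simp add: S_def)
qed

lemma powr_le_powr_add_powr:
  fixes t l r p :: real
  assumes "0 \<le> t" "0 < l" "0 < r" "r \<le> p"
  shows "t powr r \<le> l powr r + l powr (r - p) * t powr p"
proof (cases "t \<le> l")
  case True
  then have "t powr r \<le> l powr r" using assms by (intro powr_mono2) auto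
  then show ?thesis by (simp add: add_increasing2)
next
  case False
  then have "t powr r = t powr (r - p) * t powr p" using assms by (simp flip: powr_add)
  also have "\<dots> \<le> l powr (r - p) * t powr p"
    using False assms by (intro mult_right_mono powr_mono2') auto
  finally show ?thesis by (simp add: add_increasing)
qed

text \<open>A substitute for Hoelder's inequality on a space of measure 1. With \<open>l\<close> the
  size of the L^p norm it bounds the lower exponent; with \<open>l powr r\<close> half of a known
  lower bound for the left side it yields a lower bound at the higher exponent.\<close>

lemma Lp_integral_le_of_exponent_le:
  assumes g: "continuous_on {0..1} g" and "0 < l" "0 < r" "r \<le> p"
  shows "Lp_integral r g \<le> l powr r + l powr (r - p) * Lp_integral p g"
proof -
  have "Lp_integral r g \<le> integral {0..1} (\<lambda>x. l powr r + l powr (r - p) * norm (g x) powr p)"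
    unfolding Lp_integral_def using assms
    by (intro integral_le norm_powr_integrable integrable_add integrable_on_mult_right
        powr_le_powr_add_powr) auto
  also have "\<dots> = l powr r + l powr (r - p) * Lp_integral p g"
    unfolding Lp_integral_def using assms
    by (subst integral_add) (auto intro!: integrable_on_mult_right norm_powr_integrable)
  finally show ?thesis .
qed

text \<open>Splitting at height \<open>l\<close> plays the role of interpolation: where \<open>t \<le> l\<close> the lower power
  dominates \<open>t powr r\<close>, elsewhere the higher one does.\<close>

lemma Lp_integral_interpolation:
  assumes g: "continuous_on {0..1} g" and "0 < l" "0 < p" "p \<le> r" "r \<le> q"
  shows "Lp_integral r g \<le> l powr (r - p) * Lp_integral p g + l powr (r - q) * Lp_integral q g"
proof -
  have pw: "t powr r \<le> l powr (r - p) * t powr p + l powr (r - q) * t powr q" if "t \<ge> 0" for t :: real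
  proof (cases "t \<le> l")
    case True
    have "t powr r = t powr (r - p) * t powr p" by (simp flip: powr_add)
    also have "\<dots> \<le> l powr (r - p) * t powr p"
      using True that assms by (intro mult_right_mono powr_mono2) auto
    finally show ?thesis by (simp add: add_increasing2)
  next
    case False
    then have "t powr r = t powr (r - q) * t powr q" using assms by (simp flip: powr_add)
    also have "\<dots> \<le> l powr (r - q) * t powr q"
      using False assms by (intro mult_right_mono powr_mono2') auto
    finally show ?thesis by (simp add: add_increasing)
  qed
  have "Lp_integral r g \<le> integral {0..1}
      (\<lambda>x. l powr (r - p) * norm (g x) powr p + l powr (r - q) * norm (g x) powr q)"
    unfolding Lp_integral_def using assms
    by (intro integral_le norm_powr_integrable integrable_add integrable_on_mult_right pw) auto
  also have "\<dots> = l powr (r - p) * Lp_integral p g + l powr (r - q) * Lp_integral q g"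
    unfolding Lp_integral_def using assms
    by (subst integral_add) (auto intro!: integrable_on_mult_right norm_powr_integrable)
  finally show ?thesis .
qed

subsection \<open>Weyl differencing with piecewise smooth weights\<close>

definition unit_char :: "real \<Rightarrow> complex" where
  "unit_char t = cis (2 * pi * t)"

definition dist_int :: "real \<Rightarrow> real" where
  "dist_int t = \<bar>t - of_int (round t)\<bar>"

lemma norm_unit_char [simp]: "norm (unit_char t) = 1"
  by (simp add: unit_char_def)

lemma unit_char_add: "unit_char (s + t) = unit_char s * unit_char t"
  by (simp add: unit_char_def cis_mult ring_distribs)

lemma unit_char_0 [simp]: "unit_char 0 = 1"
  by (simp add: unit_char_def)

lemma cnj_unit_char: "cnj (unit_char t) = unit_char (- t)"
  by (simp add: unit_char_def cis_cnj)

lemma unit_char_int [simp]: "unit_char (of_int k) = 1"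
  by (simp add: unit_char_def cis_multiple_2pi)

lemma continuous_on_unit_char [continuous_intros]:
  "continuous_on S f \<Longrightarrow> continuous_on S (\<lambda>x. unit_char (f x))"
  unfolding unit_char_def by (intro continuous_intros)

lemma dist_int_nonneg [simp]: "0 \<le> dist_int t"
  by (simp add: dist_int_def)

lemma dist_int_le: "dist_int t \<le> \<bar>t - of_int k\<bar>"
  unfolding dist_int_def by (rule round_diff_minimal)

lemma dist_int_attained: obtains k :: int where "dist_int t = \<bar>t - of_int k\<bar>"
  unfolding dist_int_def by blast

lemma dist_int_eqI:
  assumes "\<bar>t - of_int k\<bar> \<le> 1/2"
  shows "dist_int t = \<bar>t - of_int k\<bar>"
proof (rule antisym[OF dist_int_le])
  obtain j where j: "dist_int t = \<bar>t - of_int j\<bar>" by (rule dist_int_attained)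
  show "\<bar>t - of_int k\<bar> \<le> dist_int t"
  proof (cases "j = k")
    case False
    then have "1 \<le> \<bar>j - k\<bar>" by linarith
    then have "1 \<le> \<bar>real_of_int j - of_int k\<bar>" by (simp flip: of_int_diff of_int_abs)
    then show ?thesis using assms j by linarith
  qed (use j in simp)
qed

lemma dist_int_add_le: "dist_int (s + t) \<le> dist_int s + \<bar>t\<bar>"
proof -
  obtain k where "dist_int s = \<bar>s - of_int k\<bar>" by (rule dist_int_attained)
  then show ?thesis using dist_int_le[of "s + t" k] by linarith
qed

lemma dist_int_add_int [simp]: "dist_int (t + of_int k) = dist_int t"
proof -
  have "dist_int (s + of_int k) \<le> dist_int s" for s and k :: int
  proof -
    obtain j where "dist_int s = \<bar>s - of_int j\<bar>" by (rule dist_int_attained)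
    then show ?thesis using dist_int_le[of "s + of_int k" "j + k"] by simp
  qed
  from this[of t k] this[of "t + of_int k" "-k"] show ?thesis by simp
qed

text \<open>Jordan's inequality: sin is concave on [0, pi], so it lies above its chord between 0 and
  pi/2.\<close>

lemma sin_pi_ge_double:
  assumes "0 \<le> u" "u \<le> 1/2"
  shows "2 * u \<le> sin (pi * u)"
proof -
  have conv: "convex_on {0..pi} (\<lambda>x. - sin x)"
    by (rule f''_ge0_imp_convex[where f' = "\<lambda>x. - cos x" and f'' = sin])
       (auto intro!: derivative_eq_intros sin_ge_zero)
  have "- sin ((1 - 2 * u) *\<^sub>R 0 + (2 * u) *\<^sub>R (pi / 2)) \<le> (1 - 2 * u) * (- sin 0) + 2 * u * (- sin (pi / 2))"
    by (rule convex_onD[OF conv]) (use assms in auto)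
  then show ?thesis by (simp add: mult.commute)
qed

lemma norm_one_minus_unit_char_ge: "4 * dist_int t \<le> norm (1 - unit_char t)"
proof -
  define u where "u = t - of_int (round t)"
  have u: "\<bar>u\<bar> \<le> 1/2" unfolding u_def using of_int_round_abs_le[of t] by (simp add: abs_minus_commute)
  have "unit_char t = unit_char (u + of_int (round t))" by (simp add: u_def)
  also have "\<dots> = unit_char u" by (simp add: unit_char_add)
  finally have eq: "unit_char t = unit_char u" .
  \<comment> \<open>The chord has length 2 |sin(pi u)|; Jordan's inequality then supplies the factor
    4.\<close>
  have "(norm (1 - unit_char u))\<^sup>2 = (1 - cos (2 * (pi * u)))\<^sup>2 + (sin (2 * (pi * u)))\<^sup>2"
    by (simp add: cmod_power2 unit_char_def mult.assoc)
  also have "\<dots> = 2 - 2 * cos (2 * (pi * u))"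
    using sin_cos_squared_add[of "2 * (pi * u)"] by (simp add: power2_eq_square algebra_simps)
  also have "\<dots> = (2 * \<bar>sin (pi * u)\<bar>)\<^sup>2"
    by (simp add: cos_double_sin power_mult_distrib)
  finally have n: "norm (1 - unit_char u) = 2 * \<bar>sin (pi * u)\<bar>"
    by (rule power2_eq_imp_eq) auto
  have "2 * \<bar>u\<bar> \<le> \<bar>sin (pi * u)\<bar>"
  proof (cases "u \<ge> 0")
    case True
    then show ?thesis using sin_pi_ge_double[of u] u by auto
  next
    case False
    then show ?thesis using sin_pi_ge_double[of "-u"] u by auto
  qed
  then show ?thesis using eq n by (simp add: dist_int_def u_def)
qed

text \<open>Two summations by parts at once: multiplying the sum by (1 - e(-theta))^2 replaces its
  coefficients by their second differences. The range starts at a - 2 since g(n + 2) may already be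
  nonzero there.\<close>

lemma second_difference_bound:
  fixes g :: "int \<Rightarrow> real"
  assumes supp: "\<And>n. n \<notin> {a..<b} \<Longrightarrow> g n = 0"
  shows "(norm (1 - unit_char \<theta>))\<^sup>2 * norm (\<Sum>n\<in>{a..<b}. of_real (g n) * unit_char (of_int n * \<theta>))
       \<le> (\<Sum>n\<in>{a-2..<b}. \<bar>g (n + 2) - 2 * g (n + 1) + g n\<bar>)"
proof -
  define G where "G = (\<Sum>n\<in>{a..<b}. of_real (g n) * unit_char (of_int n * \<theta>))"
  have shift: "(\<Sum>n\<in>{a-2..<b}. of_real (g (n + j)) * unit_char (of_int n * \<theta>)) = unit_char (- of_int j * \<theta>) * G"
    if j: "0 \<le> j" "j \<le> 2" for j
  proof -
    have "(\<Sum>n\<in>{a-2..<b}. of_real (g (n + j)) * unit_char (of_int n * \<theta>))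
        = (\<Sum>n\<in>{a-2+j..<b+j}. of_real (g n) * unit_char (of_int (n - j) * \<theta>))"
      by (rule sum.reindex_bij_witness[of _ "\<lambda>n. n - j" "\<lambda>n. n + j"]) auto
    also have "\<dots> = (\<Sum>n\<in>{a..<b}. of_real (g n) * unit_char (of_int (n - j) * \<theta>))"
      using j by (intro sum.mono_neutral_right) (auto simp: supp)
    also have "\<dots> = unit_char (- of_int j * \<theta>) * G"
      unfolding G_def sum_distrib_left
      by (intro sum.cong refl) (simp add: ring_distribs unit_char_add[symmetric] mult.left_commute)
    finally show ?thesis .
  qed
  have "(\<Sum>n\<in>{a-2..<b}. of_real (g (n + 2) - 2 * g (n + 1) + g n) * unit_char (of_int n * \<theta>))
      = unit_char (- 2 * \<theta>) * G - 2 * (unit_char (- \<theta>) * G) + G"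
    using shift[of 2] shift[of 1] shift[of 0]
    by (simp add: ring_distribs sum.distrib sum_subtractf sum_distrib_left[symmetric] mult.assoc)
  also have "\<dots> = (1 - unit_char (- \<theta>))\<^sup>2 * G"
    using unit_char_add[of "-\<theta>" "-\<theta>"] by (simp add: power2_eq_square algebra_simps)
  finally have "(norm (1 - unit_char (-\<theta>)))\<^sup>2 * norm G
      = norm (\<Sum>n\<in>{a-2..<b}. of_real (g (n + 2) - 2 * g (n + 1) + g n) * unit_char (of_int n * \<theta>))"
    by (simp add: norm_mult norm_power)
  also have "\<dots> \<le> (\<Sum>n\<in>{a-2..<b}. \<bar>g (n + 2) - 2 * g (n + 1) + g n\<bar>)"
    by (intro order_trans[OF norm_sum] sum_mono) (simp add: norm_mult del: of_real_add of_real_diff of_real_mult)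
  also have "norm (1 - unit_char (-\<theta>)) = norm (1 - unit_char \<theta>)"
    by (metis cnj_unit_char complex_cnj_diff complex_cnj_one complex_mod_cnj)
  finally show ?thesis unfolding G_def .
qed

text \<open>The constants are those of a difference of two ramps of slope at most 1/L: each ramp has
  two corners, and each corner contributes at most 1/L to the second differences. Quantifying over
  finite sets F bounds the l^1 norm over all integers, hence also over any translate of a
  range.\<close>

definition bump :: "nat \<Rightarrow> int \<Rightarrow> (int \<Rightarrow> real) \<Rightarrow> bool" where
  "bump L a w \<longleftrightarrow> (\<forall>n. n \<notin> {a..<a + 4 * int L} \<longrightarrow> w n = 0) \<and> (\<forall>n. \<bar>w n\<bar> \<le> 1) \<and>
     (\<forall>n. \<bar>w (n + 1) - w n\<bar> \<le> 2 / L) \<and>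
     (\<forall>F. finite F \<longrightarrow> (\<Sum>n\<in>F. \<bar>w (n + 2) - 2 * w (n + 1) + w n\<bar>) \<le> 4 / L)"

text \<open>A product of two translates of the weight is again smooth at scale L, so two summations
  by parts give decay like (L ||theta||)^(-2). A sharp cutoff would only give min(L, 1/||theta||),
  whose sum over the shifts loses a logarithm.\<close>

lemma bump_correlation_bound:
  assumes w: "bump L a w" and L: "L \<ge> 1"
  shows "norm (\<Sum>n\<in>{a..<a + 4 * int L}. of_real (w n * w (n + h)) * unit_char (of_int n * \<theta>))
       \<le> 16 * real L / (1 + L * dist_int \<theta>)\<^sup>2"
proof -
  let ?A = "{a..<a + 4 * int L}"
  define G where "G = norm (\<Sum>n\<in>?A. of_real (w n * w (n + h)) * unit_char (of_int n * \<theta>))"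
  define t where "t = dist_int \<theta>"
  define d where "d = (\<lambda>n. w (n + 1) - w n)"
  define dd where "dd = (\<lambda>n. w (n + 2) - 2 * w (n + 1) + w n)"
  have supp: "\<And>n. n \<notin> ?A \<Longrightarrow> w n = 0" and w1: "\<And>n. \<bar>w n\<bar> \<le> 1"
    and d: "\<And>n. \<bar>d n\<bar> \<le> 2 / L" and dd: "\<And>F. finite F \<Longrightarrow> (\<Sum>n\<in>F. \<bar>dd n\<bar>) \<le> 4 / L"
    using w by (auto simp: bump_def d_def dd_def)
  have L0: "real L > 0" using L by simp
  have triv: "G \<le> 4 * real L"
  proof -
    have "G \<le> (\<Sum>n\<in>?A. 1)"
      unfolding G_def
    proof (intro order_trans[OF norm_sum] sum_mono)
      fix n show "norm (of_real (w n * w (n + h)) * unit_char (of_int n * \<theta>)) \<le> 1"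
        using mult_mono[OF w1[of n] w1[of "n + h"]] by (simp add: norm_mult)
    qed
    then show ?thesis by simp
  qed
  have "(4 * t)\<^sup>2 * G \<le> (norm (1 - unit_char \<theta>))\<^sup>2 * G"
    unfolding t_def using norm_one_minus_unit_char_ge by (intro mult_right_mono power_mono) (auto simp: G_def)
  also have "\<dots> \<le> (\<Sum>n\<in>{a-2..<a + 4 * int L}.
      \<bar>w (n + 2) * w (n + 2 + h) - 2 * (w (n + 1) * w (n + 1 + h)) + w n * w (n + h)\<bar>)"
    unfolding G_def by (rule second_difference_bound[of a _ "\<lambda>n. w n * w (n + h)"]) (simp add: supp)
  also have "\<dots> \<le> (\<Sum>n\<in>{a-2..<a + 4 * int L}. \<bar>dd n\<bar> + 2 * (2 / L * (2 / L)) + \<bar>dd (n + h)\<bar>)"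
  proof (rule sum_mono)
    fix n
    \<comment> \<open>Product rule for second differences. The mixed term is where the Lipschitz
      bound enters; it is O(L^(-2)) on a range of length O(L).\<close>
    have "w (n + 2) * w (n + 2 + h) - 2 * (w (n + 1) * w (n + 1 + h)) + w n * w (n + h)
        = dd n * w (n + h + 2) + 2 * (d n * d (n + h + 1)) + w n * dd (n + h)"
      unfolding d_def dd_def by (simp add: algebra_simps)
    also have "\<bar>\<dots>\<bar> \<le> \<bar>dd n * w (n + h + 2)\<bar> + \<bar>2 * (d n * d (n + h + 1))\<bar> + \<bar>w n * dd (n + h)\<bar>"
      by linarith
    also have "\<dots> \<le> \<bar>dd n\<bar> * 1 + 2 * (2 / L * (2 / L)) + 1 * \<bar>dd (n + h)\<bar>"
      unfolding abs_mult using w1 d by (intro add_mono mult_mono) auto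
    finally show "\<bar>w (n + 2) * w (n + 2 + h) - 2 * (w (n + 1) * w (n + 1 + h)) + w n * w (n + h)\<bar>
        \<le> \<bar>dd n\<bar> + 2 * (2 / L * (2 / L)) + \<bar>dd (n + h)\<bar>" by simp
  qed
  also have "\<dots> = (\<Sum>n\<in>{a-2..<a + 4 * int L}. \<bar>dd n\<bar>) + (4 * real L + 2) * (8 / L\<^sup>2)
      + (\<Sum>n\<in>{a-2..<a + 4 * int L}. \<bar>dd (n + h)\<bar>)"
    by (simp add: sum.distrib power2_eq_square)
  also have "(\<Sum>n\<in>{a-2..<a + 4 * int L}. \<bar>dd (n + h)\<bar>) = (\<Sum>n\<in>{a-2+h..<a + 4 * int L+h}. \<bar>dd n\<bar>)"
    by (rule sum.reindex_bij_witness[of _ "\<lambda>n. n - h" "\<lambda>n. n + h"]) auto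
  also have "(\<Sum>n\<in>{a-2..<a + 4 * int L}. \<bar>dd n\<bar>) + (4 * real L + 2) * (8 / L\<^sup>2) + (\<Sum>n\<in>{a-2+h..<a + 4 * int L+h}. \<bar>dd n\<bar>)
      \<le> 4 / L + (4 * real L + 2 * L) * (8 / L\<^sup>2) + 4 / L"
    using L by (intro add_mono dd mult_right_mono) auto
  also have "\<dots> = 56 / L" using L0 by (simp add: field_simps power2_eq_square)
  finally have main: "16 * t\<^sup>2 * G \<le> 56 / L" by (simp add: power_mult_distrib)
  have t0: "t \<ge> 0" by (simp add: t_def)
  \<comment> \<open>For L t <= 1 the trivial bound 4 L suffices, as (1 + L t)^2 <= 4. Otherwise (1 +
    L t)^2 <= 4 (L t)^2 and the difference bound gives 14 L.\<close>
  have "G * (1 + L * t)\<^sup>2 \<le> 16 * L"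
  proof (cases "L * t \<le> 1")
    case True
    then have "(1 + L * t)\<^sup>2 \<le> 2\<^sup>2" using t0 L0 by (intro power_mono) auto
    then have "G * (1 + L * t)\<^sup>2 \<le> 4 * real L * 4" using triv by (intro mult_mono) (auto simp: G_def)
    then show ?thesis by simp
  next
    case False
    then have "1 + L * t \<le> 2 * (L * t)" by linarith
    then have "(1 + L * t)\<^sup>2 \<le> (2 * (L * t))\<^sup>2" using t0 L0 by (intro power_mono) auto
    then have "G * (1 + L * t)\<^sup>2 \<le> G * (2 * (L * t))\<^sup>2" by (intro mult_left_mono) (auto simp: G_def)
    also have "\<dots> = (16 * t\<^sup>2 * G) * (L\<^sup>2 / 4)" by (simp add: power_mult_distrib)
    also have "\<dots> \<le> 56 / L * (L\<^sup>2 / 4)" using main by (intro mult_right_mono) auto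
    also have "\<dots> \<le> 16 * L" using L0 by (simp add: power2_eq_square)
    finally show ?thesis .
  qed
  moreover have "(1 + L * t)\<^sup>2 > 0" using t0 L0 by (intro zero_less_power add_pos_nonneg) auto
  ultimately show ?thesis unfolding G_def[symmetric] t_def[symmetric] by (simp add: pos_le_divide_eq)
qed

text \<open>Since (n + h)^2 - n^2 = 2 n h + h^2, the phase of the correlation is linear in n with
  frequency 2 h x, and the factor from h^2 has modulus 1. Shifts beyond 4 L contribute nothing
  because the supports no longer meet.\<close>

lemma weyl_differencing:
  assumes w: "bump L a w" and L: "L \<ge> 1"
  shows "(norm (\<Sum>n\<in>{a..<a + 4 * int L}. of_real (w n) * unit_char (of_int (n\<^sup>2) * x)))\<^sup>2
       \<le> (\<Sum>h\<in>{-4 * int L..4 * int L}. 16 * real L / (1 + L * dist_int (of_int (2 * h) * x))\<^sup>2)"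
proof -
  let ?c = "\<lambda>n h. of_real (w n * w (n + h)) * unit_char (of_int n * (of_int (2 * h) * x))"
  let ?e = "\<lambda>n. unit_char (of_int (n\<^sup>2) * x)"
  let ?A = "{a..<a + 4 * int L}" and ?H = "{-4 * int L..4 * int L}"
  define S where "S = (\<Sum>n\<in>?A. of_real (w n) * ?e n)"
  have supp: "\<And>n. n \<notin> ?A \<Longrightarrow> w n = 0" using w by (auto simp: bump_def)
  have S': "S = (\<Sum>h\<in>?H. of_real (w (n + h)) * ?e (n + h))" if n: "n \<in> ?A" for n
  proof -
    have "S = (\<Sum>m\<in>{n - 4 * int L..n + 4 * int L}. of_real (w m) * ?e m)"
      unfolding S_def using n by (intro sum.mono_neutral_left) (auto simp: supp)
    also have "\<dots> = (\<Sum>h\<in>?H. of_real (w (n + h)) * ?e (n + h))"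
      by (rule sum.reindex_bij_witness[of _ "\<lambda>h. n + h" "\<lambda>m. m - n"]) auto
    finally show ?thesis .
  qed
  have "of_real ((norm S)\<^sup>2) = cnj S * S" by (simp only: complex_norm_square mult.commute)
  also have "\<dots> = (\<Sum>n\<in>?A. cnj (of_real (w n) * ?e n) * S)"
    by (subst (1) S_def) (simp add: sum_distrib_right)
  also have "\<dots> = (\<Sum>n\<in>?A. \<Sum>h\<in>?H. ?e h * ?c n h)"
  proof (intro sum.cong refl)
    fix n assume n: "n \<in> ?A"
    have ph: "unit_char (- (of_int (n\<^sup>2) * x)) * ?e (n + h)
        = ?e h * unit_char (of_int n * (of_int (2 * h) * x))" for h
      unfolding unit_char_add[symmetric] by (simp add: power2_eq_square algebra_simps)
    show "cnj (of_real (w n) * ?e n) * S = (\<Sum>h\<in>?H. ?e h * ?c n h)"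
      unfolding S'[OF n] sum_distrib_left
    proof (intro sum.cong refl)
      fix h
      have "cnj (of_real (w n) * ?e n) * (of_real (w (n + h)) * ?e (n + h))
         = of_real (w n * w (n + h)) * (unit_char (- (of_int (n\<^sup>2) * x)) * ?e (n + h))"
        by (simp add: cnj_unit_char mult_ac)
      then show "cnj (of_real (w n) * ?e n) * (of_real (w (n + h)) * ?e (n + h))
         = ?e h * ?c n h"
        unfolding ph by (simp only: mult_ac)
    qed
  qed
  also have "\<dots> = (\<Sum>h\<in>?H. ?e h * (\<Sum>n\<in>?A. ?c n h))"
    by (subst sum.swap) (simp only: sum_distrib_left)
  finally have "norm (of_real ((norm S)\<^sup>2) :: complex) \<le> (\<Sum>h\<in>?H. norm (\<Sum>n\<in>?A. ?c n h))"
    by (simp only:) (intro order_trans[OF norm_sum] sum_mono, simp add: norm_mult)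
  also have "\<dots> \<le> (\<Sum>h\<in>?H. 16 * real L / (1 + L * dist_int (of_int (2 * h) * x))\<^sup>2)"
    by (intro sum_mono bump_correlation_bound[OF w L])
  finally show ?thesis unfolding S_def[symmetric] by (simp add: norm_power)
qed

subsection \<open>The pointwise bound near a rational\<close>

lemma sum_inverse_squares_le: "(\<Sum>r\<in>{1..<int m + 1}. 1 / (of_int r)\<^sup>2) \<le> (2::real)"
proof -
  \<comment> \<open>Strengthened by the term 1/(m + 1) so that the induction telescopes.\<close>
  have "(\<Sum>r\<in>{1..<int (Suc m) + 1}. 1 / (of_int r)\<^sup>2) \<le> (2::real) - 1 / (m + 1)" for m
  proof (induction m)
    case (Suc m)
    have *: "{1..<int (Suc (Suc m)) + 1} = insert (int m + 2) {1..<int (Suc m) + 1}" by auto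
    have "1 / (real m + 2)\<^sup>2 \<le> 1 / (real m + 1) - 1 / (real m + 2)"
    proof -
      have "1 / (real m + 2)\<^sup>2 \<le> 1 / ((real m + 1) * (real m + 2))"
        by (intro divide_left_mono) (auto simp: power2_eq_square intro!: mult_right_mono mult_pos_pos add_pos_nonneg)
      also have "\<dots> = 1 / (real m + 1) - 1 / (real m + 2)"
        by (simp add: divide_simps)
      finally show ?thesis .
    qed
    then show ?case using Suc.IH unfolding * by (simp add: add_ac)
  next
    case 0
    have "{1..<int (Suc 0) + 1} = {1}" by auto
    then show ?case by simp
  qed
  from this[of "m - 1"] show ?thesis
    by (cases m) (auto intro: order_trans)
qed

lemma sum_kernel_telescope:
  fixes c :: real
  assumes c: "c > 0"
  shows "(\<Sum>j\<in>{-int m..int m}. 1 / (1 + c * of_int \<bar>j\<bar>)\<^sup>2) \<le> 1 + 2 / c"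
proof -
  have "(\<Sum>j\<in>{-int m..int m}. 1 / (1 + c * of_int \<bar>j\<bar>)\<^sup>2) \<le> 1 + 2 / c * (1 - 1 / (1 + c * m))"
  proof (induction m)
    case (Suc m)
    have *: "{-int (Suc m)..int (Suc m)} = insert (int m + 1) (insert (- (int m + 1)) {-int m..int m})" by auto
    define u where "u = 1 + c * m"
    have u: "u \<ge> 1" using c by (simp add: u_def)
    \<comment> \<open>Each term is compared with the telescoping difference (1/u - 1/(u + c)) /
      c.\<close>
    have "1 / (u + c)\<^sup>2 \<le> 1 / (u * (u + c))"
      using u c by (intro divide_left_mono) (auto simp: power2_eq_square)
    also have "\<dots> = 1 / c * (1 / u - 1 / (u + c))"
      using u c by (simp add: divide_simps)
    finally have "2 * (1 / (u + c)\<^sup>2) \<le> 2 / c * (1 / u - 1 / (u + c))"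
      using mult_left_mono[of _ _ "2::real"] by fastforce
    moreover have "1 + c * (real m + 1) = u + c" by (simp add: u_def algebra_simps)
    ultimately show ?case using Suc.IH unfolding *
      by (simp add: u_def[symmetric] right_diff_distrib)
         (simp add: add_ac)
  qed simp
  also have "\<dots> \<le> 1 + 2 / c * 1"
    using c by (intro add_left_mono mult_left_mono) auto
  finally show ?thesis by simp
qed

lemma dist_int_fraction_mod:
  assumes "q > 0"
  shows "dist_int (of_int (k mod q) / of_int q) = dist_int (of_int k / of_int q)"
proof -
  have "of_int k = of_int q * of_int (k div q) + (of_int (k mod q) :: real)"
    by (simp flip: of_int_mult of_int_add)
  then have "of_int k / of_int q = of_int (k mod q) / of_int q + (of_int (k div q) :: real)"
    using assms by (simp add: field_simps)
  then show ?thesis by simp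
qed

text \<open>If the nearest integer to r/q is at most 0, the distance is at least r/q, and otherwise
  at least (q - r)/q; adding both inverse squares covers either case.\<close>

lemma inverse_dist_int_fraction_le:
  assumes r: "1 \<le> r" "r < q"
  shows "1 / (dist_int (of_int r / of_int q))\<^sup>2 \<le> (of_int q)\<^sup>2 * (1 / (of_int r)\<^sup>2 + 1 / (of_int (q - r))\<^sup>2)"
proof -
  obtain k where k: "dist_int (of_int r / of_int q) = \<bar>of_int r / of_int q - of_int k\<bar>" by (rule dist_int_attained)
  have aux: "1 / d\<^sup>2 \<le> (of_int q)\<^sup>2 * (1 / (of_int u)\<^sup>2)" if "u \<ge> 1" "of_int u / of_int q \<le> d" for u :: int and d :: real
  proof -
    have q: "(of_int q :: real) > 0" "(of_int u :: real) > 0" using r that by auto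
    have "0 < of_int u / (of_int q :: real)" using q by simp
    with that(2) have "1 / d\<^sup>2 \<le> 1 / (of_int u / of_int q)\<^sup>2"
      by (intro divide_left_mono power_mono mult_pos_pos zero_less_power) linarith+
    then show ?thesis by (simp add: power_divide)
  qed
  have q: "(of_int q :: real) > 0" using r by auto
  show ?thesis
  proof (cases "k \<le> 0")
    case True
    then have "of_int r / of_int q \<le> dist_int (of_int r / of_int q)"
      unfolding k using r by (intro order_trans[OF _ abs_ge_self]) auto
    from aux[OF r(1) this] show ?thesis by (simp add: distrib_left add_increasing2)
  next
    case False
    then have k1: "1 \<le> (of_int k :: real)" by linarith
    have "of_int (q - r) / of_int q = 1 - of_int r / (of_int q :: real)" using q by (simp add: field_simps)
    then have "of_int (q - r) / of_int q \<le> dist_int (of_int r / of_int q)"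
      unfolding k using k1 by linarith
    from aux[OF _ this] r show ?thesis by (simp add: distrib_left add_increasing)
  qed
qed

lemma sum_residues_inverse_dist_le:
  assumes q: "q > 0" and cop: "coprime a q"
  shows "(\<Sum>r\<in>{0..<q}. 1 / (dist_int (of_int (r * a) / of_int q))\<^sup>2) \<le> 4 * (of_int q)\<^sup>2"
proof -
  have S: "(\<Sum>r\<in>{1..<q}. 1 / (of_int r)\<^sup>2) \<le> (2::real)"
    using sum_inverse_squares_le[of "nat (q - 1)"] q by simp
  \<comment> \<open>The residue 0 has distance 0 and its term is 1 / 0 = 0, so this sum sees only
    nonzero residues; frequencies divisible by q need an estimate of their own.\<close>
  have "(\<Sum>r\<in>{0..<q}. 1 / (dist_int (of_int (r * a) / of_int q))\<^sup>2)
      = (\<Sum>r\<in>{1..<q}. 1 / (dist_int (of_int (r * a) / of_int q))\<^sup>2)"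
  proof (rule sum.mono_neutral_right)
    show "\<forall>r\<in>{0..<q} - {1..<q}. 1 / (dist_int (of_int (r * a) / of_int q))\<^sup>2 = 0"
    proof
      fix r assume "r \<in> {0..<q} - {1..<q}"
      then have "r = 0" by auto
      then show "1 / (dist_int (of_int (r * a) / of_int q))\<^sup>2 = 0" by (simp add: dist_int_def)
    qed
  qed auto
  also have "\<dots> = (\<Sum>r\<in>{1..<q}. 1 / (dist_int (of_int (a * r mod q) / of_int q))\<^sup>2)"
    using q by (simp add: dist_int_fraction_mod mult.commute del: of_int_mult)
  also have "\<dots> = (\<Sum>r\<in>{1..<q}. 1 / (dist_int (of_int r / of_int q))\<^sup>2)"
    by (rule sum.reindex_bij_betw[OF bij_betw_int_remainders_mult[OF cop]])
  also have "\<dots> \<le> (\<Sum>r\<in>{1..<q}. (of_int q)\<^sup>2 * (1 / (of_int r)\<^sup>2 + 1 / (of_int (q - r))\<^sup>2))"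
    by (intro sum_mono inverse_dist_int_fraction_le) auto
  also have "\<dots> = (of_int q)\<^sup>2 * ((\<Sum>r\<in>{1..<q}. 1 / (of_int r)\<^sup>2) + (\<Sum>r\<in>{1..<q}. 1 / (of_int (q - r))\<^sup>2))"
    by (simp only: sum_distrib_left[symmetric] sum.distrib)
  also have "(\<Sum>r\<in>{1..<q}. 1 / (of_int (q - r))\<^sup>2) = (\<Sum>r\<in>{1..<q}. 1 / (of_int r :: real)\<^sup>2)"
    by (rule sum.reindex_bij_witness[of _ "\<lambda>r. q - r" "\<lambda>r. q - r"]) auto
  also have "(of_int q)\<^sup>2 * ((\<Sum>r\<in>{1..<q}. 1 / (of_int r)\<^sup>2) + (\<Sum>r\<in>{1..<q}. 1 / (of_int r)\<^sup>2)) \<le> (of_int q)\<^sup>2 * (2 + 2 :: real)"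
    using S by (intro mult_left_mono add_mono) auto
  finally show ?thesis by simp
qed

text \<open>The interval from -K to K is covered by 2 (K div q) + 3 full periods.\<close>

lemma sum_periodic_le:
  fixes F :: "int \<Rightarrow> real"
  assumes q: "q > 0" and K: "K \<ge> 0" and F: "\<And>k. F k \<ge> 0" "\<And>k. F (k mod q) = F k"
  shows "(\<Sum>k\<in>{-K..K}. F k) \<le> (2 * of_int K / of_int q + 3) * (\<Sum>r\<in>{0..<q}. F r)"
proof -
  define J where "J = K div q + 1"
  define P where "P = {-J..J} \<times> {0..<q}"
  have "k \<in> (\<lambda>(j, r). q * j + r) ` P" if "k \<in> {-K..K}" for k
  proof (rule image_eqI[where x = "(k div q, k mod q)"])
    have "k div q \<le> K div q" using that q by (intro zdiv_mono1) auto
    moreover have "(-K) div q \<le> k div q" using that q by (intro zdiv_mono1) auto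
    moreover have "(-K) div q \<ge> - (K div q) - 1"
      using q by (simp add: zdiv_zminus1_eq_if)
    ultimately show "(k div q, k mod q) \<in> P" using q by (auto simp: P_def J_def)
  qed simp
  then have "(\<Sum>k\<in>{-K..K}. F k) \<le> sum F ((\<lambda>(j, r). q * j + r) ` P)"
    by (intro sum_mono2) (auto simp: P_def F)
  also have "\<dots> \<le> sum (F \<circ> (\<lambda>(j, r). q * j + r)) P"
    by (intro sum_image_le) (auto simp: P_def F)
  also have "\<dots> = (\<Sum>j\<in>{-J..J}. \<Sum>r\<in>{0..<q}. F (q * j + r))"
    by (simp add: P_def sum.cartesian_product comp_def case_prod_unfold)
  also have "\<dots> = (\<Sum>j\<in>{-J..J}. \<Sum>r\<in>{0..<q}. F r)"
  proof (intro sum.cong refl)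
    fix j r assume "r \<in> {0..<q}"
    then have "(q * j + r) mod q = r" by simp
    then show "F (q * j + r) = F r" by (metis F(2))
  qed
  also have "\<dots> = of_int (2 * J + 1) * (\<Sum>r\<in>{0..<q}. F r)"
    using K q by (simp add: J_def pos_imp_zdiv_nonneg_iff)
  also have "\<dots> \<le> (2 * of_int K / of_int q + 3) * (\<Sum>r\<in>{0..<q}. F r)"
  proof (intro mult_right_mono sum_nonneg F)
    have "real_of_int (K div q) \<le> of_int K / of_int q" by (rule real_of_int_div4)
    then show "of_int (2 * J + 1) \<le> 2 * of_int K / of_int q + (3::real)" by (simp add: J_def)
  qed
  finally show ?thesis .
qed

text \<open>Multiples of q and the other k behave differently. If q does not divide k, then kx is as
  far from the integers as ka/q up to a factor 2, and these terms add up to O(q). If k = q j, then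
  kx has distance exactly q |j| |x - a/q|, and these terms give O(L^2/q) or O(L + 1/(q |x - a/q|)),
  used according as |x - a/q| is below or above L^(-2).\<close>

lemma kernel_sum_major_arc:
  fixes x :: real
  assumes L: "L \<ge> 1" and q: "0 < q" "q \<le> 16 * int L" and cop: "coprime a q"
    and approx: "\<bar>of_int q * x - of_int a\<bar> < 1 / (16 * L)"
  shows "(\<Sum>k\<in>{-8 * int L..8 * int L}. 16 * real L / (1 + L * dist_int (of_int k * x))\<^sup>2)
       \<le> 10 ^ 7 / (of_int q * (1 / (real L)\<^sup>2 + \<bar>x - of_int a / of_int q\<bar>))"
proof -
  define \<beta> where "\<beta> = x - of_int a / of_int q"
  define f where "f = (\<lambda>k::int. 16 * real L / (1 + L * dist_int (of_int k * x))\<^sup>2)"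
  define Q where "Q = real_of_int q"
  let ?K = "{-8 * int L..8 * int L}"
  let ?D = "{k\<in>?K. q dvd k}"
  let ?N = "{k\<in>?K. \<not> q dvd k}"
  have Q: "Q \<ge> 1" "Q \<le> 16 * L" and L0: "real L \<ge> 1" using q L by (auto simp: Q_def)
  have x: "x = of_int a / Q + \<beta>" by (simp add: \<beta>_def Q_def)
  have "Q * \<beta> = of_int q * x - of_int a" using Q by (simp add: \<beta>_def Q_def right_diff_distrib)
  then have "\<bar>Q * \<beta>\<bar> < 1 / (16 * L)" using approx by simp
  then have \<beta>: "Q * \<bar>\<beta>\<bar> < 1 / (16 * L)" using Q by (simp add: abs_mult)
  \<comment> \<open>This is what the approximation level 16 L is for: with |k| <= 8 L the
    perturbation k \<beta> is at most half the spacing 1/q of the fractions.\<close>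
  have k\<beta>: "\<bar>of_int k * \<beta>\<bar> \<le> 1 / (2 * Q)" if "k \<in> ?K" for k
  proof -
    have "\<bar>of_int k\<bar> \<le> 8 * real L" using that by auto
    then have "\<bar>of_int k * \<beta>\<bar> \<le> 8 * real L * (1 / (16 * L) / Q)"
      unfolding abs_mult using \<beta> Q by (intro mult_mono) (auto simp: field_simps)
    also have "\<dots> = 1 / (2 * Q)" using L0 Q by (simp add: field_simps)
    finally show ?thesis .
  qed
  have f0: "f k \<ge> 0" for k by (simp add: f_def)
  have part1: "f k \<le> 64 / L * (1 / (dist_int (of_int (k * a) / of_int q))\<^sup>2)" if k: "k \<in> ?K" "\<not> q dvd k" for k
  proof -
    define d where "d = dist_int (of_int (k * a) / of_int q)"
    obtain j where j: "d = \<bar>of_int (k * a) / of_int q - of_int j\<bar>" unfolding d_def by (rule dist_int_attained)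
    have "\<not> q dvd k * a" using k cop by (simp add: coprime_commute coprime_dvd_mult_left_iff)
    then have "k * a - q * j \<noteq> 0" by (metis dvd_triv_left eq_iff_diff_eq_0)
    then have "1 \<le> \<bar>k * a - q * j\<bar>" by linarith
    then have "1 \<le> \<bar>real_of_int (k * a - q * j)\<bar>" by linarith
    moreover have "d * Q = \<bar>of_int (k * a - q * j)\<bar>"
      unfolding j Q_def using q by (simp add: abs_mult_pos' field_simps)
    ultimately have d: "1 / Q \<le> d" using Q by (simp add: field_simps)
    have "of_int k * x + - (of_int k * \<beta>) = of_int (k * a) / of_int q" by (simp add: x Q_def algebra_simps)
    with dist_int_add_le[of "of_int k * x" "- (of_int k * \<beta>)"]
    have "d \<le> dist_int (of_int k * x) + \<bar>of_int k * \<beta>\<bar>" unfolding d_def by simp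
    moreover define v where "v = 1 / Q"
    moreover have "1 / (2 * Q) = v / 2" by (simp add: v_def)
    ultimately have d2: "d / 2 \<le> dist_int (of_int k * x)" using d k\<beta>[OF k(1)] by linarith
    have d0: "d > 0" using d Q by (smt (verit) divide_pos_pos)
    have "L * (d / 2) \<le> 1 + L * dist_int (of_int k * x)"
      using mult_left_mono[OF d2, of L] by simp
    then have "(L * (d / 2))\<^sup>2 \<le> (1 + L * dist_int (of_int k * x))\<^sup>2"
      using d0 by (intro power_mono) auto
    moreover have "0 < 1 + L * dist_int (of_int k * x)" by (intro add_pos_nonneg) auto
    ultimately have "f k \<le> 16 * real L / (L * (d / 2))\<^sup>2"
      unfolding f_def using d0 L0 by (intro divide_left_mono mult_pos_pos zero_less_power) auto
    also have "\<dots> = 64 / L * (1 / d\<^sup>2)" using L0 d0 by (simp add: field_simps power2_eq_square)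
    finally show ?thesis unfolding d_def .
  qed
  have "(\<Sum>k\<in>?N. f k) \<le> (\<Sum>k\<in>?N. 64 / L * (1 / (dist_int (of_int (k * a) / of_int q))\<^sup>2))"
    by (intro sum_mono part1) auto
  also have "\<dots> \<le> (\<Sum>k\<in>?K. 64 / L * (1 / (dist_int (of_int (k * a) / of_int q))\<^sup>2))"
    by (intro sum_mono2) auto
  also have "\<dots> = 64 / L * (\<Sum>k\<in>{-(8 * int L)..8 * int L}. 1 / (dist_int (of_int (k * a) / of_int q))\<^sup>2)"
    by (simp only: sum_distrib_left mult_minus_left)
  also have "(\<Sum>k\<in>{-(8 * int L)..8 * int L}. 1 / (dist_int (of_int (k * a) / of_int q))\<^sup>2)
      \<le> (2 * of_int (8 * int L) / of_int q + 3) * (\<Sum>r\<in>{0..<q}. 1 / (dist_int (of_int (r * a) / of_int q))\<^sup>2)"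
  proof (rule sum_periodic_le)
    fix k
    show "1 / (dist_int (of_int (k mod q * a) / of_int q))\<^sup>2 = 1 / (dist_int (of_int (k * a) / of_int q))\<^sup>2"
      using dist_int_fraction_mod[OF q(1), of "k mod q * a"] dist_int_fraction_mod[OF q(1), of "k * a"]
      by (simp add: mod_mult_left_eq del: of_int_mult)
  qed (use q in auto)
  also have "\<dots> \<le> (2 * of_int (8 * int L) / of_int q + 3) * (4 * (of_int q)\<^sup>2)"
    using q by (intro mult_left_mono sum_residues_inverse_dist_le cop) auto
  also have "\<dots> \<le> (64 * L / Q) * (4 * Q\<^sup>2)"
    using Q by (intro mult_mono) (auto simp: Q_def field_simps)
  also have "\<dots> = 256 * (L * Q)" using Q by (simp add: field_simps power2_eq_square)
  finally have A: "(\<Sum>k\<in>?N. f k) \<le> 16384 * Q"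
    using L0 by (simp add: field_simps)
  define m where "m = nat (8 * int L div q)"
  have m: "int m = 8 * int L div q" using q by (simp add: m_def pos_imp_zdiv_nonneg_iff)
  let ?Y = "(\<Sum>j\<in>{-int m..int m}. 1 / (1 + L * Q * \<bar>\<beta>\<bar> * of_int \<bar>j\<bar>)\<^sup>2)"
  have "?D \<subseteq> (\<lambda>j. q * j) ` {-int m..int m}"
  proof
    fix k assume k: "k \<in> ?D"
    then obtain j where j: "k = q * j" by (auto elim: dvdE)
    have "q * i div q \<le> 8 * int L div q" if "q * i \<le> 8 * int L" for i
      using that q(1) by (rule zdiv_mono1)
    then have *: "i \<le> 8 * int L div q" if "q * i \<le> 8 * int L" for i
      using that q by (metis nonzero_mult_div_cancel_left less_irrefl)
    have "j \<le> 8 * int L div q" "- j \<le> 8 * int L div q"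
      using k unfolding j by (auto intro!: *)
    then show "k \<in> (\<lambda>j. q * j) ` {-int m..int m}" using j m by auto
  qed
  then have "(\<Sum>k\<in>?D. f k) \<le> (\<Sum>k\<in>(\<lambda>j. q * j) ` {-int m..int m}. f k)"
    by (intro sum_mono2 f0) auto
  also have "\<dots> \<le> (\<Sum>j\<in>{-int m..int m}. f (q * j))"
    by (intro order_trans[OF sum_image_le]) (auto simp: f0)
  also have "\<dots> = (\<Sum>j\<in>{-int m..int m}. 16 * real L * (1 / (1 + L * Q * \<bar>\<beta>\<bar> * of_int \<bar>j\<bar>)\<^sup>2))"
  proof (intro sum.cong refl)
    fix j assume j: "j \<in> {-int m..int m}"
    have "q * \<bar>j\<bar> \<le> q * (8 * int L div q)" using j m q by (intro mult_left_mono) auto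
    also have "\<dots> \<le> 8 * int L" using q by (simp add: minus_mod_eq_mult_div[symmetric])
    finally have "\<bar>q * j\<bar> \<le> 8 * int L" using q by (simp add: abs_mult)
    then have "\<bar>of_int (q * j) * \<beta>\<bar> \<le> 1 / (2 * Q)" by (intro k\<beta>) auto
    also have "\<dots> \<le> 1 / 2" using Q by simp
    finally have le: "\<bar>of_int (q * j) * \<beta>\<bar> \<le> 1 / 2" .
    have eq: "of_int (q * j) * x = of_int (q * j) * \<beta> + of_int (j * a)"
      using Q by (simp add: x Q_def field_simps)
    have "dist_int (of_int (q * j) * x) = \<bar>of_int (q * j) * \<beta>\<bar>"
      unfolding eq dist_int_add_int using dist_int_eqI[of "of_int (q * j) * \<beta>" 0] le by simp
    also have "\<dots> = Q * \<bar>\<beta>\<bar> * of_int \<bar>j\<bar>" using Q by (simp add: Q_def abs_mult)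
    finally show "f (q * j) = 16 * real L * (1 / (1 + L * Q * \<bar>\<beta>\<bar> * of_int \<bar>j\<bar>)\<^sup>2)"
      by (simp add: f_def mult.assoc)
  qed
  also have "\<dots> = 16 * real L * ?Y"
    by (simp only: sum_distrib_left)
  finally have Bd: "(\<Sum>k\<in>?D. f k) \<le> 16 * real L * ?Y" .
  have split: "(\<Sum>k\<in>?K. f k) = (\<Sum>k\<in>?N. f k) + (\<Sum>k\<in>?D. f k)"
  proof -
    have "finite ?N" "finite ?D" by (rule finite_subset[of _ ?K]; blast)+
    then have "sum f (?N \<union> ?D) = sum f ?N + sum f ?D"
      by (rule sum.union_disjoint) blast
    moreover have "?N \<union> ?D = ?K" by blast
    ultimately show ?thesis by (simp only:)
  qed
  have pos: "Q * (1 / (real L)\<^sup>2 + \<bar>\<beta>\<bar>) > 0" using Q L0 by (intro mult_pos_pos add_pos_nonneg) auto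
  have "(\<Sum>k\<in>?K. f k) * (Q * (1 / (real L)\<^sup>2 + \<bar>\<beta>\<bar>)) \<le> 10 ^ 7"
  \<comment> \<open>On the central arc the kernel is bounded trivially, and q <= 16 L lets the O(q)
    part be absorbed by L^2/q. Outside it, 1/(q |\<beta>|) is at least 16 L and absorbs both q and
    L.\<close>
  proof (cases "\<bar>\<beta>\<bar> \<le> 1 / (real L)\<^sup>2")
    case True
    have "?Y \<le> (\<Sum>j\<in>{-int m..int m}. 1)"
      using Q by (intro sum_mono) (auto simp: divide_le_eq_1 intro!: one_le_power)
    also have "\<dots> = 2 * real m + 1" by simp
    also have "\<dots> \<le> 32 * L / Q"
    proof -
      have "real m = of_int (8 * int L div q)" unfolding m[symmetric] by simp
      also have "\<dots> \<le> 8 * L / Q" using real_of_int_div4[of "8 * int L" q] unfolding Q_def by simp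
      finally show ?thesis using Q by (simp add: field_simps)
    qed
    finally have "16 * real L * ?Y \<le> 16 * real L * (32 * L / Q)"
      by (intro mult_left_mono) auto
    then have "(\<Sum>k\<in>?K. f k) \<le> 16384 * Q + 16 * real L * (32 * L / Q)" using A Bd split by linarith
    also have "\<dots> \<le> 16384 * (256 * (real L)\<^sup>2 / Q) + 16 * real L * (32 * L / Q)"
    proof -
      have "Q * Q \<le> real (16 * L) * real (16 * L)" using Q by (intro mult_mono) auto
      then show ?thesis using Q by (simp add: field_simps power2_eq_square)
    qed
    also have "\<dots> = 4194816 * ((real L)\<^sup>2 / Q)" by (simp add: power2_eq_square)
    finally have "(\<Sum>k\<in>?K. f k) * (Q * (1 / (real L)\<^sup>2 + \<bar>\<beta>\<bar>)) \<le> 4194816 * ((real L)\<^sup>2 / Q) * (Q * (1 / (real L)\<^sup>2 + 1 / (real L)\<^sup>2))"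
      using True Q by (intro mult_mono add_left_mono) (auto intro!: sum_nonneg f0)
    also have "\<dots> = 8389632" using Q L0 by (simp add: field_simps)
    finally show ?thesis by simp
  next
    case False
    moreover have "1 / (real L)\<^sup>2 > 0" using L0 by simp
    ultimately have b: "\<bar>\<beta>\<bar> > 0" by linarith
    define g where "g = 1 / (Q * \<bar>\<beta>\<bar>)"
    have qb: "Q * \<bar>\<beta>\<bar> > 0" using Q b by (intro mult_pos_pos) auto
    have g: "16 * L \<le> g" using \<beta> qb L0 by (simp add: g_def field_simps)
    have "?Y \<le> 1 + 2 / (L * Q * \<bar>\<beta>\<bar>)"
      using L0 Q b by (intro sum_kernel_telescope mult_pos_pos) auto
    then have "16 * real L * ?Y \<le> 16 * real L * (1 + 2 / (L * Q * \<bar>\<beta>\<bar>))"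
      by (intro mult_left_mono) auto
    also have "\<dots> = 16 * L + 32 * g" using L0 qb by (simp add: g_def field_simps)
    finally have "(\<Sum>k\<in>?K. f k) \<le> 16417 * g" using A Bd split g Q by linarith
    then have "(\<Sum>k\<in>?K. f k) * (Q * (1 / (real L)\<^sup>2 + \<bar>\<beta>\<bar>)) \<le> 16417 * g * (Q * (\<bar>\<beta>\<bar> + \<bar>\<beta>\<bar>))"
      using False Q qb by (intro mult_mono add_right_mono) (auto simp: g_def)
    also have "\<dots> = 32834 * ((Q * \<bar>\<beta>\<bar>) / (Q * \<bar>\<beta>\<bar>))" by (simp add: g_def field_simps)
    also have "\<dots> = 32834" using qb by (metis divide_self less_irrefl mult.right_neutral)
    finally show ?thesis by simp
  qed
  then show ?thesis using pos unfolding f_def[symmetric] \<beta>_def[symmetric] unfolding Q_def[symmetric]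
    by (simp add: pos_le_divide_eq)
qed

lemma bump_sum_pointwise:
  assumes w: "bump L b w" and L: "L \<ge> 1" and x: "x \<in> {0..1}"
  obtains q a :: nat where "1 \<le> q" "q \<le> 16 * L" "a \<le> q"
    "(norm (\<Sum>n\<in>{b..<b + 4 * int L}. of_real (w n) * unit_char (of_int (n\<^sup>2) * x)))\<^sup>2
     \<le> 10 ^ 7 / (q * (1 / (real L)\<^sup>2 + \<bar>x - a / q\<bar>))"
proof -
  let ?H = "{-4 * int L..4 * int L}"
  let ?S2 = "(norm (\<Sum>n\<in>{b..<b + 4 * int L}. of_real (w n) * unit_char (of_int (n\<^sup>2) * x)))\<^sup>2"
  obtain h k where hk: "coprime h k" "0 < k" "k \<le> int (16 * L)" "\<bar>of_int k * x - of_int h\<bar> < 1 / (16 * L)"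
    using Dirichlet_approx_coprime[of "16 * L" x] L by auto
  \<comment> \<open>Since x lies in [0, 1] and the error is below 1, the numerator lies between 0
    and k, so both integers can be taken as natural numbers.\<close>
  have "\<bar>of_int k * x - of_int h\<bar> < 1" using hk(4) L by (auto elim!: order_less_le_trans)
  moreover have "0 \<le> of_int k * x" "of_int k * x \<le> of_int k * 1" using x hk(2) by (auto intro!: mult_left_mono)
  ultimately have "of_int h > (-1::real)" "(of_int h :: real) < of_int k + 1" by linarith+
  then have h: "h \<ge> 0" "h \<le> k" by linarith+
  have "?S2
      \<le> (\<Sum>h\<in>?H. 16 * real L / (1 + L * dist_int (of_int (2 * h) * x))\<^sup>2)"
    by (rule weyl_differencing[OF w L])
  also have "\<dots> = (\<Sum>k\<in>(\<lambda>h. 2 * h) ` ?H. 16 * real L / (1 + L * dist_int (of_int k * x))\<^sup>2)"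
    by (subst sum.reindex) (auto simp: inj_on_def)
  \<comment> \<open>Only even frequencies occur; admitting the odd ones as well keeps the parity of
    q out of the argument.\<close>
  also have "\<dots> \<le> (\<Sum>k\<in>{-8 * int L..8 * int L}. 16 * real L / (1 + L * dist_int (of_int k * x))\<^sup>2)"
    by (intro sum_mono2) auto
  also have "\<dots> \<le> 10 ^ 7 / (of_int k * (1 / (real L)\<^sup>2 + \<bar>x - of_int h / of_int k\<bar>))"
    using hk by (intro kernel_sum_major_arc L) auto
  finally show ?thesis
    using hk h by (intro that[of "nat k" "nat h"]) auto
qed

subsection \<open>Integrating the pointwise bound\<close>

lemma integral_shifted_powr_le:
  fixes \<delta> \<rho> b :: real
  assumes \<delta>: "\<delta> > 0" and \<rho>: "\<rho> > 1" and b: "b \<in> {0..1}"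
  shows "(\<lambda>x. (\<delta> + \<bar>x - b\<bar>) powr (-\<rho>)) integrable_on {0..1}"
    and "integral {0..1} (\<lambda>x. (\<delta> + \<bar>x - b\<bar>) powr (-\<rho>)) \<le> 2 * \<delta> powr (1 - \<rho>) / (\<rho> - 1)"
proof -
  let ?f = "\<lambda>x. (\<delta> + \<bar>x - b\<bar>) powr (-\<rho>)"
  let ?F = "\<lambda>x. (\<delta> + b - x) powr (1 - \<rho>) / (\<rho> - 1)"
  let ?G = "\<lambda>x. - ((\<delta> + x - b) powr (1 - \<rho>) / (\<rho> - 1))"
  \<comment> \<open>In expanded form this is the denominator left by the quotient rule in the two
    derivative computations.\<close>
  have "(\<rho> - 1)\<^sup>2 \<noteq> 0" using \<rho> by simp
  then have nz: "1 + \<rho> * \<rho> - \<rho> * 2 \<noteq> 0" by (simp add: power2_eq_square algebra_simps)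
  have "continuous_on {0..1} ?f"
    using \<delta> by (intro continuous_intros) (auto simp: add_nonneg_eq_0_iff)
  then show int: "?f integrable_on {0..1}" by (rule integrable_continuous_real)
  have "((\<lambda>x. (\<delta> + b - x) powr (-\<rho>)) has_integral (?F b - ?F 0)) {0..b}"
  proof (rule fundamental_theorem_of_calculus)
    fix x assume "x \<in> {0..b}"
    then have "(?F has_real_derivative (\<delta> + b - x) powr (-\<rho>)) (at x within {0..b})"
      using \<delta> \<rho> nz by (auto intro!: derivative_eq_intros simp: field_simps)
    then show "(?F has_vector_derivative (\<delta> + b - x) powr (-\<rho>)) (at x within {0..b})"
      by (simp add: has_real_derivative_iff_has_vector_derivative)
  qed (use b in auto)
  then have 1: "(?f has_integral (?F b - ?F 0)) {0..b}"
    by (rule has_integral_eq[rotated]) (simp add: algebra_simps)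
  have "((\<lambda>x. (\<delta> + x - b) powr (-\<rho>)) has_integral (?G 1 - ?G b)) {b..1}"
  proof (rule fundamental_theorem_of_calculus)
    fix x assume "x \<in> {b..1}"
    then have "(?G has_real_derivative (\<delta> + x - b) powr (-\<rho>)) (at x within {b..1})"
      using \<delta> \<rho> nz by (auto intro!: derivative_eq_intros simp: field_simps)
    then show "(?G has_vector_derivative (\<delta> + x - b) powr (-\<rho>)) (at x within {b..1})"
      by (simp add: has_real_derivative_iff_has_vector_derivative)
  qed (use b in auto)
  then have 2: "(?f has_integral (?G 1 - ?G b)) {b..1}"
    by (rule has_integral_eq[rotated]) (simp add: algebra_simps)
  have "(?f has_integral ((?F b - ?F 0) + (?G 1 - ?G b))) {0..1}"
    using b by (intro has_integral_combine[OF _ _ 1 2]) auto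
  then have "integral {0..1} ?f = (?F b - ?F 0) + (?G 1 - ?G b)" by (rule integral_unique)
  also have "\<dots> \<le> ?F b - ?G b"
  proof -
    have "?F 0 \<ge> 0" "?G 1 \<le> 0" using \<rho> by auto
    then show ?thesis by linarith
  qed
  also have "\<dots> = 2 * \<delta> powr (1 - \<rho>) / (\<rho> - 1)" by simp
  finally show "integral {0..1} ?f \<le> 2 * \<delta> powr (1 - \<rho>) / (\<rho> - 1)" .
qed

lemma continuous_on_exponential_sum:
  "continuous_on S (\<lambda>x. \<Sum>n\<in>A. c n * unit_char (f n * x))"
  by (intro continuous_intros)

text \<open>The fraction attached to x need not depend measurably on x: its majorant is dominated by
  the sum over all a/q. Each arc integrates to at most a constant times q^(-r/2) L^(r-2), which uses
  r/2 > 1, and there are q + 1 <= 2 q numerators.\<close>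

lemma bump_sum_Lp_integral_le:
  assumes w: "bump L b w" and L: "L \<ge> 1" and r: "r > 2"
  shows "Lp_integral r (\<lambda>x. \<Sum>n\<in>{b..<b + 4 * int L}. of_real (w n) * unit_char (of_int (n\<^sup>2) * x))
     \<le> 4 * (10 ^ 7) powr (r / 2) / (r / 2 - 1) * real L powr (r - 2) * (\<Sum>q\<in>{1..16 * L}. real q powr (1 - r / 2))"
proof -
  define S where "S = (\<lambda>x. \<Sum>n\<in>{b..<b + 4 * int L}. of_real (w n) * unit_char (of_int (n\<^sup>2) * x))"
  define \<delta> where "\<delta> = 1 / (real L)\<^sup>2"
  define c where "c = ((10::real) ^ 7) powr (r / 2)"
  define h where "h = (\<lambda>(q::nat) (a::nat) x. c * real q powr (-(r/2)) * (\<delta> + \<bar>x - a / q\<bar>) powr (-(r/2)))"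
  have \<delta>: "\<delta> > 0" using L by (simp add: \<delta>_def)
  let ?t = "\<lambda>q. c * real q powr (-(r/2)) * (2 * \<delta> powr (1 - r/2) / (r/2 - 1))"
  have h0: "h q a x \<ge> 0" for q a x by (simp add: h_def c_def)
  have pw: "norm (S x) powr r \<le> (\<Sum>q\<in>{1..16 * L}. \<Sum>a\<in>{0..q}. h q a x)" if x: "x \<in> {0..1}" for x
  proof -
    obtain q a :: nat where qa: "1 \<le> q" "q \<le> 16 * L" "a \<le> q"
      and le: "(norm (S x))\<^sup>2 \<le> 10 ^ 7 / (q * (\<delta> + \<bar>x - a / q\<bar>))"
      unfolding S_def \<delta>_def using bump_sum_pointwise[OF w L x] by blast
    have "(norm (S x))\<^sup>2 = norm (S x) powr 2" by (cases "S x = 0") auto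
    then have "norm (S x) powr r = ((norm (S x))\<^sup>2) powr (r / 2)"
      by (simp only: powr_powr) simp
    also have "\<dots> \<le> (10 ^ 7 / (q * (\<delta> + \<bar>x - a / q\<bar>))) powr (r / 2)"
      by (rule powr_mono2[OF _ _ le]) (use r in simp_all)
    also have "\<dots> = h q a x"
    proof -
      define T where "T = (10::real) ^ 7"
      have "(T / (q * (\<delta> + \<bar>x - a / q\<bar>))) powr (r / 2) = T powr (r/2) * real q powr (-(r/2)) * (\<delta> + \<bar>x - a / q\<bar>) powr (-(r/2))"
        unfolding divide_inverse[of T] powr_mult inverse_mult_distrib
        by (simp add: powr_minus inverse_powr mult.assoc)
      then show ?thesis unfolding h_def c_def T_def .
    qed
    also have "\<dots> \<le> (\<Sum>a\<in>{0..q}. h q a x)"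
      using qa by (intro member_le_sum h0) auto
    also have "\<dots> \<le> (\<Sum>q\<in>{1..16 * L}. \<Sum>a\<in>{0..q}. h q a x)"
      using qa by (intro member_le_sum[of q _ "\<lambda>q. \<Sum>a\<in>{0..q}. h q a x"] sum_nonneg h0) auto
    finally show ?thesis .
  qed
  have frac: "real a / real q \<in> {0..1}" if "q \<in> {1..16 * L}" "a \<in> {0..q}" for q a
    using that by (auto simp: divide_le_eq_1)
  have inth: "h q a integrable_on {0..1}" if "q \<in> {1..16 * L}" "a \<in> {0..q}" for q a
    unfolding h_def using r \<delta> frac[OF that] by (intro integrable_on_mult_right integral_shifted_powr_le) auto
  have "Lp_integral r S \<le> integral {0..1} (\<lambda>x. \<Sum>q\<in>{1..16 * L}. \<Sum>a\<in>{0..q}. h q a x)"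
    unfolding Lp_integral_def
  proof (intro integral_le norm_powr_integrable integrable_sum inth pw)
    show "continuous_on {0..1} S" unfolding S_def by (rule continuous_on_exponential_sum)
  qed (use r in auto)
  also have "\<dots> = (\<Sum>q\<in>{1..16 * L}. \<Sum>a\<in>{0..q}. integral {0..1} (h q a))"
    by (subst integral_sum) (auto intro!: integrable_sum inth sum.cong integral_sum)
  also have "\<dots> \<le> (\<Sum>q\<in>{1..16 * L}. \<Sum>a\<in>{0..q}. ?t q)"
  proof (intro sum_mono)
    fix q a assume qa: "q \<in> {1..16 * L}" "a \<in> {0..q}"
    have "integral {0..1} (h q a) = c * real q powr (-(r/2)) * integral {0..1} (\<lambda>x. (\<delta> + \<bar>x - a / q\<bar>) powr (-(r/2)))"
      by (simp add: h_def)
    also have "\<dots> \<le> ?t q"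
      using r \<delta> frac[OF qa] by (intro mult_left_mono integral_shifted_powr_le) (auto simp: c_def)
    finally show "integral {0..1} (h q a) \<le> ?t q" .
  qed
  also have "\<dots> \<le> (\<Sum>q\<in>{1..16 * L}. 4 * c / (r/2 - 1) * \<delta> powr (1 - r/2) * real q powr (1 - r/2))"
  proof (intro sum_mono)
    fix q assume q: "q \<in> {1..16 * L}"
    have "(\<Sum>a\<in>{0..q}. ?t q)
       = (real q + 1) * ?t q" by simp
    also have "\<dots> \<le> (2 * real q) * ?t q"
      using q r by (intro mult_right_mono) (auto simp: c_def)
    also have "\<dots> = 4 * c / (r/2 - 1) * \<delta> powr (1 - r/2) * (real q powr 1 * real q powr (-(r/2)))"
      by simp
    also have "real q powr 1 * real q powr (-(r/2)) = real q powr (1 - r/2)"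
      by (simp only: powr_add[symmetric]) simp
    finally show "(\<Sum>a\<in>{0..q}. ?t q)
       \<le> 4 * c / (r/2 - 1) * \<delta> powr (1 - r/2) * real q powr (1 - r/2)" .
  qed
  also have "\<dots> = 4 * c / (r/2 - 1) * \<delta> powr (1 - r/2) * (\<Sum>q\<in>{1..16 * L}. real q powr (1 - r/2))"
    by (simp only: sum_distrib_left)
  also have "\<delta> powr (1 - r/2) = real L powr (r - 2)"
  proof -
    have "\<delta> = real L powr (-2)" using L by (simp add: \<delta>_def powr_minus divide_inverse)
    then show ?thesis by (simp add: powr_powr)
  qed
  finally show ?thesis unfolding S_def c_def .
qed

section \<open>Sums over denominators and the resulting growth rate\<close>

lemma powr_diff_ge:
  fixes y z \<theta> :: real
  assumes "0 \<le> z" "z \<le> y" "0 < y" "0 < \<theta>" "\<theta> \<le> 1"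
  shows "\<theta> * y powr (\<theta> - 1) * (y - z) \<le> y powr \<theta> - z powr \<theta>"
proof (cases "z = 0 \<or> z = y")
  case True
  then show ?thesis
  proof
    assume "z = 0"
    have "\<theta> * y powr (\<theta> - 1) * y = \<theta> * y powr \<theta>" using assms by (simp add: powr_diff)
    also have "\<dots> \<le> 1 * y powr \<theta>" using assms by (intro mult_right_mono) auto
    finally show ?thesis using \<open>z = 0\<close> assms by simp
  qed simp
next
  case False
  then have z: "0 < z" "z < y" using assms by auto
  obtain u where u: "z < u" "u < y" "y powr \<theta> - z powr \<theta> = (y - z) * (\<theta> * u powr (\<theta> - 1))"
    using MVT2[of z y "\<lambda>x. x powr \<theta>" "\<lambda>x. \<theta> * x powr (\<theta> - 1)"] z
    by (metis has_real_derivative_powr less_le_trans)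
  have "y powr (\<theta> - 1) \<le> u powr (\<theta> - 1)" using u z assms by (intro powr_mono2') auto
  then have "(y - z) * (\<theta> * y powr (\<theta> - 1)) \<le> (y - z) * (\<theta> * u powr (\<theta> - 1))"
    using z assms by (intro mult_left_mono) auto
  then show ?thesis using u by (simp add: mult_ac)
qed

lemma sum_powr_le:
  fixes \<theta> :: real
  assumes "0 < \<theta>" "\<theta> \<le> 1"
  shows "(\<Sum>q\<in>{1..n::nat}. real q powr (\<theta> - 1)) \<le> real n powr \<theta> / \<theta>"
proof (induction n)
  case (Suc n)
  have "\<theta> * real (Suc n) powr (\<theta> - 1) * (real (Suc n) - real n) \<le> real (Suc n) powr \<theta> - real n powr \<theta>"
    using assms by (intro powr_diff_ge) auto
  then have "real (Suc n) powr (\<theta> - 1) \<le> (real (Suc n) powr \<theta> - real n powr \<theta>) / \<theta>"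
    using assms by (simp add: field_simps)
  then show ?case using Suc.IH by (simp add: diff_divide_distrib)
qed simp

lemma sum_inverse_le_ln:
  assumes "n \<ge> 1"
  shows "(\<Sum>q\<in>{1..n::nat}. 1 / real q) \<le> 1 + ln n"
  using assms
proof (induction n rule: dec_induct)
  case (step n)
  have "ln (real n) - ln (real (Suc n)) \<le> (real n - real (Suc n)) / real (Suc n)"
    using step by (intro ln_diff_le) auto
  then show ?case using step by (simp add: diff_divide_distrib)
qed simp

text \<open>The order of the upper bound for the L^r norm of a quadratic Weyl sum over n consecutive
  integers: square-root cancellation up to r = 4, peaks at fractions of small denominator beyond.
  Writing 1 + ln n keeps the value positive at n = 1.\<close>

definition weyl_growth :: "real \<Rightarrow> real \<Rightarrow> real" where
  "weyl_growth r n = n powr max (1/2) (1 - 2/r) * (if r = 4 then (1 + ln n) powr (1/4) else 1)"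

lemma weyl_growth_pos:
  assumes "n \<ge> 1" shows "weyl_growth r n > 0"
proof -
  have "ln n \<ge> 0" using assms by simp
  then have "1 + ln n \<noteq> 0" by linarith
  then show ?thesis using assms by (auto simp: weyl_growth_def)
qed

text \<open>For r < 4 the large denominators q ~ L dominate, at r = 4 the sum is harmonic, and for r
  > 4 it converges. Multiplied by L^(r-2), each outcome is the r-th power of
  \<open>weyl_growth\<close> up to a constant.\<close>

lemma denominator_sum_le:
  assumes r: "r \<ge> 3"
  shows "\<exists>K>0. \<forall>L::nat. L \<ge> 1 \<longrightarrow>
     real L powr (r - 2) * (\<Sum>q\<in>{1..16 * L}. real q powr (1 - r / 2)) \<le> K * weyl_growth r L powr r"
proof -
  let ?S = "\<lambda>L. real L powr (r - 2) * (\<Sum>q\<in>{1..16 * L}. real q powr (1 - r / 2))"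
  consider "r < 4" | "r = 4" | "r > 4" by linarith
  then show ?thesis
  proof cases
    case 1
    define \<theta> where "\<theta> = 2 - r/2"
    have \<theta>: "0 < \<theta>" "\<theta> \<le> 1" using 1 r by (auto simp: \<theta>_def)
    have mx: "max (1/2) (1 - 2/r) = 1/2" using 1 r by (simp add: max_def field_simps)
    show ?thesis
    proof (intro exI[of _ "16 powr \<theta> / \<theta>"] conjI allI impI)
      fix L :: nat assume L: "L \<ge> 1"
      have "(\<Sum>q\<in>{1..16 * L}. real q powr (1 - r / 2)) \<le> real (16 * L) powr \<theta> / \<theta>"
        using sum_powr_le[OF \<theta>, of "16 * L"] by (simp add: \<theta>_def)
      then have "?S L
           \<le> real L powr (r - 2) * (real (16 * L) powr \<theta> / \<theta>)" by (intro mult_left_mono) auto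
      also have "\<dots> = 16 powr \<theta> / \<theta> * (real L powr (r - 2) * real L powr \<theta>)"
        by (simp add: powr_mult)
      also have "real L powr (r - 2) * real L powr \<theta> = weyl_growth r L powr r"
        using 1 by (simp add: weyl_growth_def mx powr_powr \<theta>_def flip: powr_add)
      finally show "?S L
         \<le> 16 powr \<theta> / \<theta> * weyl_growth r L powr r" .
    qed (use \<theta> in auto)
  next
    case 2
    have "ln 16 > (0::real)" by simp
    then have pos: "1 + ln 16 > (0::real)" by linarith
    show ?thesis
    proof (intro exI[of _ "1 + ln 16"] conjI allI impI)
      fix L :: nat assume L: "L \<ge> 1"
      have "(\<Sum>q\<in>{1..16 * L}. real q powr (1 - r / 2)) = (\<Sum>q\<in>{1..16 * L}. 1 / real q)"
        unfolding 2 by (intro sum.cong) (auto simp: powr_minus_divide)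
      also have "\<dots> \<le> 1 + ln (real (16 * L))" using L by (intro sum_inverse_le_ln) auto
      also have "\<dots> = 1 + ln 16 + ln L" using L by (simp add: ln_mult)
      also have "\<dots> \<le> (1 + ln 16) * (1 + ln L)"
        using L \<open>ln 16 > (0::real)\<close> by (simp add: algebra_simps)
      finally have "?S L
           \<le> real L powr (r - 2) * ((1 + ln 16) * (1 + ln L))" by (intro mult_left_mono) auto
      also have "\<dots> = (1 + ln 16) * weyl_growth r L powr r"
        using L 2 by (simp add: weyl_growth_def powr_mult powr_powr add_nonneg_nonneg)
      finally show "?S L
         \<le> (1 + ln 16) * weyl_growth r L powr r" .
    qed (rule pos)
  next
    case 3
    have sm: "summable (\<lambda>n. real n powr (1 - r/2))"
      using 3 by (simp add: summable_real_powr_iff)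
    have mx: "max (1/2) (1 - 2/r) = 1 - 2/r" using 3 by (simp add: max_def field_simps)
    define K where "K = (\<Sum>n. real n powr (1 - r/2)) + 1"
    have K: "K > 0" unfolding K_def using suminf_nonneg[OF sm] by simp
    show ?thesis
    proof (intro exI[of _ K] conjI allI impI K)
      fix L :: nat assume L: "L \<ge> 1"
      have "(\<Sum>q\<in>{1..16 * L}. real q powr (1 - r / 2)) \<le> K"
        unfolding K_def using sum_le_suminf[OF sm, of "{1..16 * L}"] by simp
      then have "?S L
         \<le> real L powr (r - 2) * K" by (intro mult_left_mono) auto
      also have "\<dots> = K * weyl_growth r L powr r"
        using 3 by (simp add: weyl_growth_def mx powr_powr left_diff_distrib)
      finally show "?S L
         \<le> K * weyl_growth r L powr r" .
    qed
  qed
qed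

lemma bump_sum_growth:
  assumes r: "r \<ge> 3"
  shows "\<exists>K>0. \<forall>L b w. bump L b w \<longrightarrow> L \<ge> 1 \<longrightarrow>
     Lp_integral r (\<lambda>x. \<Sum>n\<in>{b..<b + 4 * int L}. of_real (w n) * unit_char (of_int (n\<^sup>2) * x))
     \<le> (K * weyl_growth r L) powr r"
proof -
  let ?J = "\<lambda>L b w. Lp_integral r (\<lambda>x. \<Sum>n\<in>{b..<b + 4 * int L}. of_real (w n) * unit_char (of_int (n\<^sup>2) * x))"
  obtain K where K: "K > 0" and le: "\<And>L::nat. L \<ge> 1 \<Longrightarrow>
     real L powr (r - 2) * (\<Sum>q\<in>{1..16 * L}. real q powr (1 - r / 2)) \<le> K * weyl_growth r L powr r"
    using denominator_sum_le[OF r] by blast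
  define A where "A = 4 * (10 ^ 7) powr (r / 2) / (r / 2 - 1)"
  have A: "A > 0" using r by (simp add: A_def)
  show ?thesis
  proof (intro exI[of _ "(A * K) powr (1 / r)"] conjI allI impI)
    fix L b w assume w: "bump L b w" and L: "L \<ge> 1"
    have "?J L b w
      \<le> A * real L powr (r - 2) * (\<Sum>q\<in>{1..16 * L}. real q powr (1 - r / 2))"
      unfolding A_def using r by (intro bump_sum_Lp_integral_le w L) auto
    also have "\<dots> \<le> A * (K * weyl_growth r L powr r)"
      unfolding mult.assoc using A le[OF L] by (intro mult_left_mono) auto
    also have "\<dots> = ((A * K) powr (1 / r) * weyl_growth r L) powr r"
      using A K r weyl_growth_pos[of "real L" r] L by (simp add: powr_mult powr_powr less_imp_le)
    finally show "?J L b w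
      \<le> ((A * K) powr (1 / r) * weyl_growth r L) powr r" .
  qed (use A K in auto)
qed

subsection \<open>Sharp cutoffs as sums of bumps at dyadic scales\<close>

text \<open>The shift by 1 makes \<open>ramp 1\<close> exactly the indicator of the nonnegative
  integers, so the sharp cutoff is itself the narrowest ramp.\<close>

definition ramp :: "nat \<Rightarrow> int \<Rightarrow> real" where
  "ramp m n = max 0 (min 1 ((of_int n + 1) / m))"

lemma ramp_bounds: "0 \<le> ramp m n" "ramp m n \<le> 1"
  by (auto simp: ramp_def)

lemma ramp_eq_0: "n < 0 \<Longrightarrow> ramp m n = 0"
proof -
  assume "n < 0"
  then have "of_int n + 1 \<le> (0::real)" by linarith
  then have "(of_int n + 1) / real m \<le> 0" by (simp add: divide_nonpos_nonneg)
  then show ?thesis by (simp add: ramp_def)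
qed

lemma ramp_eq_1: "m \<ge> 1 \<Longrightarrow> n \<ge> int m - 1 \<Longrightarrow> ramp m n = 1"
proof -
  assume a: "m \<ge> 1" "n \<ge> int m - 1"
  then have "real m \<le> of_int n + 1" by linarith
  then have "1 \<le> (of_int n + 1) / real m" using a by (simp add: le_divide_eq)
  then show ?thesis by (simp add: ramp_def)
qed

lemma ramp_linear: "m \<ge> 1 \<Longrightarrow> -1 \<le> n \<Longrightarrow> n \<le> int m - 1 \<Longrightarrow> ramp m n = (of_int n + 1) / m"
proof -
  assume a: "m \<ge> 1" "-1 \<le> n" "n \<le> int m - 1"
  then have "of_int n + 1 \<le> real m" "0 \<le> of_int n + (1::real)" by linarith+
  then have "(of_int n + 1) / real m \<le> 1" "0 \<le> (of_int n + 1) / real m" using a by (auto simp: divide_le_eq)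
  then show ?thesis by (simp add: ramp_def)
qed

lemma ramp_diff:
  assumes "m \<ge> 1" shows "\<bar>ramp m (n + 1) - ramp m n\<bar> \<le> 1 / m"
proof -
  consider "n < -1" | "-1 \<le> n" "n < int m - 1" | "n \<ge> int m - 1" by linarith
  then show ?thesis
  proof cases
    case 1 then show ?thesis by (simp add: ramp_eq_0)
  next
    case 2 then show ?thesis using assms by (simp add: ramp_linear diff_divide_distrib[symmetric])
  next
    case 3 then show ?thesis using assms by (simp add: ramp_eq_1)
  qed
qed

text \<open>A ramp is linear except at its corners -1 and m - 1, the midpoints of the second
  differences that start at -2 and m - 2.\<close>

lemma ramp_second_diff:
  assumes "m \<ge> 1"
  shows "\<bar>ramp m (n + 2) - 2 * ramp m (n + 1) + ramp m n\<bar>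
    \<le> (if n = -2 then 1 / m else 0) + (if n = int m - 2 then 1 / m else 0)"
proof -
  consider "n < -2" | "n = -2" | "-2 < n" "n < int m - 2" | "n = int m - 2" "-2 < n" | "n > int m - 2" by linarith
  then show ?thesis
  proof cases
    case 1 then show ?thesis using assms by (simp add: ramp_eq_0)
  next
    case 2
    then show ?thesis using assms by (simp add: ramp_eq_0 ramp_linear)
  next
    case 3
    then show ?thesis using assms by (simp add: ramp_linear field_simps)
  next
    case 4
    have "ramp m (n + 2) = 1" "ramp m (n + 1) = 1" using 4 assms by (auto intro!: ramp_eq_1)
    moreover have "ramp m n = 1 - 1 / m"
      using 4 assms by (subst ramp_linear) (auto simp: field_simps)
    ultimately show ?thesis using 4 by simp
  next
    case 5 then show ?thesis using assms by (simp add: ramp_eq_1)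
  qed
qed

lemma sum_ramp_second_diff:
  assumes "m \<ge> 1" "finite F"
  shows "(\<Sum>n\<in>F. \<bar>ramp m (n + 2 - c) - 2 * ramp m (n + 1 - c) + ramp m (n - c)\<bar>) \<le> 2 / m"
proof -
  let ?d = "\<lambda>n. ramp m (n + 2 - c) - 2 * ramp m (n + 1 - c) + ramp m (n - c)"
  let ?i = "\<lambda>n. (if n = c - 2 then 1 / m else 0) + (if n = c + int m - 2 then 1 / m else 0)"
  have "(\<Sum>n\<in>F. \<bar>?d n\<bar>)
     \<le> (\<Sum>n\<in>F. ?i n)"
  proof (rule sum_mono)
    fix n show "\<bar>?d n\<bar>
       \<le> ?i n"
      using ramp_second_diff[OF assms(1), of "n - c"]
      by (simp add: algebra_simps split: if_splits)
  qed
  also have "\<dots> \<le> 1 / m + 1 / m"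
    unfolding sum.distrib using assms by (intro add_mono) (auto simp: sum.delta)
  finally show ?thesis by simp
qed

text \<open>Serves two purposes: ramps of consecutive dyadic widths at one corner, and ramps of
  equal width at two corners. The last hypothesis says that the second ramp has saturated beyond the
  window, so that the difference has bounded support.\<close>

lemma bump_ramp_diff:
  assumes "m \<ge> 1" "k \<ge> m" "c \<ge> a" "\<And>n. n \<ge> a + 4 * int m \<Longrightarrow> ramp k (n - c) = 1"
  shows "bump m a (\<lambda>n. ramp m (n - a) - ramp k (n - c))"
  unfolding bump_def
proof (intro conjI allI impI)
  fix n assume n: "n \<notin> {a..<a + 4 * int m}"
  show "ramp m (n - a) - ramp k (n - c) = 0"
  proof (cases "n < a")
    case True then show ?thesis using assms(3) by (simp add: ramp_eq_0)
  next
    case False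
    then have "n \<ge> a + 4 * int m" using n by auto
    then show ?thesis using assms(4)[of n] assms(1) by (simp add: ramp_eq_1)
  qed
next
  fix n show "\<bar>ramp m (n - a) - ramp k (n - c)\<bar> \<le> 1"
    using ramp_bounds[of m "n - a"] ramp_bounds[of k "n - c"] by linarith
next
  fix n
  have "1 / real k \<le> 1 / real m" using assms by (intro divide_left_mono) auto
  moreover have "\<bar>ramp m (n - a + 1) - ramp m (n - a)\<bar> \<le> 1 / m" "\<bar>ramp k (n - c + 1) - ramp k (n - c)\<bar> \<le> 1 / k"
    using assms by (intro ramp_diff; simp)+
  moreover have "2 / real m = 1 / m + 1 / m" by simp
  ultimately show "\<bar>ramp m (n + 1 - a) - ramp k (n + 1 - c) - (ramp m (n - a) - ramp k (n - c))\<bar> \<le> 2 / m"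
    unfolding diff_add_eq[symmetric] by linarith
next
  fix F :: "int set" assume F: "finite F"
  let ?d = "\<lambda>k c n. ramp k (n + 2 - c) - 2 * ramp k (n + 1 - c) + ramp k (n - c)"
  let ?e = "\<lambda>n. ramp m (n + 2 - a) - ramp k (n + 2 - c) - 2 * (ramp m (n + 1 - a) - ramp k (n + 1 - c)) + (ramp m (n - a) - ramp k (n - c))"
  have "(\<Sum>n\<in>F. \<bar>?e n\<bar>)
    \<le> (\<Sum>n\<in>F. \<bar>?d m a n\<bar> + \<bar>?d k c n\<bar>)"
  proof (rule sum_mono)
    fix n
    have eq: "?e n
      = ?d m a n - ?d k c n"
      by simp
    show "\<bar>?e n\<bar>
      \<le> \<bar>?d m a n\<bar> + \<bar>?d k c n\<bar>"
      unfolding eq by (rule abs_triangle_ineq4)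
  qed
  also have "\<dots> \<le> 2 / m + 2 / k"
    unfolding sum.distrib using assms F by (intro add_mono sum_ramp_second_diff) auto
  also have "\<dots> \<le> 2 / m + 2 / m" using assms by (intro add_left_mono divide_left_mono) auto
  finally show "(\<Sum>n\<in>F. \<bar>?e n\<bar>) \<le> 4 / m"
    by simp
qed

lemma indicator_eq_ramp: "(if 0 \<le> n then 1 else 0) = ramp 1 n"
  by (auto simp: ramp_def)

lemma ramp_telescope:
  "ramp 1 n = ramp (2 ^ Suc K) n + (\<Sum>k\<le>K. ramp (2 ^ k) n - ramp (2 ^ Suc k) n)"
  by (subst sum_telescope) simp

section \<open>Growth rates along dyadic scales\<close>

lemma weyl_growth_le_scaled:
  assumes "1 \<le> n" "n \<le> m"
  shows "weyl_growth r n \<le> (n / m) powr max (1/2) (1 - 2/r) * weyl_growth r m"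
proof -
  have "(if r = 4 then (1 + ln n) powr (1/4) else 1) \<le> (if r = 4 then (1 + ln m) powr (1/4) else 1)"
    using assms by (auto intro!: powr_mono2)
  then have "weyl_growth r n \<le> n powr max (1/2) (1 - 2/r) * (if r = 4 then (1 + ln m) powr (1/4) else 1)"
    unfolding weyl_growth_def by (intro mult_left_mono) auto
  also have "\<dots> = (n / m) powr max (1/2) (1 - 2/r) * weyl_growth r m"
    using assms by (simp add: weyl_growth_def powr_divide)
  finally show ?thesis .
qed

lemma weyl_growth_mono:
  assumes "1 \<le> n" "n \<le> m"
  shows "weyl_growth r n \<le> weyl_growth r m"
proof -
  have "(n / m) powr max (1/2) (1 - 2/r) \<le> 1 powr max (1/2) (1 - 2/r)"
    using assms by (intro powr_mono2) (auto simp: divide_le_eq_1)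
  then have "(n / m) powr max (1/2) (1 - 2/r) * weyl_growth r m \<le> 1 * weyl_growth r m"
    using weyl_growth_pos[of m r] assms by (intro mult_right_mono) auto
  then show ?thesis using weyl_growth_le_scaled[OF assms, of r] by linarith
qed

text \<open>An arbitrarily small loss \<open>\<epsilon>\<close> in the exponent absorbs the logarithm.\<close>

lemma weyl_growth_le_powr:
  assumes nm: "1 \<le> m" "m \<le> n" and e: "0 < \<epsilon>"
  shows "weyl_growth r n \<le> (1 + 1/\<epsilon>) * weyl_growth r m * (n / m) powr (max (1/2) (1 - 2/r) + \<epsilon>)"
proof -
  define \<alpha> where "\<alpha> = max (1/2) (1 - 2/r)"
  define y where "y = n / m"
  have y: "y \<ge> 1" using nm by (simp add: y_def)
  have n: "n = m * y" using nm by (simp add: y_def)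
  have "ln (y powr \<epsilon>) \<le> y powr \<epsilon> - 1" using y by (intro ln_le_minus_one) auto
  then have "\<epsilon> * ln y \<le> y powr \<epsilon> - 1" using y by (simp add: ln_powr)
  then have "ln y \<le> (y powr \<epsilon> - 1) / \<epsilon>" using e by (simp add: field_simps)
  also have "\<dots> \<le> y powr \<epsilon> / \<epsilon>" using e by (intro divide_right_mono) auto
  finally have lny: "ln y \<le> y powr \<epsilon> / \<epsilon>" .
  have y1: "1 \<le> y powr \<epsilon>" using y e by (simp add: ge_one_powr_ge_zero)
  have lg: "(1 + ln n) powr (1/4) \<le> (1 + 1/\<epsilon>) * y powr \<epsilon> * (1 + ln m) powr (1/4)"
  proof -
    have "1 + ln n = 1 + ln m + ln y" using nm y by (simp add: n ln_mult)
    also have "\<dots> \<le> (1 + ln y) * (1 + ln m)" using nm y by (simp add: algebra_simps)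
    finally have "(1 + ln n) powr (1/4) \<le> ((1 + ln y) * (1 + ln m)) powr (1/4)"
      using nm by (intro powr_mono2) auto
    also have "\<dots> = (1 + ln y) powr (1/4) * (1 + ln m) powr (1/4)"
      using nm y by (intro powr_mult)
    also have "(1 + ln y) powr (1/4) \<le> (1 + ln y) powr 1" using y by (intro powr_mono) auto
    also have "\<dots> = 1 + ln y" using y by simp
    also have "\<dots> \<le> (1 + 1/\<epsilon>) * y powr \<epsilon>" using lny y1 by (simp add: algebra_simps)
    finally show ?thesis by (simp add: mult_right_mono)
  qed
  have c: "1 \<le> (1 + 1/\<epsilon>) * y powr \<epsilon>"
    using mult_mono[of 1 "1 + 1/\<epsilon>" 1 "y powr \<epsilon>"] y1 e by simp
  have "(if r = 4 then (1 + ln n) powr (1/4) else 1) \<le> (1 + 1/\<epsilon>) * y powr \<epsilon> * (if r = 4 then (1 + ln m) powr (1/4) else 1)"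
    using lg c by auto
  then have "n powr \<alpha> * (if r = 4 then (1 + ln n) powr (1/4) else 1)
     \<le> n powr \<alpha> * ((1 + 1/\<epsilon>) * y powr \<epsilon> * (if r = 4 then (1 + ln m) powr (1/4) else 1))"
    by (intro mult_left_mono) auto
  also have "\<dots> = (1 + 1/\<epsilon>) * weyl_growth r m * y powr (\<alpha> + \<epsilon>)"
    unfolding weyl_growth_def \<alpha>_def[symmetric] using nm y by (simp add: n powr_mult powr_add mult_ac)
  finally show ?thesis unfolding weyl_growth_def \<alpha>_def[symmetric] y_def[symmetric] .
qed

text \<open>The growth exponent is at least 1/2, so halving the length multiplies the rate by at
  most 2^(-1/2) <= 3/4. A geometric series of ratio 3/4 gives the constant 4, and summing over
  scales loses no logarithm.\<close>

lemma sum_weyl_growth_dyadic_le: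
  "(\<Sum>k\<le>K. weyl_growth r (2 ^ k)) \<le> 4 * weyl_growth r (2 ^ K)"
proof (induction K)
  case 0
  then show ?case using weyl_growth_pos[of 1 r] by simp
next
  case (Suc K)
  define c :: real where "c = (1/2) powr max (1/2) (1 - 2/r)"
  have "c \<le> (1/2) powr (1/2)" unfolding c_def by (intro powr_mono') auto
  also have "\<dots> = sqrt (1/2)" by (simp add: powr_half_sqrt)
  also have "\<dots> \<le> 3/4" by (rule real_le_lsqrt) (auto simp: power2_eq_square)
  finally have c: "c \<le> 3/4" .
  have pos: "weyl_growth r (2 ^ Suc K) > 0" by (intro weyl_growth_pos) (rule one_le_power, simp)
  have "weyl_growth r (2 ^ K) \<le> (2 ^ K / 2 ^ Suc K) powr max (1/2) (1 - 2/r) * weyl_growth r (2 ^ Suc K)"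
    by (intro weyl_growth_le_scaled) auto
  also have "\<dots> = c * weyl_growth r (2 ^ Suc K)" by (simp add: c_def)
  also have "\<dots> \<le> 3/4 * weyl_growth r (2 ^ Suc K)" using c pos by (intro mult_right_mono) auto
  finally show ?case using Suc.IH by simp
qed

lemma bump_sum_superset:
  assumes "bump L b w" "finite A" "{b..<b + 4 * int L} \<subseteq> A"
  shows "(\<Sum>n\<in>A. of_real (w n) * g n) = (\<Sum>n\<in>{b..<b + 4 * int L}. of_real (w n) * (g n :: complex))"
  using assms by (intro sum.mono_neutral_right) (auto simp: bump_def)

text \<open>The widest ramps at the two ends have unbounded support, but their difference is a
  single bump; the narrower corrections are bumps near one of the ends. Minkowski's inequality over
  all scales costs only the constant 16 = 8 + 2 * 4.\<close>

lemma interval_sum_growth: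
  assumes r: "r \<ge> 3"
  shows "\<exists>K>0. \<forall>a m. m \<ge> 1 \<longrightarrow>
     Lp_integral r (\<lambda>x. \<Sum>n\<in>{a..<a + int m}. unit_char (of_int (n\<^sup>2) * x)) \<le> (K * weyl_growth r m) powr r"
proof -
  obtain C where C: "C > 0" and bd: "\<And>L b w. bump L b w \<Longrightarrow> L \<ge> 1 \<Longrightarrow>
     Lp_integral r (\<lambda>x. \<Sum>n\<in>{b..<b + 4 * int L}. of_real (w n) * unit_char (of_int (n\<^sup>2) * x)) \<le> (C * weyl_growth r L) powr r"
    using bump_sum_growth[OF r] by blast
  have main: "Lp_integral r (\<lambda>x. \<Sum>n\<in>{a..<a + int m}. unit_char (of_int (n\<^sup>2) * x)) \<le> (16 * C * weyl_growth r m) powr r"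
    if m: "m \<ge> 1" for a m
  proof -
    obtain K where K: "2 ^ K \<le> m" "m < 2 ^ Suc K" using ex_power_ivl1[of 2 m] m by auto
    \<comment> \<open>Long enough for every bump: the widest occupies 8 * 2^K integers, and those
      starting at b end before a + 6 * 2^K.\<close>
    define A where "A = {a..<a + 8 * 2 ^ K}"
    define b where "b = a + int m"
    define e where "e = (\<lambda>n x. unit_char (of_int (n\<^sup>2) * x))"
    define u where "u = (\<lambda>n. ramp (2 ^ Suc K) (n - a) - ramp (2 ^ Suc K) (n - b))"
    define v where "v = (\<lambda>k c n. ramp (2 ^ k) (n - c) - ramp (2 ^ Suc k) (n - c))"
    have mK: "int m < 2 * 2 ^ K" using K by (metis of_nat_less_iff of_nat_numeral of_nat_power power_Suc)
    have bu: "bump (2 ^ Suc K) a u"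
      unfolding u_def by (rule bump_ramp_diff) (use mK in \<open>auto simp: b_def intro!: ramp_eq_1\<close>)
    have bv: "bump (2 ^ k) c (v k c)" for k c
    proof -
      have "(0::int) < 2 ^ k" by simp
      then show ?thesis unfolding v_def by (intro bump_ramp_diff ramp_eq_1) (auto simp del: zero_less_power)
    qed
    have ind: "(if n \<in> {a..<a + int m} then 1 else 0) = u n + (\<Sum>k\<le>K. v k a n) - (\<Sum>k\<le>K. v k b n)" for n
    proof -
      have "(if n \<in> {a..<a + int m} then 1 else 0) = (if 0 \<le> n - a then 1 else 0) - (if 0 \<le> n - b then 1 else (0::real))"
        by (auto simp: b_def)
      also have "\<dots> = ramp 1 (n - a) - ramp 1 (n - b)" by (simp only: indicator_eq_ramp)
      also have "\<dots> = u n + (\<Sum>k\<le>K. v k a n) - (\<Sum>k\<le>K. v k b n)"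
        unfolding u_def v_def ramp_telescope[of "n - a" K] ramp_telescope[of "n - b" K] by simp
      finally show ?thesis .
    qed
    have small: "(2::int) ^ k \<le> 2 ^ K" if "k \<le> K" for k using that by (intro power_increasing) auto
    have subu: "{a..<a + 4 * int (2 ^ Suc K)} \<subseteq> A" by (auto simp: A_def)
    have subv: "{c..<c + 4 * int (2 ^ k)} \<subseteq> A" if kc: "k \<le> K" "c = a \<or> c = b" for k c
    proof -
      have "{c..<c + 4 * p} \<subseteq> A" if "p \<le> 2 ^ K" for p
        using that kc(2) mK unfolding A_def b_def by auto
      from this[OF small[OF kc(1)]] show ?thesis by simp
    qed
    have finA: "finite A" by (simp add: A_def)
    define U where "U = (\<lambda>x. \<Sum>n\<in>A. of_real (u n) * e n x)"
    define V where "V = (\<lambda>k c x. \<Sum>n\<in>A. of_real (v k c n) * e n x)"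
    have dec: "(\<Sum>n\<in>{a..<a + int m}. e n x) = U x + (\<Sum>k\<le>K. V k a x) + (\<Sum>k\<le>K. - V k b x)" for x
    proof -
      have "(\<Sum>n\<in>{a..<a + int m}. e n x) = (\<Sum>n\<in>A. of_real (if n \<in> {a..<a + int m} then 1 else 0) * e n x)"
        using mK by (subst sum.mono_neutral_right[of A "{a..<a + int m}"]) (auto simp: A_def)
      also have "\<dots> = U x + (\<Sum>n\<in>A. \<Sum>k\<le>K. of_real (v k a n) * e n x) - (\<Sum>n\<in>A. \<Sum>k\<le>K. of_real (v k b n) * e n x)"
        unfolding ind U_def
        by (simp add: ring_distribs sum.distrib sum_subtractf sum_distrib_right)
      finally show ?thesis unfolding V_def by (subst (asm) (1 2) sum.swap) (simp add: sum_negf)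
    qed
    have contU: "continuous_on {0..1} U" and contV: "continuous_on {0..1} (V k c)" for k c
      unfolding U_def V_def e_def by (rule continuous_on_exponential_sum)+
    have JU: "Lp_integral r U \<le> (C * weyl_growth r (2 ^ Suc K)) powr r"
      using bd[OF bu] unfolding U_def bump_sum_superset[OF bu finA subu] e_def by simp
    have JV: "Lp_integral r (V k c) \<le> (C * weyl_growth r (2 ^ k)) powr r" if "k \<le> K" "c = a \<or> c = b" for k c
      using bd[OF bv] unfolding V_def bump_sum_superset[OF bv finA subv[OF that]] e_def by simp
    have JnV: "Lp_integral r (\<lambda>x. - V k b x) \<le> (C * weyl_growth r (2 ^ k)) powr r" if "k \<le> K" for k
      using JV[OF that, of b] by (simp add: Lp_integral_def)
    define D where "D = (\<Sum>k\<le>K. C * weyl_growth r (2 ^ k))"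
    have pos: "C * weyl_growth r (2 ^ k) > 0" for k using C by (intro mult_pos_pos weyl_growth_pos) auto
    have D: "D > 0" unfolding D_def by (intro sum_pos pos) auto
    have JVa: "Lp_integral r (\<lambda>x. \<Sum>k\<le>K. V k a x) \<le> D powr r"
      unfolding D_def using r by (intro Lp_integral_sum_le contV pos JV) auto
    have JVb: "Lp_integral r (\<lambda>x. \<Sum>k\<le>K. - V k b x) \<le> D powr r"
      unfolding D_def using r by (intro Lp_integral_sum_le continuous_on_minus contV pos JnV) auto
    define g where "g = (\<lambda>i::nat. if i = 0 then U else if i = 1 then (\<lambda>x. \<Sum>k\<le>K. V k a x) else (\<lambda>x. \<Sum>k\<le>K. - V k b x))"
    define B where "B = (\<lambda>i::nat. if i = 0 then C * weyl_growth r (2 ^ Suc K) else D)"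
    have "Lp_integral r (\<lambda>x. \<Sum>i\<in>{0,1,2::nat}. g i x) \<le> (\<Sum>i\<in>{0,1,2::nat}. B i) powr r"
    proof (rule Lp_integral_sum_le)
      fix i :: nat assume "i \<in> {0,1,2}"
      show "continuous_on {0..1} (g i)"
        unfolding g_def by (auto intro!: contU contV continuous_on_sum continuous_on_minus)
      show "B i > 0" unfolding B_def using pos[of "Suc K"] D by (auto simp del: power_Suc)
      show "Lp_integral r (g i) \<le> B i powr r"
        unfolding g_def B_def using JU JVa JVb by auto
    qed (use r in auto)
    also have "(\<lambda>x. \<Sum>i\<in>{0,1,2::nat}. g i x) = (\<lambda>x. \<Sum>n\<in>{a..<a + int m}. e n x)"
      by (rule ext) (simp add: dec g_def)
    also have "(\<Sum>i\<in>{0,1,2::nat}. B i) = C * weyl_growth r (2 ^ Suc K) + 2 * D" by (simp add: B_def)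
    finally have J: "Lp_integral r (\<lambda>x. \<Sum>n\<in>{a..<a + int m}. e n x) \<le> (C * weyl_growth r (2 ^ Suc K) + 2 * D) powr r" .
    have g1: "weyl_growth r (2 ^ K) \<le> weyl_growth r m"
      using K by (intro weyl_growth_mono) (simp_all flip: of_nat_power)
    have "D = C * (\<Sum>k\<le>K. weyl_growth r (2 ^ k))" by (simp add: D_def sum_distrib_left)
    also have "\<dots> \<le> C * (4 * weyl_growth r (2 ^ K))"
      using C by (intro mult_left_mono sum_weyl_growth_dyadic_le) auto
    finally have D1: "D \<le> 4 * (C * weyl_growth r (2 ^ K))" by simp
    \<comment> \<open>With \<epsilon> = 1 the exponent is at most 2, so one doubling costs at most 2
      * 2^2 = 8.\<close>
    have "weyl_growth r (2 ^ Suc K) \<le> 8 * weyl_growth r (2 ^ K)"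
    proof -
      have "weyl_growth r (2 ^ Suc K) \<le> (1 + 1/1) * weyl_growth r (2 ^ K) * (2 ^ Suc K / 2 ^ K) powr (max (1/2) (1 - 2/r) + 1)"
        by (intro weyl_growth_le_powr) auto
      also have "(2 ^ Suc K / 2 ^ K :: real) = 2" by simp
      also have "(2::real) powr (max (1/2) (1 - 2/r) + 1) \<le> 2 powr 2" using r by (intro powr_mono) auto
      finally show ?thesis using weyl_growth_pos[of "2 ^ K" r] by simp
    qed
    then have "C * weyl_growth r (2 ^ Suc K) + 2 * D \<le> C * (8 * weyl_growth r (2 ^ K)) + 2 * (4 * (C * weyl_growth r (2 ^ K)))"
      using C D1 by (intro add_mono mult_left_mono) auto
    also have "\<dots> \<le> 16 * C * weyl_growth r m" using g1 C by simp
    finally have "(C * weyl_growth r (2 ^ Suc K) + 2 * D) powr r \<le> (16 * C * weyl_growth r m) powr r"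
      using pos[of "Suc K"] D r by (intro powr_mono2) (auto simp del: power_Suc)
    then show ?thesis using J unfolding e_def by linarith
  qed
  show ?thesis using C main by (intro exI[of _ "16 * C"]) auto
qed

subsection \<open>Upper bounds for blocks of the series\<close>

definition series_block :: "real \<Rightarrow> nat \<Rightarrow> nat \<Rightarrow> real \<Rightarrow> complex" where
  "series_block s a b x = (\<Sum>n\<in>{a..<b}. of_real (real n powr (-2 * s)) * unit_char (real (n\<^sup>2) * x))"

lemma continuous_on_series_block: "continuous_on S (series_block s a b)"
  unfolding series_block_def by (rule continuous_on_exponential_sum)

lemma sum_by_parts:
  fixes c :: "nat \<Rightarrow> real" and z :: "nat \<Rightarrow> 'a :: {real_algebra_1, comm_ring_1}"
  assumes "a \<le> b"
  shows "(\<Sum>n\<in>{a..<b}. of_real (c n) * z n)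
    = (\<Sum>n\<in>{a..<b}. of_real (c n - c (Suc n)) * (\<Sum>i\<in>{a..<Suc n}. z i)) + of_real (c b) * (\<Sum>i\<in>{a..<b}. z i)"
  using assms
proof (induction b rule: dec_induct)
  case (step b)
  then show ?case by (simp add: algebra_simps)
qed simp

text \<open>Concavity of \<open>y \<mapsto> y powr \<theta>\<close> with \<open>y = n powr (-2s)\<close> and \<open>\<theta> = 1 - \<alpha> / (2s)\<close> makes
  the sum of \<open>n powr \<alpha>\<close> against the differences of \<open>n powr (-2s)\<close> telescope.\<close>

lemma sum_powr_differences_le:
  fixes s \<alpha> :: real
  assumes s: "0 < \<alpha>" "\<alpha> < 2 * s" and ab: "1 \<le> a" "a \<le> b"
  shows "(\<Sum>n\<in>{a..<b}. (real n powr (-2 * s) - real (Suc n) powr (-2 * s)) * real n powr \<alpha>) + real b powr (-2 * s) * real b powr \<alpha>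
     \<le> 1 / (1 - \<alpha> / (2 * s)) * real a powr (\<alpha> - 2 * s)"
proof -
  let ?v = "\<lambda>n. (real n powr (-2 * s) - real (Suc n) powr (-2 * s)) * real n powr \<alpha>"
  define \<theta> where "\<theta> = 1 - \<alpha> / (2 * s)"
  have s0: "s > 0" using s by linarith
  have \<theta>: "0 < \<theta>" "\<theta> \<le> 1" using s s0 by (auto simp: \<theta>_def)
  have ex: "- (2 * s) * \<theta> = \<alpha> - 2 * s" "- (2 * s) * (\<theta> - 1) = \<alpha>"
    using s0 by (auto simp: \<theta>_def field_simps)
  have st: "?v n
      \<le> 1 / \<theta> * (real n powr (\<alpha> - 2 * s) - real (Suc n) powr (\<alpha> - 2 * s))" if "n \<ge> 1" for n
  proof -
    have "\<theta> * (real n powr (-2 * s)) powr (\<theta> - 1) * (real n powr (-2 * s) - real (Suc n) powr (-2 * s))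
       \<le> (real n powr (-2 * s)) powr \<theta> - (real (Suc n) powr (-2 * s)) powr \<theta>"
      using that s0 \<theta> by (intro powr_diff_ge powr_mono2') auto
    then have "\<theta> * (real n powr \<alpha> * (real n powr (-2 * s) - real (Suc n) powr (-2 * s)))
       \<le> real n powr (\<alpha> - 2 * s) - real (Suc n) powr (\<alpha> - 2 * s)"
      using ex by (simp add: powr_powr mult.assoc)
    then show ?thesis using \<theta> by (simp add: field_simps)
  qed
  have "(\<Sum>n\<in>{a..<b}. ?v n)
     \<le> (\<Sum>n\<in>{a..<b}. 1 / \<theta> * (real n powr (\<alpha> - 2 * s) - real (Suc n) powr (\<alpha> - 2 * s)))"
    using ab by (intro sum_mono st) auto
  also have "\<dots> = 1 / \<theta> * (real a powr (\<alpha> - 2 * s) - real b powr (\<alpha> - 2 * s))"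
    unfolding sum_distrib_left[symmetric] using ab(2)
    by (induction b rule: dec_induct) (auto simp: algebra_simps)
  finally have 1: "(\<Sum>n\<in>{a..<b}. ?v n)
     \<le> 1 / \<theta> * (real a powr (\<alpha> - 2 * s) - real b powr (\<alpha> - 2 * s))" .
  have "1 * real b powr (\<alpha> - 2 * s) \<le> 1 / \<theta> * real b powr (\<alpha> - 2 * s)"
    using \<theta> by (intro mult_right_mono) (auto simp: field_simps)
  moreover have "real b powr (-2 * s) * real b powr \<alpha> = real b powr (\<alpha> - 2 * s)"
    by (simp add: powr_add[symmetric])
  ultimately show ?thesis using 1 unfolding \<theta>_def[symmetric] by (simp add: right_diff_distrib)
qed

text \<open>Abel summation expresses the block through partial sums starting at a, each controlled
  by its length, and the outcome must not depend on b. This requires partial sums growing like a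
  power below n^(2s), which is where the condition on s enters.\<close>

lemma series_block_Lp_le:
  assumes r: "r \<ge> 3" and s: "2 * s > max (1/2) (1 - 2/r)"
  shows "\<exists>K>0. \<forall>a b. 1 \<le> a \<longrightarrow>
     Lp_integral r (series_block s a b) \<le> (K * (weyl_growth r a * real a powr (-2 * s))) powr r"
proof -
  obtain C where C: "C > 0" and bd: "\<And>a m. m \<ge> 1 \<Longrightarrow>
     Lp_integral r (\<lambda>x. \<Sum>n\<in>{a..<a + int m}. unit_char (of_int (n\<^sup>2) * x)) \<le> (C * weyl_growth r m) powr r"
    using interval_sum_growth[OF r] by blast
  define \<alpha> where "\<alpha> = max (1/2) (1 - 2/r)"
  \<comment> \<open>Half of the gap between \<alpha> and 2 s: it absorbs the logarithm and still
    leaves \<open>\<alpha>'\<close> strictly below 2 s.\<close>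
  define \<epsilon> where "\<epsilon> = (2 * s - \<alpha>) / 2"
  define \<alpha>' where "\<alpha>' = \<alpha> + \<epsilon>"
  have \<alpha>: "\<alpha> \<ge> 1/2" and \<epsilon>: "\<epsilon> > 0" using s by (auto simp: \<alpha>_def \<epsilon>_def)
  have \<alpha>': "0 < \<alpha>'" "\<alpha>' < 2 * s" using \<alpha> \<epsilon> s by (auto simp: \<alpha>'_def \<epsilon>_def \<alpha>_def field_simps)
  have s0: "s > 0" using \<alpha>' by linarith
  define \<theta> where "\<theta> = 1 - \<alpha>' / (2 * s)"
  have \<theta>: "\<theta> > 0" using \<alpha>' by (simp add: \<theta>_def)
  define K where "K = C * (1 + 1 / \<epsilon>) / \<theta>"
  have K: "K > 0" using C \<epsilon> \<theta> by (auto simp: K_def intro!: divide_pos_pos mult_pos_pos add_pos_pos)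
  have main: "Lp_integral r (series_block s a b) \<le> (K * (weyl_growth r a * real a powr (-2 * s))) powr r"
    if a: "1 \<le> a" for a b
  proof (cases "a < b")
    case False
    then show ?thesis using r by (simp add: series_block_def Lp_integral_def)
  next
    case True
    define c where "c = (\<lambda>n::nat. real n powr (-2 * s))"
    define e where "e = (\<lambda>n x. unit_char (real (n\<^sup>2) * x))"
    define T where "T = (\<lambda>n x. \<Sum>i\<in>{a..<n}. e i x)"
    have contT: "continuous_on {0..1} (T n)" for n
      unfolding T_def e_def by (intro continuous_intros)
    have JT: "Lp_integral r (T n) \<le> (C * weyl_growth r (real (n - a))) powr r" if "n > a" for n
    proof -
      have "T n x = (\<Sum>k\<in>{int a..<int a + int (n - a)}. unit_char (of_int (k\<^sup>2) * x))" for x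
        unfolding T_def e_def using that
        by (intro sum.reindex_bij_witness[of _ nat int]) auto
      then have "T n = (\<lambda>x. \<Sum>k\<in>{int a..<int a + int (n - a)}. unit_char (of_int (k\<^sup>2) * x))" by (rule ext)
      then show ?thesis using bd[of "n - a" "int a"] that by (simp only:)
    qed
    have gr: "weyl_growth r m \<le> (1 + 1/\<epsilon>) * weyl_growth r a * real a powr (-\<alpha>') * real n powr \<alpha>'"
      if "1 \<le> m" "m \<le> real n" "a \<le> n" for m n
    proof -
      have "weyl_growth r m \<le> weyl_growth r n" using that by (intro weyl_growth_mono) auto
      also have "\<dots> \<le> (1 + 1/\<epsilon>) * weyl_growth r a * (real n / real a) powr \<alpha>'"
        unfolding \<alpha>'_def \<alpha>_def using a that \<epsilon> by (intro weyl_growth_le_powr) auto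
      also have "(real n / real a) powr \<alpha>' = real a powr (-\<alpha>') * real n powr \<alpha>'"
        by (simp add: powr_divide powr_minus_divide)
      finally show ?thesis by (simp only: mult.assoc)
    qed
    \<comment> \<open>The boundary term of the Abel summation is stored under the index b, so that
      one application of Minkowski's inequality covers all terms.\<close>
    define g where "g = (\<lambda>n x. if n < b then of_real (c n - c (Suc n)) * T (Suc n) x else of_real (c b) * T b x)"
    define B where "B = (\<lambda>n. if n < b then (c n - c (Suc n)) * (C * weyl_growth r (real (Suc n - a)))
        else c b * (C * weyl_growth r (real (b - a))))"
    have cd: "c n - c (Suc n) > 0" if "n \<ge> a" for n
      using that a s0 by (auto simp: c_def intro!: powr_less_mono2_neg)
    have cb: "c b > 0" using True by (simp add: c_def)
    have gpos: "C * weyl_growth r (real (n - a)) > 0" if "n > a" for n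
      using that C by (intro mult_pos_pos weyl_growth_pos) auto
    have blk: "series_block s a b = (\<lambda>x. \<Sum>n\<in>{a..b}. g n x)"
    proof
      fix x
      have "series_block s a b x = (\<Sum>n\<in>{a..<b}. of_real (c n) * e n x)" by (simp add: series_block_def c_def e_def)
      also have "\<dots> = (\<Sum>n\<in>{a..<b}. of_real (c n - c (Suc n)) * T (Suc n) x) + of_real (c b) * T b x"
        unfolding T_def using True by (intro sum_by_parts) auto
      also have "\<dots> = (\<Sum>n\<in>{a..<b}. g n x) + g b x"
        by (intro arg_cong2[where f = "(+)"] sum.cong) (auto simp: g_def)
      also have "\<dots> = (\<Sum>n\<in>{a..b}. g n x)"
        using True by (simp add: atLeastLessThanSuc_atLeastAtMost[symmetric])
      finally show "series_block s a b x = (\<Sum>n\<in>{a..b}. g n x)" .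
    qed
    have B0: "B n > 0" if "n \<in> {a..b}" for n
      unfolding B_def using that True cd cb gpos[of "Suc n"] gpos[of b] by auto
    have "Lp_integral r (\<lambda>x. \<Sum>n\<in>{a..b}. g n x) \<le> (\<Sum>n\<in>{a..b}. B n) powr r"
    proof (rule Lp_integral_sum_le)
      fix n assume n: "n \<in> {a..b}"
      show "continuous_on {0..1} (g n)" unfolding g_def by (cases "n < b") (auto intro!: continuous_intros contT)
      show "B n > 0" using n by (rule B0)
      show "Lp_integral r (g n) \<le> B n powr r"
      proof (cases "n < b")
        case nb: True
        have "Lp_integral r (g n) = (c n - c (Suc n)) powr r * Lp_integral r (T (Suc n))"
          unfolding g_def using nb cd[of n] n by (simp add: Lp_integral_cmult del: of_real_diff)
        also have "\<dots> \<le> (c n - c (Suc n)) powr r * (C * weyl_growth r (real (Suc n - a))) powr r"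
          using n by (intro mult_left_mono JT) auto
        also have "\<dots> = B n powr r"
          unfolding B_def using nb by (simp add: powr_mult)
        finally show ?thesis .
      next
        case nb: False
        have "Lp_integral r (g n) = c b powr r * Lp_integral r (T b)"
          unfolding g_def using nb cb by (simp add: Lp_integral_cmult)
        also have "\<dots> \<le> c b powr r * (C * weyl_growth r (real (b - a))) powr r"
          using True by (intro mult_left_mono JT) auto
        also have "\<dots> = B n powr r"
          unfolding B_def using nb by (simp add: powr_mult)
        finally show ?thesis .
      qed
    qed (use r in auto)
    also have "\<dots> \<le> (K * (weyl_growth r a * real a powr (-2 * s))) powr r"
    proof -
      define G where "G = C * ((1 + 1/\<epsilon>) * weyl_growth r a * real a powr (-\<alpha>'))"
      have G: "G \<ge> 0" unfolding G_def using C \<epsilon> a weyl_growth_pos[of "real a" r] by (intro mult_nonneg_nonneg) auto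
      \<comment> \<open>The partial sum through n has n + 1 - a <= n terms because a >= 1, so its
        growth is measured against n and then compared with the value at a.\<close>
      have Gle: "C * weyl_growth r (real m) \<le> G * real n powr \<alpha>'" if "1 \<le> m" "m \<le> n" "a \<le> n" for m n :: nat
        unfolding G_def mult.assoc[of C] using C gr[of "real m" n] that by (intro mult_left_mono) auto
      have "(\<Sum>n\<in>{a..b}. B n) = (\<Sum>n\<in>{a..<b}. B n) + B b"
        using True by (simp add: atLeastLessThanSuc_atLeastAtMost[symmetric])
      also have "\<dots> \<le> (\<Sum>n\<in>{a..<b}. (c n - c (Suc n)) * (G * real n powr \<alpha>')) + c b * (G * real b powr \<alpha>')"
      proof (intro add_mono sum_mono)
        fix n assume n: "n \<in> {a..<b}"
        have "C * weyl_growth r (real (Suc n - a)) \<le> G * real n powr \<alpha>'"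
          using n a by (intro Gle) auto
        moreover have "B n = (c n - c (Suc n)) * (C * weyl_growth r (real (Suc n - a)))"
          unfolding B_def using n by (intro if_P) auto
        ultimately show "B n \<le> (c n - c (Suc n)) * (G * real n powr \<alpha>')"
          using cd[of n] n by (simp only:) (intro mult_left_mono, auto)
      next
        have "C * weyl_growth r (real (b - a)) \<le> G * real b powr \<alpha>'"
          using True a by (intro Gle) auto
        then show "B b \<le> c b * (G * real b powr \<alpha>')"
          unfolding B_def using cb by (simp add: mult_left_mono)
      qed
      also have "\<dots> = G * ((\<Sum>n\<in>{a..<b}. (c n - c (Suc n)) * real n powr \<alpha>') + c b * real b powr \<alpha>')"
        by (simp add: distrib_left sum_distrib_left mult_ac)
      also have "\<dots> \<le> G * (1 / \<theta> * real a powr (\<alpha>' - 2 * s))"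
        unfolding c_def \<theta>_def using G \<alpha>' a True by (intro mult_left_mono sum_powr_differences_le) auto
      also have "\<dots> = K * (weyl_growth r a * (real a powr (-\<alpha>') * real a powr (\<alpha>' - 2 * s)))"
        by (simp add: G_def K_def)
      also have "real a powr (-\<alpha>') * real a powr (\<alpha>' - 2 * s) = real a powr (-2 * s)"
        by (simp add: powr_add[symmetric])
      finally have "(\<Sum>n\<in>{a..b}. B n) \<le> K * (weyl_growth r a * real a powr (-2 * s))" .
      then show ?thesis using r B0 by (intro powr_mono2 sum_nonneg) (auto simp: less_imp_le)
    qed
    finally show ?thesis unfolding blk .
  qed
  show ?thesis using K main by blast
qed

subsection \<open>Orthogonality\<close>

text \<open>Arbitrary index sets and possibly repeated frequencies keep the class closed under
  products and conjugation, so |f|^2 and |f|^4 are again such sums and their integrals are read off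
  at frequency zero.\<close>

definition trig_sum :: "'a set \<Rightarrow> ('a \<Rightarrow> real) \<Rightarrow> ('a \<Rightarrow> int) \<Rightarrow> real \<Rightarrow> complex" where
  "trig_sum I d k x = (\<Sum>i\<in>I. of_real (d i) * unit_char (of_int (k i) * x))"

lemma continuous_on_trig_sum: "continuous_on S (trig_sum I d k)"
  unfolding trig_sum_def by (rule continuous_on_exponential_sum)

lemma trig_sum_mult:
  "trig_sum I d k x * trig_sum J d' k' x
    = trig_sum (I \<times> J) (\<lambda>(i, j). d i * d' j) (\<lambda>(i, j). k i + k' j) x"
  unfolding trig_sum_def sum_product sum.cartesian_product
  by (intro sum.cong refl) (auto simp: unit_char_add ring_distribs mult_ac)

lemma cnj_trig_sum: "cnj (trig_sum I d k x) = trig_sum I d (\<lambda>i. - k i) x"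
  by (simp add: trig_sum_def cnj_unit_char)

lemma has_integral_unit_char:
  "((\<lambda>x. unit_char (of_int k * x)) has_integral (if k = 0 then 1 else 0)) {0..1}"
proof (cases "k = 0")
  case True
  then show ?thesis using has_integral_const_real[of "1::complex" 0 1] by simp
next
  case False
  define c where "c = 2 * pi * of_int k"
  have c: "c \<noteq> 0" using False by (simp add: c_def)
  define F where "F = (\<lambda>x. cis (c * x) / (\<i> * of_real c))"
  have "((\<lambda>x. cis (c * x)) has_integral (F 1 - F 0)) {0..1}"
  proof (rule fundamental_theorem_of_calculus)
    fix x :: real
    show "(F has_vector_derivative cis (c * x)) (at x within {0..1})"
      unfolding F_def cis_conv_exp using c
      by (auto intro!: derivative_eq_intros has_vector_derivative_real_field simp: field_simps)
  qed simp
  moreover have "F 1 = F 0"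
    using unit_char_int[of k] by (simp add: F_def c_def unit_char_def)
  moreover have "(\<lambda>x. unit_char (of_int k * x)) = (\<lambda>x. cis (c * x))"
    by (simp add: unit_char_def c_def mult.assoc)
  ultimately show ?thesis using False by simp
qed

lemma has_integral_trig_sum:
  assumes "finite I"
  shows "(trig_sum I d k has_integral of_real (\<Sum>i\<in>{i\<in>I. k i = 0}. d i)) {0..1}"
proof -
  have "(trig_sum I d k has_integral (\<Sum>i\<in>I. of_real (d i) * (if k i = 0 then 1 else 0))) {0..1}"
    unfolding trig_sum_def using assms
    by (intro has_integral_sum has_integral_mult_right has_integral_unit_char)
  also have "(\<Sum>i\<in>I. of_real (d i) * (if k i = 0 then 1 else 0)) = (of_real (\<Sum>i\<in>{i\<in>I. k i = 0}. d i) :: complex)"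
    unfolding of_real_sum using assms by (subst sum.inter_filter) (auto intro!: sum.cong)
  finally show ?thesis .
qed

lemma norm_trig_sum_square:
  "of_real ((norm (trig_sum I d k x))\<^sup>2) = trig_sum (I \<times> I) (\<lambda>(i, j). d i * d j) (\<lambda>(i, j). k i - k j) x"
  unfolding complex_norm_square cnj_trig_sum trig_sum_mult by simp

lemma Lp_integral_2_trig_sum:
  assumes "finite I" "inj_on k I"
  shows "Lp_integral 2 (trig_sum I d k) = (\<Sum>i\<in>I. (d i)\<^sup>2)"
proof -
  have "((\<lambda>x. Re (of_real ((norm (trig_sum I d k x))\<^sup>2))) has_integral
      Re (of_real (\<Sum>p\<in>{p\<in>I \<times> I. (\<lambda>(i, j). k i - k j) p = 0}. (\<lambda>(i, j). d i * d j) p))) {0..1}"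
    unfolding norm_trig_sum_square using assms
    by (intro has_integral_linear[OF has_integral_trig_sum bounded_linear_Re, unfolded o_def]) auto
  also have "(\<lambda>x. Re (of_real ((norm (trig_sum I d k x))\<^sup>2))) = (\<lambda>x. norm (trig_sum I d k x) powr 2)"
  proof
    fix x show "Re (of_real ((norm (trig_sum I d k x))\<^sup>2)) = norm (trig_sum I d k x) powr 2"
      by (cases "trig_sum I d k x = 0") auto
  qed
  also have "{p\<in>I \<times> I. (\<lambda>(i, j). k i - k j) p = 0} = (\<lambda>i. (i, i)) ` I"
    using assms(2) by (auto simp: image_iff inj_on_eq_iff)
  also have "Re (of_real (\<Sum>p\<in>(\<lambda>i. (i, i)) ` I. (\<lambda>(i, j). d i * d j) p)) = (\<Sum>i\<in>I. (d i)\<^sup>2)"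
    by (subst sum.reindex) (auto simp: inj_on_def power2_eq_square)
  finally show ?thesis unfolding Lp_integral_def by (rule integral_unique)
qed

text \<open>The integral is a weighted count of the quadruples whose frequency differences agree. As
  the weights are nonnegative, any family Q of such quadruples gives a lower bound.\<close>

lemma Lp_integral_4_trig_sum_ge:
  fixes m :: real
  assumes I: "finite I" and d: "\<And>i. i \<in> I \<Longrightarrow> 0 \<le> d i" and Q: "Q \<subseteq> (I \<times> I) \<times> (I \<times> I)"
    and eq: "\<And>i j i' j'. ((i, j), (i', j')) \<in> Q \<Longrightarrow> k i - k j = k i' - k j'"
    and m: "\<And>i j i' j'. ((i, j), (i', j')) \<in> Q \<Longrightarrow> m \<le> d i * d j * (d i' * d j')"
  shows "m * card Q \<le> Lp_integral 4 (trig_sum I d k)"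
proof -
  define D where "D = (\<lambda>(i, j). d i * d j)"
  define E where "E = (\<lambda>(i, j). k i - k j)"
  have n4: "of_real (norm (trig_sum I d k x) powr 4)
     = trig_sum ((I \<times> I) \<times> (I \<times> I)) (\<lambda>(p, q). D p * D q) (\<lambda>(p, q). E p - E q) x" for x
  proof -
    have sq: "of_real ((norm (trig_sum I d k x))\<^sup>2) = trig_sum (I \<times> I) D E x"
      unfolding norm_trig_sum_square D_def E_def ..
    have "norm (trig_sum I d k x) powr 4 = (norm (trig_sum I d k x)) ^ 4"
      by (cases "trig_sum I d k x = 0") auto
    also have "\<dots> = (norm (trig_sum I d k x))\<^sup>2 * (norm (trig_sum I d k x))\<^sup>2"
      by (simp flip: power_add)
    also have "of_real \<dots> = trig_sum (I \<times> I) D E x * cnj (trig_sum (I \<times> I) D E x)"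
      unfolding sq[symmetric] by simp
    finally show ?thesis unfolding cnj_trig_sum trig_sum_mult by simp
  qed
  define Z where "Z = {p\<in>(I \<times> I) \<times> (I \<times> I). (\<lambda>(p, q). E p - E q) p = 0}"
  have "((\<lambda>x. Re (of_real (norm (trig_sum I d k x) powr 4))) has_integral
      Re (of_real (\<Sum>p\<in>Z. (\<lambda>(p, q). D p * D q) p))) {0..1}"
    unfolding n4 Z_def using I
    by (intro has_integral_linear[OF has_integral_trig_sum bounded_linear_Re, unfolded o_def]) auto
  then have "Lp_integral 4 (trig_sum I d k) = (\<Sum>p\<in>Z. (\<lambda>(p, q). D p * D q) p)"
    unfolding Lp_integral_def by (simp add: integral_unique)
  also have "\<dots> \<ge> (\<Sum>p\<in>Q. (\<lambda>(p, q). D p * D q) p)"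
  proof (rule sum_mono2)
    show "finite Z" unfolding Z_def using I by simp
    show "Q \<subseteq> Z" unfolding Z_def E_def using Q eq by auto
  qed (auto simp: Z_def D_def intro!: mult_nonneg_nonneg d)
  moreover have "(\<Sum>p\<in>Q. m) \<le> (\<Sum>p\<in>Q. (\<lambda>(p, q). D p * D q) p)"
    by (intro sum_mono) (auto simp: D_def dest: m)
  ultimately show ?thesis by (simp add: mult.commute)
qed

subsection \<open>Lower bound by testing against a Fejer kernel\<close>

text \<open>The unnormalised Fejer kernel has integral J, is at most J^2, and has coefficient J - k
  at each frequency k from 0 to J, so its pairing with f is at least A. Splitting |f| at a suitable
  height bounds the pairing by A/2 plus a multiple of the p-th power integral, which must carry the
  other half.\<close>

lemma Lp_integral_trig_sum_ge_fejer:
  assumes I: "finite I" and d: "\<And>i. i \<in> I \<Longrightarrow> 0 \<le> d i" and k: "\<And>i. i \<in> I \<Longrightarrow> 0 \<le> k i"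
    and A: "0 < A" "A \<le> (\<Sum>i\<in>{i\<in>I. k i \<le> J}. d i * of_int (J - k i))" and J: "J > 0" and p: "p \<ge> 1"
  shows "(A / (2 * of_int J)) powr p / of_int J \<le> Lp_integral p (trig_sum I d k)"
proof -
  define N where "N = nat J"
  have N: "J = int N" "N > 0" using J by (auto simp: N_def)
  define f where "f = trig_sum I d k"
  define D where "D = trig_sum {..<N} (\<lambda>_. 1) int"
  define \<Phi> where "\<Phi> = (\<lambda>x. (norm (D x))\<^sup>2)"
  have sq: "of_real (\<Phi> x) = trig_sum ({..<N} \<times> {..<N}) (\<lambda>_. 1) (\<lambda>(i, j). int i - int j) x" for x
    unfolding \<Phi>_def D_def norm_trig_sum_square by (simp add: case_prod_unfold)
  have cont\<Phi>: "continuous_on {0..1} \<Phi>"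
    unfolding \<Phi>_def D_def by (intro continuous_intros continuous_on_trig_sum)
  have contf: "continuous_on {0..1} f" unfolding f_def by (rule continuous_on_trig_sum)
  have \<Phi>0: "\<Phi> x \<ge> 0" for x by (simp add: \<Phi>_def)
  have \<Phi>le: "\<Phi> x \<le> (real N)\<^sup>2" for x
  proof -
    have "norm (D x) \<le> (\<Sum>i<N. 1)"
      unfolding D_def trig_sum_def by (intro order_trans[OF norm_sum] sum_mono) (simp add: norm_mult)
    then show ?thesis unfolding \<Phi>_def by (intro power_mono) auto
  qed
  have int\<Phi>: "integral {0..1} \<Phi> = N"
  proof -
    have "((\<lambda>x. Re (of_real (\<Phi> x))) has_integral
       Re (of_real (\<Sum>p\<in>{p\<in>{..<N} \<times> {..<N}. (\<lambda>(i, j). int i - int j) p = 0}. 1))) {0..1}"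
      unfolding sq
      by (intro has_integral_linear[OF has_integral_trig_sum bounded_linear_Re, unfolded o_def]) auto
    moreover have "{p\<in>{..<N} \<times> {..<N}. (\<lambda>(i, j). int i - int j) p = 0} = (\<lambda>i. (i, i)) ` {..<N}" by auto
    moreover have "card ((\<lambda>i. (i, i)) ` {..<N}) = N" by (subst card_image) (auto simp: inj_on_def)
    ultimately show ?thesis by (simp add: integral_unique)
  qed
  let ?P = "I \<times> ({..<N} \<times> {..<N})"
  let ?d = "\<lambda>(i, q). d i * (\<lambda>_. 1) (q :: nat \<times> nat)"
  let ?k = "\<lambda>(i, q). k i + (\<lambda>(i, j). int i - int j) q"
  have "((\<lambda>x. Re (f x * of_real (\<Phi> x))) has_integral Re (of_real (\<Sum>p\<in>{p\<in>?P. ?k p = 0}. ?d p))) {0..1}"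
    unfolding f_def sq trig_sum_mult using I
    by (intro has_integral_linear[OF has_integral_trig_sum bounded_linear_Re, unfolded o_def]) auto
  then have If: "integral {0..1} (\<lambda>x. Re (f x * of_real (\<Phi> x))) = (\<Sum>p\<in>{p\<in>?P. ?k p = 0}. ?d p)"
    by (simp add: integral_unique)
  have "A \<le> (\<Sum>i\<in>{i\<in>I. k i \<le> J}. d i * of_int (J - k i))" by fact
  also have "\<dots> = (\<Sum>i\<in>{i\<in>I. k i \<le> J}. \<Sum>l\<in>{..<nat (J - k i)}. d i)"
    by (intro sum.cong) auto
  also have "\<dots> = (\<Sum>p\<in>(SIGMA i:{i\<in>I. k i \<le> J}. {..<nat (J - k i)}). d (fst p))"
    using I by (subst sum.Sigma) (auto simp: case_prod_unfold)
  \<comment> \<open>Each pair (l, l + k_i) with l < J - k_i lies in the index range of the kernel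
    and cancels the frequency k_i, producing J - k_i resonances.\<close>
  also have "\<dots> = (\<Sum>p\<in>(\<lambda>(i, l). (i, (l, l + nat (k i)))) ` (SIGMA i:{i\<in>I. k i \<le> J}. {..<nat (J - k i)}). ?d p)"
    by (subst sum.reindex) (auto simp: inj_on_def intro!: sum.cong)
  also have "\<dots> \<le> (\<Sum>p\<in>{p\<in>?P. ?k p = 0}. ?d p)"
  proof (rule sum_mono2)
    have "l < N \<and> l + nat (k i) < N" if "i \<in> I" "l < nat (J - k i)" for i l
      using k[OF that(1)] that(2) N by linarith
    then show "(\<lambda>(i, l). (i, (l, l + nat (k i)))) ` (SIGMA i:{i\<in>I. k i \<le> J}. {..<nat (J - k i)}) \<subseteq> {p\<in>?P. ?k p = 0}"
      using k by auto
  qed (use I d in auto)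
  also have "\<dots> = integral {0..1} (\<lambda>x. Re (f x * of_real (\<Phi> x)))" by (rule If[symmetric])
  finally have A1: "A \<le> integral {0..1} (\<lambda>x. Re (f x * of_real (\<Phi> x)))" .
  \<comment> \<open>This height makes \<open>l\<close> times the integral of the kernel equal to
    A/2.\<close>
  define l where "l = A / (2 * of_int J)"
  have l: "l > 0" using A J by (simp add: l_def)
  have "integral {0..1} (\<lambda>x. Re (f x * of_real (\<Phi> x))) \<le> integral {0..1} (\<lambda>x. l * \<Phi> x + l powr (1 - p) * (real N)\<^sup>2 * norm (f x) powr p)"
  proof (intro integral_le integrable_continuous_real)
    show "continuous_on {0..1} (\<lambda>x. Re (f x * of_real (\<Phi> x)))"
      by (intro continuous_intros contf cont\<Phi>)
    show "continuous_on {0..1} (\<lambda>x. l * \<Phi> x + l powr (1 - p) * (real N)\<^sup>2 * norm (f x) powr p)"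
      using p by (intro continuous_intros continuous_on_norm_powr contf cont\<Phi>) auto
    fix x :: real
    have "Re (f x * of_real (\<Phi> x)) \<le> norm (f x) * \<Phi> x"
      using complex_Re_le_cmod[of "f x * of_real (\<Phi> x)"] \<Phi>0[of x] by (simp add: norm_mult)
    also have "\<dots> \<le> (l + l powr (1 - p) * norm (f x) powr p) * \<Phi> x"
      using \<Phi>0 powr_le_powr_add_powr[of "norm (f x)" l 1 p] l p by (intro mult_right_mono) auto
    also have "\<dots> = l * \<Phi> x + l powr (1 - p) * norm (f x) powr p * \<Phi> x" by (simp add: algebra_simps)
    also have "\<dots> \<le> l * \<Phi> x + l powr (1 - p) * norm (f x) powr p * (real N)\<^sup>2"
      using \<Phi>le by (intro add_left_mono mult_left_mono) auto
    finally show "Re (f x * of_real (\<Phi> x)) \<le> l * \<Phi> x + l powr (1 - p) * (real N)\<^sup>2 * norm (f x) powr p"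
      by (simp add: mult_ac)
  qed
  also have "\<dots> = l * N + l powr (1 - p) * (real N)\<^sup>2 * Lp_integral p f"
    unfolding Lp_integral_def using p int\<Phi>
    by (subst integral_add)
      (auto intro!: integrable_continuous_real continuous_intros continuous_on_norm_powr contf cont\<Phi>)
  finally have "A \<le> l * N + l powr (1 - p) * (real N)\<^sup>2 * Lp_integral p f" using A1 by linarith
  moreover have "A = 2 * (l * N)" using N by (simp add: l_def)
  ultimately have "l * N \<le> l powr (1 - p) * (real N)\<^sup>2 * Lp_integral p f" by linarith
  then have "(l powr (p - 1) / (real N)\<^sup>2) * (l * N) \<le> (l powr (p - 1) / (real N)\<^sup>2) * (l powr (1 - p) * (real N)\<^sup>2 * Lp_integral p f)"
    by (intro mult_left_mono) auto
  also have "\<dots> = l powr (p - 1) * l powr (1 - p) * Lp_integral p f" using N by simp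
  also have "l powr (p - 1) * l powr (1 - p) = 1" using l by (simp add: powr_add[symmetric])
  also have "(l powr (p - 1) / (real N)\<^sup>2) * (l * N) = l powr p / of_int J"
    using l N by (simp add: powr_diff power2_eq_square)
  finally show ?thesis unfolding l_def f_def by simp
qed

subsection \<open>Lower bounds for blocks of the series\<close>

lemma series_block_eq_trig_sum:
  "series_block s a b = trig_sum {a..<b} (\<lambda>n. real n powr (-2 * s)) (\<lambda>n. int (n\<^sup>2))"
  by (rule ext) (simp add: series_block_def trig_sum_def)

lemma series_block_L2_ge:
  assumes s: "s > 0" and a: "1 \<le> a" "2 * a \<le> b"
  shows "2 powr (-4 * s) * real a powr (1 - 4 * s) \<le> Lp_integral 2 (series_block s a b)"
proof -
  have "2 powr (-4 * s) * real a powr (1 - 4 * s) = real a * (real (2 * a) powr (-2 * s))\<^sup>2"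
    using a by (simp add: powr_mult powr_diff powr_minus power_mult_distrib field_simps flip: powr_powr)
  also have "\<dots> = (\<Sum>n\<in>{a..<2 * a}. (real (2 * a) powr (-2 * s))\<^sup>2)" by simp
  also have "\<dots> \<le> (\<Sum>n\<in>{a..<2 * a}. (real n powr (-2 * s))\<^sup>2)"
    using s a by (intro sum_mono power_mono powr_mono2') auto
  also have "\<dots> \<le> (\<Sum>n\<in>{a..<b}. (real n powr (-2 * s))\<^sup>2)"
    using a by (intro sum_mono2) auto
  also have "\<dots> = Lp_integral 2 (series_block s a b)"
    unfolding series_block_eq_trig_sum
    by (subst Lp_integral_2_trig_sum) (auto simp: inj_on_def power2_eq_iff_nonneg)
  finally show ?thesis .
qed

lemma series_block_Lp_ge:
  assumes s: "s > 0" and a: "1 \<le> a" "2 * a \<le> b" and p: "p \<ge> 1"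
  shows "(2 powr (-2 * s) / 4 * real a powr (1 - 2 * s)) powr p / (8 * (real a)\<^sup>2) \<le> Lp_integral p (series_block s a b)"
proof -
  \<comment> \<open>For n < 2 a the frequencies n^2 are at most 4 a^2, so this degree leaves each of
    them a kernel coefficient of at least 4 a^2. It corresponds to the width a^(-2) of the peak at
    0.\<close>
  define J where "J = int (8 * a\<^sup>2)"
  define A where "A = real a * (real (2 * a) powr (-2 * s) * (4 * (real a)\<^sup>2))"
  have J: "J > 0" using a by (simp add: J_def)
  have A: "A > 0" using a by (simp add: A_def)
  have sq: "n\<^sup>2 \<le> 4 * a\<^sup>2" if "n < 2 * a" for n
    using power_mono[of n "2 * a" 2] that by (simp add: power_mult_distrib)
  have "A = (\<Sum>n\<in>{a..<2 * a}. real (2 * a) powr (-2 * s) * (4 * (real a)\<^sup>2))" by (simp add: A_def)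
  also have "\<dots> \<le> (\<Sum>n\<in>{a..<2 * a}. real n powr (-2 * s) * of_int (J - int (n\<^sup>2)))"
  proof (intro sum_mono mult_mono)
    fix n assume n: "n \<in> {a..<2 * a}"
    then show "real (2 * a) powr (-2 * s) \<le> real n powr (-2 * s)"
      using s a by (intro powr_mono2') auto
    have "real (n\<^sup>2) \<le> real (4 * a\<^sup>2)" using n sq[of n] by (intro of_nat_mono) auto
    then show "4 * (real a)\<^sup>2 \<le> of_int (J - int (n\<^sup>2))" by (simp add: J_def)
  qed auto
  also have "\<dots> \<le> (\<Sum>n\<in>{n\<in>{a..<b}. int (n\<^sup>2) \<le> J}. real n powr (-2 * s) * of_int (J - int (n\<^sup>2)))"
  proof (rule sum_mono2)
    have "int (n\<^sup>2) \<le> J" if "n < 2 * a" for n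
    proof -
      have "n\<^sup>2 \<le> 8 * a\<^sup>2" using sq[OF that] by linarith
      then show ?thesis unfolding J_def by (simp only: of_nat_le_iff)
    qed
    then show "{a..<2 * a} \<subseteq> {n\<in>{a..<b}. int (n\<^sup>2) \<le> J}" using a by fastforce
    show "0 \<le> real n powr (-2 * s) * of_int (J - int (n\<^sup>2))" if "n \<in> {n\<in>{a..<b}. int (n\<^sup>2) \<le> J} - {a..<2 * a}" for n
      using that by (intro mult_nonneg_nonneg) (auto simp flip: of_nat_power)
  qed auto
  finally have "(A / (2 * of_int J)) powr p / of_int J \<le> Lp_integral p (series_block s a b)"
    unfolding series_block_eq_trig_sum using A J p by (intro Lp_integral_trig_sum_ge_fejer) auto
  also have "A / (2 * of_int J) = 2 powr (-2 * s) / 4 * real a powr (1 - 2 * s)"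
  proof -
    have "real a powr (1 - 2 * s) = real a * real a powr (-2 * s)"
      using a powr_add[of "real a" 1 "-2 * s"] by simp
    then show ?thesis using a by (simp add: A_def J_def powr_mult power2_eq_square)
  qed
  finally show ?thesis by (simp add: J_def)
qed

section \<open>The logarithm in the number of quadruples\<close>

lemma sum_totient_ge:
  "ln (real K + 1) / 2 \<le> (\<Sum>d\<in>{1..K}. real (totient d) / (real d)\<^sup>2)"
proof -
  let ?T = "(\<Sum>d\<in>{1..K}. real (totient d) / (real d)\<^sup>2)"
  define S where "S = (SIGMA n:{1..K}. {d. d dvd n})"
  have fin: "finite {d. d dvd n}" if "n \<in> {1..K}" for n :: nat using that by simp
  \<comment> \<open>Write 1/n as n^(-2) times the sum of \<open>totient d\<close> over d | n. With n
    = d m, and after enlarging the range to all d, m <= K, this factors into the wanted sum times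
    the sum of m^(-2), which is at most 2.\<close>
  have "ln (real K + 1) \<le> harm K" by (rule ln_le_harm)
  also have "\<dots> = (\<Sum>n\<in>{1..K}. (1 / (real n)\<^sup>2) * real (\<Sum>d | d dvd n. totient d))"
    unfolding harm_def totient_divisor_sum by (intro sum.cong) (auto simp: power2_eq_square field_simps)
  also have "\<dots> = (\<Sum>n\<in>{1..K}. \<Sum>d | d dvd n. (1 / (real n)\<^sup>2) * real (totient d))"
    by (simp add: sum_distrib_left)
  also have "\<dots> = (\<Sum>(n, d)\<in>S. (1 / (real n)\<^sup>2) * real (totient d))"
    unfolding S_def using fin by (intro sum.Sigma) auto
  also have "\<dots> = (\<Sum>(d, m)\<in>(\<lambda>(n, d). (d, n div d)) ` S. real (totient d) / (real d)\<^sup>2 * (1 / (real m)\<^sup>2))"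
  proof (subst sum.reindex)
    show "inj_on (\<lambda>(n, d). (d, n div d)) S"
      by (auto simp: inj_on_def S_def)
    show "(\<Sum>(n, d)\<in>S. (1 / (real n)\<^sup>2) * real (totient d))
       = sum ((\<lambda>(d, m). real (totient d) / (real d)\<^sup>2 * (1 / (real m)\<^sup>2)) \<circ> (\<lambda>(n, d). (d, n div d))) S"
    proof (rule sum.cong)
      fix x assume "x \<in> S"
      then obtain n d where x: "x = (n, d)" "d dvd n" "n \<ge> 1" by (auto simp: S_def)
      then obtain m where m: "n = d * m" by (auto elim: dvdE)
      then have "d \<noteq> 0" "m \<noteq> 0" using x by auto
      then show "(case x of (n, d) \<Rightarrow> (1 / (real n)\<^sup>2) * real (totient d)) =
         ((\<lambda>(d, m). real (totient d) / (real d)\<^sup>2 * (1 / (real m)\<^sup>2)) \<circ> (\<lambda>(n, d). (d, n div d))) x"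
        by (simp add: x m power_mult_distrib)
    qed simp
  qed
  also have "\<dots> \<le> (\<Sum>(d, m)\<in>{1..K} \<times> {1..K}. real (totient d) / (real d)\<^sup>2 * (1 / (real m)\<^sup>2))"
  proof (rule sum_mono2)
    have *: "d \<in> {1..K} \<and> n div d \<in> {1..K}" if nd: "n \<in> {1..K}" "d dvd n" for n d
    proof -
      obtain m where m: "n = d * m" using nd by (auto elim: dvdE)
      then have "d \<noteq> 0" "m \<noteq> 0" using nd by auto
      then have "d \<le> d * m" "m \<le> d * m" by auto
      moreover have "d * m \<le> K" using m nd by auto
      ultimately have "d \<le> K" "m \<le> K" by linarith+
      then show ?thesis using m \<open>d \<noteq> 0\<close> \<open>m \<noteq> 0\<close> by auto
    qed
    show "(\<lambda>(n, d). (d, n div d)) ` S \<subseteq> {1..K} \<times> {1..K}"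
    proof (rule image_subsetI)
      fix x assume "x \<in> S"
      then obtain n d where "x = (n, d)" "n \<in> {1..K}" "d dvd n" by (auto simp: S_def)
      then show "(case x of (n, d) \<Rightarrow> (d, n div d)) \<in> {1..K} \<times> {1..K}" using *[of n d] by simp
    qed
    show "finite ({1..K} \<times> {1..K})" by simp
  qed auto
  also have "\<dots> = ?T * (\<Sum>m\<in>{1..K}. 1 / (real m)\<^sup>2)"
    by (simp add: sum_product sum.cartesian_product)
  also have "\<dots> \<le> ?T * 2"
  proof (intro mult_left_mono sum_nonneg)
    have "(\<Sum>m\<in>{1..K}. 1 / (real m)\<^sup>2) = (\<Sum>r\<in>{1..<int K + 1}. 1 / (of_int r)\<^sup>2)"
      by (rule sum.reindex_bij_witness[of _ nat int]) auto
    then show "(\<Sum>m\<in>{1..K}. 1 / (real m)\<^sup>2) \<le> 2" using sum_inverse_squares_le[of K] by simp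
  qed auto
  finally show ?thesis by simp
qed

text \<open>Solutions of \<open>n\<^sub>1\<^sup>2 - n\<^sub>3\<^sup>2 = n\<^sub>4\<^sup>2 - n\<^sub>2\<^sup>2\<close>: both sides equal \<open>4 u z A B\<close> for
  \<open>n\<^sub>1 = uA + zB\<close>, \<open>n\<^sub>3 = zB - uA\<close>, \<open>n\<^sub>4 = uB + zA\<close>, \<open>n\<^sub>2 = zA - uB\<close>. Choosing \<open>A = w\<close> and \<open>B = w + v\<close>
  with \<open>v\<close> coprime to \<open>w\<close> makes the parametrisation injective and produces the sum of
  \<open>totient w / w\<^sup>2\<close>, which carries the logarithm.\<close>

definition quad_params :: "nat \<Rightarrow> (nat \<times> nat \<times> nat \<times> nat) set" where
  "quad_params a = (SIGMA w:{1..a div 2}. totatives w \<times> {1..(a div w) div 2} \<times> {2 * (a div w) + 2..4 * (a div w)})"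

definition quad_point :: "nat \<times> nat \<times> nat \<times> nat \<Rightarrow> (nat \<times> nat) \<times> (nat \<times> nat)" where
  "quad_point = (\<lambda>(w, v, u, z).
     ((z * (w + v) + u * w, z * (w + v) - u * w), (z * w + u * (w + v), z * w - u * (w + v))))"

text \<open>The ranges keep the products with u at most a and those with z between 2 a and 8 a, so
  all four coordinates fall between a and 9 a and no subtraction is truncated. The summand 2 in the
  lower end for z compensates for the rounding in \<open>a div w\<close>; u stops at half of
  \<open>a div w\<close> because w + v <= 2 w.\<close>

lemma quad_params_bounds:
  assumes "(w, v, u, z) \<in> quad_params a"
  shows "1 \<le> w" "1 \<le> v" "v \<le> w" "coprime w (w + v)" "1 \<le> u" "1 \<le> z" "u * (w + v) \<le> a" "u * w \<le> a"
    "2 * a \<le> z * w" "2 * a \<le> z * (w + v)" "z * w \<le> 4 * a" "z * (w + v) \<le> 8 * a"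
proof -
  define t where "t = a div w"
  have w: "1 \<le> w" "w \<le> a div 2" and v: "v \<in> totatives w" and u: "1 \<le> u" "u \<le> t div 2"
    and z: "2 * t + 2 \<le> z" "z \<le> 4 * t"
    using assms by (auto simp: quad_params_def t_def)
  have v1: "1 \<le> v" "v \<le> w" "coprime v w" using v by (auto simp: totatives_def)
  show "1 \<le> w" "1 \<le> v" "v \<le> w" "1 \<le> u" "1 \<le> z" using w v1 u z by auto
  show "coprime w (w + v)" using v1(3) unfolding coprime_iff_gcd_eq_1 by (metis gcd.commute gcd_add2)
  have tw: "t * w \<le> a" by (simp add: t_def)
  have "a mod w < w" using w by simp
  moreover have "a = t * w + a mod w" by (simp add: t_def)
  ultimately have tw2: "a \<le> (t + 1) * w" by simp
  have "u * (w + v) \<le> u * (2 * w)" using v1 by (intro mult_left_mono) auto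
  also have "\<dots> = (2 * u) * w" by simp
  also have "\<dots> \<le> t * w" using u by (intro mult_right_mono) auto
  finally show uB: "u * (w + v) \<le> a" using tw by linarith
  then show "u * w \<le> a" by (simp add: distrib_left)
  have "2 * a \<le> (2 * t + 2) * w" using tw2 by (simp add: algebra_simps)
  also have "\<dots> \<le> z * w" using z by (intro mult_right_mono) auto
  finally show zA: "2 * a \<le> z * w" .
  then show "2 * a \<le> z * (w + v)" by (simp add: distrib_left)
  have "z * w \<le> (4 * t) * w" using z by (intro mult_right_mono) auto
  also have "\<dots> \<le> 4 * a" using tw by simp
  finally show zw: "z * w \<le> 4 * a" .
  have "z * v \<le> z * w" using v1 by (intro mult_left_mono) auto
  then show "z * (w + v) \<le> 8 * a" using zw unfolding distrib_left by linarith
qed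

text \<open>Sums and differences of the coordinates return uA, uB, zA and zB, where A = w and B = w
  + v. Coprimality gives u = gcd(uA, uB), after which w, v and z follow by cancellation.\<close>

lemma inj_on_quad_point: "inj_on quad_point (quad_params a)"
proof (rule inj_onI)
  fix p p' assume p: "p \<in> quad_params a" "p' \<in> quad_params a" and eq: "quad_point p = quad_point p'"
  obtain w v u z where pe: "p = (w, v, u, z)" by (cases p)
  obtain w' v' u' z' where pe': "p' = (w', v', u', z')" by (cases p')
  note b = quad_params_bounds[OF p(1)[unfolded pe]] and b' = quad_params_bounds[OF p(2)[unfolded pe']]
  define X Y X' Y' where "X = z * (w + v)" and "Y = u * w" and "X' = z' * (w' + v')" and "Y' = u' * w'"
  define U V U' V' where "U = z * w" and "V = u * (w + v)" and "U' = z' * w'" and "V' = u' * (w' + v')"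
  have "X + Y = X' + Y'" "X - Y = X' - Y'" "U + V = U' + V'" "U - V = U' - V'"
    using eq unfolding pe pe' quad_point_def X_def Y_def X'_def Y'_def U_def V_def U'_def V'_def by auto
  moreover have "Y \<le> X" "Y' \<le> X'" "V \<le> U" "V' \<le> U'"
    using b b' unfolding X_def Y_def X'_def Y'_def U_def V_def U'_def V'_def by linarith+
  ultimately have "Y = Y'" "X = X'" "V = V'" "U = U'" by linarith+
  then have e: "u * w = u' * w'" "u * (w + v) = u' * (w' + v')" "z * w = z' * w'"
    unfolding X_def Y_def X'_def Y'_def U_def V_def U'_def V'_def by auto
  have "u * gcd w (w + v) = u' * gcd w' (w' + v')" using e by (simp only: gcd_mult_distrib_nat)
  then have u: "u = u'" using b(4) b'(4) unfolding coprime_iff_gcd_eq_1 by simp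
  have w: "w = w'" using e(1) b(5) unfolding u by simp
  have "w + v = w' + v'" using e(2) b(5) unfolding u by simp
  moreover have "z = z'" using e(3) b(1) unfolding w by simp
  ultimately show "p = p'" using u w unfolding pe pe' by simp
qed

text \<open>With t = a div w >= 2 there are (t div 2) (2 t - 1) >= t^2 / 3 choices of (u, z), and t
  >= a / (2 w); this gives the factor 1/12. The remaining 1/4 comes from the totient sum together
  with sqrt a <= a div 2 + 1.\<close>

lemma card_quad_params_ge:
  assumes "a \<ge> 4"
  shows "(real a)\<^sup>2 / 48 * ln a \<le> card (quad_params a)"
proof -
  let ?T = "(\<Sum>w\<in>{1..a div 2}. real (totient w) / (real w)\<^sup>2)"
  have "card (quad_params a) = (\<Sum>w\<in>{1..a div 2}. totient w * ((a div w) div 2 * (2 * (a div w) - 1)))"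
    unfolding quad_params_def by (subst card_SigmaI) (auto simp: card_cartesian_product totient_def intro!: sum.cong)
  then have "real (card (quad_params a)) = (\<Sum>w\<in>{1..a div 2}. real (totient w * ((a div w) div 2 * (2 * (a div w) - 1))))"
    by simp
  also have "\<dots> \<ge> (\<Sum>w\<in>{1..a div 2}. (real a)\<^sup>2 / 12 * (real (totient w) / (real w)\<^sup>2))"
  proof (rule sum_mono)
    fix w assume w: "w \<in> {1..a div 2}"
    define t where "t = a div w"
    have "2 * w \<le> a" using w by auto
    then have t2: "t \<ge> 2" unfolding t_def using w by (simp add: less_eq_div_iff_mult_less_eq)
    have tr: "real a / real w \<le> 2 * real t"
    proof -
      have "a mod w < w" using w by simp
      moreover have "a = t * w + a mod w" by (simp add: t_def)
      ultimately have "a \<le> (t + 1) * w" by simp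
      also have "\<dots> \<le> (2 * t) * w" using t2 by (intro mult_right_mono) auto
      finally have "real a \<le> real (2 * t * w)" by (simp only: of_nat_le_iff)
      then show ?thesis using w by (simp add: divide_le_eq)
    qed
    have "(real a)\<^sup>2 / 12 * (real (totient w) / (real w)\<^sup>2) = real (totient w) * ((real a / real w)\<^sup>2 / 12)"
      by (simp add: power_divide mult_ac)
    also have "\<dots> \<le> real (totient w) * ((2 * real t)\<^sup>2 / 12)"
      using tr w by (intro mult_left_mono divide_right_mono power_mono) auto
    also have "(2 * real t)\<^sup>2 / 12 = real t / 3 * real t" by (simp add: power2_eq_square)
    also have "real (totient w) * (real t / 3 * real t) \<le> real (totient w) * (real (t div 2) * real (2 * t - 1))"
    proof (intro mult_left_mono mult_mono)
      have "t \<le> 3 * (t div 2)" using t2 by linarith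
      then show "real t / 3 \<le> real (t div 2)" by linarith
      show "real t \<le> real (2 * t - 1)" using t2 by simp
    qed auto
    finally show "(real a)\<^sup>2 / 12 * (real (totient w) / (real w)\<^sup>2) \<le> real (totient w * ((a div w) div 2 * (2 * (a div w) - 1)))"
      unfolding t_def by simp
  qed
  also have "(\<Sum>w\<in>{1..a div 2}. (real a)\<^sup>2 / 12 * (real (totient w) / (real w)\<^sup>2))
     = (real a)\<^sup>2 / 12 * ?T" by (simp only: sum_distrib_left)
  finally have 1: "(real a)\<^sup>2 / 12 * ?T \<le> card (quad_params a)" .
  have "ln (real a) / 2 = ln (sqrt (real a))" using assms by (simp add: ln_sqrt)
  also have "\<dots> \<le> ln (real (a div 2) + 1)"
  proof (rule ln_mono)
    have "sqrt (real a) * 2 \<le> sqrt (real a) * sqrt (real a)"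
      using assms real_sqrt_le_mono[of 4 "real a"] by (intro mult_left_mono) auto
    then have "sqrt (real a) \<le> real a / 2" by simp
    also have "real a / 2 \<le> real (a div 2) + 1" by linarith
    finally show "sqrt (real a) \<le> real (a div 2) + 1" .
  qed (use assms in auto)
  finally have "ln (real a) / 4 \<le> ?T"
    using sum_totient_ge[of "a div 2"] by linarith
  then have "(real a)\<^sup>2 / 12 * (ln (real a) / 4) \<le> (real a)\<^sup>2 / 12 * ?T"
    by (intro mult_left_mono) auto
  moreover have "(real a)\<^sup>2 / 12 * (ln (real a) / 4) = (real a)\<^sup>2 / 48 * ln a" by simp
  ultimately show ?thesis using 1 by linarith
qed

lemma series_block_L4_ge:
  assumes s: "s > 0" and a: "4 \<le> a" "10 * a \<le> b"
  shows "10 powr (-8 * s) / 48 * (real a powr (2 - 8 * s) * ln a) \<le> Lp_integral 4 (series_block s a b)"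
proof -
  define Q where "Q = quad_point ` quad_params a"
  \<comment> \<open>All coordinates are at most 9 a, hence below 10 a, so m bounds every product of
    four coefficients from below.\<close>
  define m where "m = (real (10 * a) powr (-2 * s)) ^ 4"
  have mem: "i \<in> {a..<b} \<and> j \<in> {a..<b} \<and> i' \<in> {a..<b} \<and> j' \<in> {a..<b} \<and>
      int (i\<^sup>2) - int (j\<^sup>2) = int (i'\<^sup>2) - int (j'\<^sup>2) \<and> i \<le> 10 * a \<and> j \<le> 10 * a \<and> i' \<le> 10 * a \<and> j' \<le> 10 * a"
    if inQ: "((i, j), (i', j')) \<in> Q" for i j i' j'
  proof -
    obtain p where p: "p \<in> quad_params a" "((i, j), (i', j')) = quad_point p"
      using inQ unfolding Q_def by blast
    obtain w v u z where pe: "p = (w, v, u, z)" by (cases p)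
    have q: "(w, v, u, z) \<in> quad_params a" using p pe by simp
    have e: "i = z * (w + v) + u * w" "j = z * (w + v) - u * w" "i' = z * w + u * (w + v)" "j' = z * w - u * (w + v)"
      using p(2) unfolding pe quad_point_def by simp_all
    note b = quad_params_bounds[OF q]
    define X Y U V where "X = z * (w + v)" and "Y = u * w" and "U = z * w" and "V = u * (w + v)"
    have bb: "2 * a \<le> X" "X \<le> 8 * a" "Y \<le> a" "2 * a \<le> U" "U \<le> 4 * a" "V \<le> a" "X * Y = U * V"
      using b unfolding X_def Y_def U_def V_def by (auto simp: mult_ac)
    have e': "i = X + Y" "j = X - Y" "i' = U + V" "j' = U - V" using e by (auto simp: X_def Y_def U_def V_def)
    have sq: "int ((x + y)\<^sup>2) - int ((x - y)\<^sup>2) = 4 * int (x * y)" if "y \<le> x" for x y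
      using that unfolding of_nat_power of_nat_diff[OF that] by (simp add: power2_eq_square algebra_simps)
    have "int (i\<^sup>2) - int (j\<^sup>2) = 4 * int (X * Y)"
      using bb unfolding e' by (intro sq) linarith
    moreover have "int (i'\<^sup>2) - int (j'\<^sup>2) = 4 * int (U * V)"
      using bb unfolding e' by (intro sq) linarith
    ultimately have "int (i\<^sup>2) - int (j\<^sup>2) = int (i'\<^sup>2) - int (j'\<^sup>2)" using bb by simp
    moreover have "a \<le> i" "a \<le> j" "a \<le> i'" "a \<le> j'" "i \<le> 9 * a" "j \<le> 9 * a" "i' \<le> 9 * a" "j' \<le> 9 * a"
      using bb unfolding e' by linarith+
    ultimately show ?thesis using a by auto
  qed
  have "m * card Q \<le> Lp_integral 4 (series_block s a b)"
    unfolding series_block_eq_trig_sum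
  proof (rule Lp_integral_4_trig_sum_ge)
    show "Q \<subseteq> ({a..<b} \<times> {a..<b}) \<times> ({a..<b} \<times> {a..<b})" using mem by auto
    fix i j i' j' assume q: "((i, j), (i', j')) \<in> Q"
    show "int (i\<^sup>2) - int (j\<^sup>2) = int (i'\<^sup>2) - int (j'\<^sup>2)" using mem[OF q] by blast
    have "real (10 * a) powr (-2 * s) \<le> real n powr (-2 * s)" if "n \<in> {a..<b}" "n \<le> 10 * a" for n
      using that s a by (intro powr_mono2') auto
    then have "real (10 * a) powr (-2 * s) * real (10 * a) powr (-2 * s) * (real (10 * a) powr (-2 * s) * real (10 * a) powr (-2 * s))
       \<le> real i powr (-2 * s) * real j powr (-2 * s) * (real i' powr (-2 * s) * real j' powr (-2 * s))"
      using mem[OF q] by (intro mult_mono) auto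
    then show "m \<le> real i powr (-2 * s) * real j powr (-2 * s) * (real i' powr (-2 * s) * real j' powr (-2 * s))"
      by (simp add: m_def eval_nat_numeral mult.assoc)
  qed auto
  moreover have "card Q = card (quad_params a)" unfolding Q_def by (rule card_image[OF inj_on_quad_point])
  moreover have "m * ((real a)\<^sup>2 / 48 * ln a) \<le> m * card (quad_params a)"
    using card_quad_params_ge[OF a(1)] by (intro mult_left_mono) (auto simp: m_def)
  moreover have "m * ((real a)\<^sup>2 / 48 * ln a) = 10 powr (-8 * s) / 48 * (real a powr (2 - 8 * s) * ln a)"
  proof -
    have "m = real (10 * a) powr (-8 * s)"
      unfolding m_def using a by (simp add: powr_power)
    also have "\<dots> = 10 powr (-8 * s) * real a powr (-8 * s)" by (simp add: powr_mult)
    finally have m: "m = 10 powr (-8 * s) * real a powr (-8 * s)" .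
    have "real a powr (2 - 8 * s) = (real a)\<^sup>2 * real a powr (-8 * s)"
      using a powr_add[of "real a" 2 "-8 * s"] by simp
    then show ?thesis unfolding m by simp
  qed
  ultimately show ?thesis by (metis order_trans)
qed

subsection \<open>Two-sided bounds for blocks\<close>

text \<open>Exponents below 3 use the rate at 3: on a space of measure 1 they inherit its upper
  bound, and square-root growth is common to all exponents below 4.\<close>

definition block_rate :: "real \<Rightarrow> real \<Rightarrow> nat \<Rightarrow> real" where
  "block_rate P s a = weyl_growth (max P 3) (real a) * real a powr (-2 * s)"

lemma block_rate_pos: "a \<ge> 1 \<Longrightarrow> block_rate P s a > 0"
  unfolding block_rate_def by (intro mult_pos_pos weyl_growth_pos) auto

lemma block_rate_less_4:
  assumes "P < 4" "a \<ge> 1"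
  shows "block_rate P s a = real a powr (1/2 - 2 * s)"
proof -
  have "max (1/2) (1 - 2 / max P 3) = 1/2" using assms by (auto simp: max_def field_simps)
  moreover have "max P 3 \<noteq> 4" using assms by auto
  ultimately show ?thesis
    unfolding block_rate_def weyl_growth_def by (simp only: if_False mult_1_right powr_add[symmetric]) simp
qed

lemma block_rate_greater_4:
  assumes "P > 4" "a \<ge> 1"
  shows "block_rate P s a = real a powr (1 - 2/P - 2 * s)"
proof -
  have "max (1/2) (1 - 2 / max P 3) = 1 - 2/P" using assms by (auto simp: max_def field_simps)
  moreover have "max P 3 \<noteq> 4" using assms by auto
  ultimately show ?thesis
    unfolding block_rate_def weyl_growth_def by (simp only: if_False mult_1_right powr_add[symmetric]) simp
qed

lemma block_rate_4:
  assumes "a \<ge> 1"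
  shows "block_rate 4 s a = real a powr (1/2 - 2 * s) * (1 + ln a) powr (1/4)"
  using powr_add[of "real a" "1/2" "-2 * s"] by (simp add: block_rate_def weyl_growth_def mult_ac)

lemma admissible_exponent:
  fixes P s :: real
  assumes "P \<le> 4 \<Longrightarrow> s > 1/4" "P > 4 \<Longrightarrow> s > 1/2 - 1/P"
  shows "s > 1/4" "2 * s > max (1/2) (1 - 2 / max P 3)"
proof -
  show s: "s > 1/4"
  proof (cases "P \<le> 4")
    case False
    then have "1 / P < 1/4" by (simp add: field_simps)
    then show ?thesis using assms(2) False by linarith
  qed (use assms in auto)
  show "2 * s > max (1/2) (1 - 2 / max P 3)"
  proof (cases "P \<le> 4")
    case True
    then have eq: "max (1/2) (1 - 2 / max P 3) = 1/2" by (auto simp: max_def field_simps)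
    show ?thesis unfolding eq using s by simp
  next
    case False
    then have eq: "max (1/2) (1 - 2 / max P 3) = 1 - 2/P" by (auto simp: max_def field_simps)
    show ?thesis unfolding eq using assms(2) False by simp
  qed
qed

lemma block_rate_tendsto_0:
  assumes "2 * s > max (1/2) (1 - 2 / max P 3)"
  shows "(\<lambda>a. block_rate P s a) \<longlonglongrightarrow> 0"
proof -
  define \<alpha> where "\<alpha> = max (1/2) (1 - 2 / max P 3)"
  define \<epsilon> where "\<epsilon> = (2 * s - \<alpha>) / 2"
  have \<epsilon>: "\<epsilon> > 0" using assms by (simp add: \<epsilon>_def \<alpha>_def)
  define K where "K = (1 + 1/\<epsilon>) * weyl_growth (max P 3) 1"
  have le: "block_rate P s a \<le> K * real a powr (- \<epsilon>)" if "a \<ge> 1" for a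
  proof -
    have "weyl_growth (max P 3) (real a) \<le> K * (real a / 1) powr (\<alpha> + \<epsilon>)"
      unfolding K_def \<alpha>_def using that \<epsilon> by (intro weyl_growth_le_powr) auto
    then have "block_rate P s a \<le> K * (real a / 1) powr (\<alpha> + \<epsilon>) * real a powr (-2 * s)"
      unfolding block_rate_def by (intro mult_right_mono) auto
    also have "\<dots> = K * (real a powr (\<alpha> + \<epsilon>) * real a powr (-2 * s))" by simp
    also have "real a powr (\<alpha> + \<epsilon>) * real a powr (-2 * s) = real a powr (- \<epsilon>)"
    proof -
      have "\<alpha> + \<epsilon> + -2 * s = - \<epsilon>" by (simp add: \<epsilon>_def field_simps)
      then show ?thesis by (simp only: powr_add[symmetric])
    qed
    finally show ?thesis .
  qed
  have "(\<lambda>a. K * real a powr (- \<epsilon>)) \<longlonglongrightarrow> K * 0"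
    using \<epsilon> by (intro tendsto_mult tendsto_const tendsto_neg_powr filterlim_real_sequentially) auto
  then have lim: "(\<lambda>a. K * real a powr (- \<epsilon>)) \<longlonglongrightarrow> 0" by simp
  show ?thesis
  proof (rule tendsto_sandwich[OF _ _ tendsto_const lim])
    show "\<forall>\<^sub>F a in sequentially. 0 \<le> block_rate P s a"
      using block_rate_pos by (intro eventually_sequentiallyI[of 1]) (auto intro: less_imp_le)
    show "\<forall>\<^sub>F a in sequentially. block_rate P s a \<le> K * real a powr (- \<epsilon>)"
      using le by (intro eventually_sequentiallyI[of 1])
  qed
qed

text \<open>The exponent is lowered from r = max P 3 to P with splitting height \<open>l\<close>
  equal to the bound for the L^r norm, which turns both terms into \<open>l powr P\<close> and
  explains the factor 2 powr (1/P).\<close>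

lemma block_upper_bound:
  assumes P: "P > 0" and s: "2 * s > max (1/2) (1 - 2 / max P 3)"
  shows "\<exists>K>0. \<forall>a b. 1 \<le> a \<longrightarrow> Lp_integral P (series_block s a b) \<le> (K * block_rate P s a) powr P"
proof -
  define r where "r = max P 3"
  have r: "r \<ge> 3" by (simp add: r_def)
  obtain K where K: "K > 0" and le: "\<And>a b. 1 \<le> a \<Longrightarrow> Lp_integral r (series_block s a b) \<le> (K * block_rate P s a) powr r"
    using series_block_Lp_le[OF r] s unfolding r_def block_rate_def by blast
  have main: "Lp_integral P (series_block s a b) \<le> (2 powr (1/P) * K * block_rate P s a) powr P" if a: "1 \<le> a" for a b
  proof -
    define l where "l = K * block_rate P s a"
    have l: "l > 0" using K block_rate_pos[OF a] by (simp add: l_def)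
    have "Lp_integral P (series_block s a b) \<le> l powr P + l powr (P - r) * Lp_integral r (series_block s a b)"
      using P l by (intro Lp_integral_le_of_exponent_le continuous_on_series_block) (auto simp: r_def)
    also have "\<dots> \<le> l powr P + l powr (P - r) * l powr r"
      using le[OF a] by (intro add_left_mono mult_left_mono) (auto simp: l_def)
    also have "l powr (P - r) * l powr r = l powr P" by (simp add: powr_add[symmetric])
    also have "l powr P + l powr P = (2 powr (1/P) * l) powr P"
      using P by (simp add: powr_mult powr_powr)
    finally show ?thesis by (simp add: l_def mult.assoc)
  qed
  show ?thesis using K main by (intro exI[of _ "2 powr (1/P) * K"]) auto
qed

text \<open>Common end of the two cases below 4: half of the L^2 lower bound has been absorbed at
  splitting height \<kappa> \<rho>, and solving for I fixes the constant.\<close>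

lemma powr_lower_bound_of_split:
  fixes P e \<kappa> \<rho> I :: real
  assumes P: "P > 0" and e: "e > 0" and \<kappa>: "\<kappa> > 0" and \<rho>: "\<rho> > 0"
    and le: "e / 2 * \<rho> powr 2 \<le> (\<kappa> * \<rho>) powr (2 - P) * I"
  shows "((e / 2 * \<kappa> powr (P - 2)) powr (1/P) * \<rho>) powr P \<le> I"
proof -
  define l where "l = \<kappa> * \<rho>"
  have l: "l > 0" using \<kappa> \<rho> by (simp add: l_def)
  have "((e / 2 * \<kappa> powr (P - 2)) powr (1/P) * \<rho>) powr P = e / 2 * \<kappa> powr (P - 2) * \<rho> powr P"
    using P e \<kappa> by (simp add: powr_mult powr_powr)
  also have "\<rho> powr P = \<rho> powr (P - 2) * \<rho> powr 2" by (simp only: powr_add[symmetric]) simp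
  also have "e / 2 * \<kappa> powr (P - 2) * (\<rho> powr (P - 2) * \<rho> powr 2) = l powr (P - 2) * (e / 2 * \<rho> powr 2)"
    by (simp add: l_def powr_mult)
  also have "\<dots> \<le> l powr (P - 2) * (l powr (2 - P) * I)"
    using le unfolding l_def by (intro mult_left_mono) auto
  also have "\<dots> = (l powr (P - 2) * l powr (2 - P)) * I" by simp
  also have "l powr (P - 2) * l powr (2 - P) = 1" using l by (simp add: powr_add[symmetric])
  finally show ?thesis by simp
qed

lemma block_lower_bound:
  assumes P: "P > 0" and s: "P \<le> 4 \<Longrightarrow> s > 1/4" "P > 4 \<Longrightarrow> s > 1/2 - 1/P"
  shows "\<exists>c>0. \<forall>a b. 4 \<le> a \<longrightarrow> 10 * a \<le> b \<longrightarrow> (c * block_rate P s a) powr P \<le> Lp_integral P (series_block s a b)"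
proof -
  have s4: "s > 1/4" using admissible_exponent[OF s] by simp
  then have s0: "s > 0" by linarith
  consider "P < 2" | "2 \<le> P" "P < 4" | "P = 4" | "P > 4" by linarith
  then show ?thesis
  proof cases
    case 1
    obtain K where K: "K > 0" and up: "\<And>a b. 1 \<le> a \<Longrightarrow> Lp_integral 3 (series_block s a b) \<le> (K * block_rate 3 s a) powr 3"
      using block_upper_bound[of 3 s] s4 by auto
    define e where "e = 2 powr (-4 * s)"
    have e: "e > 0" by (simp add: e_def)
    \<comment> \<open>Chosen so that the L^3 term K^3 \<rho>^2 / \<kappa> is exactly half of the L^2
      lower bound e \<rho>^2.\<close>
    define \<kappa> where "\<kappa> = 2 * K ^ 3 / e"
    have \<kappa>: "\<kappa> > 0" using K e by (simp add: \<kappa>_def)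
    define c where "c = (e / 2 * \<kappa> powr (P - 2)) powr (1/P)"
    have c: "c > 0" using e \<kappa> by (simp add: c_def)
    show ?thesis
    proof (intro exI[of _ c] conjI allI impI c)
      fix a b :: nat assume a: "4 \<le> a" "10 * a \<le> b"
      define \<rho> where "\<rho> = real a powr (1/2 - 2 * s)"
      have \<rho>: "\<rho> > 0" using a by (simp add: \<rho>_def)
      have \<rho>2: "\<rho> powr 2 = real a powr (1 - 4 * s)" by (simp add: \<rho>_def powr_powr)
      have \<rho>P: "block_rate P s a = \<rho>" "block_rate 3 s a = \<rho>"
        unfolding \<rho>_def using 1 a by (intro block_rate_less_4; simp)+
      define l where "l = \<kappa> * \<rho>"
      have l: "l > 0" using \<kappa> \<rho> by (simp add: l_def)
      have "e * \<rho> powr 2 \<le> Lp_integral 2 (series_block s a b)"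
        unfolding e_def \<rho>2 using s0 a by (intro series_block_L2_ge) auto
      also have "\<dots> \<le> l powr (2 - P) * Lp_integral P (series_block s a b) + l powr (2 - 3) * Lp_integral 3 (series_block s a b)"
        using P 1 l by (intro Lp_integral_interpolation continuous_on_series_block) auto
      also have "l powr (2 - 3) * Lp_integral 3 (series_block s a b) \<le> l powr (2 - 3) * (K * \<rho>) powr 3"
        using up[of a b] a unfolding \<rho>P by (intro mult_left_mono) auto
      also have "l powr (2 - 3) * (K * \<rho>) powr 3 = e / 2 * \<rho> powr 2"
        using l K \<rho> e by (simp add: l_def \<kappa>_def powr_minus_divide power_mult_distrib field_simps eval_nat_numeral)
      finally have "e / 2 * \<rho> powr 2 \<le> l powr (2 - P) * Lp_integral P (series_block s a b)" by simp
      then show "(c * block_rate P s a) powr P \<le> Lp_integral P (series_block s a b)"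
        unfolding c_def \<rho>P l_def by (rule powr_lower_bound_of_split[OF P e \<kappa> \<rho>])
    qed
  next
    case 2
    define e where "e = 2 powr (-4 * s)"
    have e: "e > 0" by (simp add: e_def)
    \<comment> \<open>For P >= 2 no higher exponent enters: values below \<open>l\<close> contribute
      at most l^2 = e \<rho>^2 / 2 to the integral of the square, and values above are controlled by
      the P-th power.\<close>
    define \<kappa> where "\<kappa> = sqrt (e / 2)"
    have \<kappa>: "\<kappa> > 0" "\<kappa> powr 2 = e / 2" using e by (auto simp: \<kappa>_def)
    define c where "c = (e / 2 * \<kappa> powr (P - 2)) powr (1/P)"
    have c: "c > 0" using e \<kappa> by (simp add: c_def)
    show ?thesis
    proof (intro exI[of _ c] conjI allI impI c)
      fix a b :: nat assume a: "4 \<le> a" "10 * a \<le> b"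
      define \<rho> where "\<rho> = real a powr (1/2 - 2 * s)"
      have \<rho>: "\<rho> > 0" using a by (simp add: \<rho>_def)
      have \<rho>2: "\<rho> powr 2 = real a powr (1 - 4 * s)" by (simp add: \<rho>_def powr_powr)
      have \<rho>P: "block_rate P s a = \<rho>"
        unfolding \<rho>_def using 2 a by (intro block_rate_less_4) auto
      define l where "l = \<kappa> * \<rho>"
      have l: "l > 0" using \<kappa> \<rho> by (simp add: l_def)
      have l2: "l powr 2 = e / 2 * \<rho> powr 2" unfolding l_def powr_mult \<kappa>(2) ..
      have "e * \<rho> powr 2 \<le> Lp_integral 2 (series_block s a b)"
        unfolding e_def \<rho>2 using s0 a by (intro series_block_L2_ge) auto
      also have "\<dots> \<le> l powr 2 + l powr (2 - P) * Lp_integral P (series_block s a b)"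
        using P 2 l by (intro Lp_integral_le_of_exponent_le continuous_on_series_block) auto
      finally have "e / 2 * \<rho> powr 2 \<le> l powr (2 - P) * Lp_integral P (series_block s a b)" unfolding l2 by simp
      then show "(c * block_rate P s a) powr P \<le> Lp_integral P (series_block s a b)"
        unfolding c_def \<rho>P l_def by (rule powr_lower_bound_of_split[OF P e \<kappa>(1) \<rho>])
    qed
  next
    case 3
    \<comment> \<open>Here 96 = 2 * 48, since 1 + ln a <= 2 ln a for a >= 4.\<close>
    define e where "e = 10 powr (-8 * s) / 96"
    have e: "e > 0" by (simp add: e_def)
    show ?thesis
    proof (intro exI[of _ "e powr (1/4)"] conjI allI impI)
      fix a b :: nat assume a: "4 \<le> a" "10 * a \<le> b"
      have "exp 1 \<le> real a" using exp_le a by linarith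
      then have ln1: "1 \<le> ln (real a)" using a by (simp add: ln_ge_iff)
      have "(e powr (1/4) * block_rate P s a) powr P = e * (block_rate 4 s a) powr 4"
        using e by (simp add: 3 powr_mult powr_powr)
      also have "block_rate 4 s a powr 4 = real a powr (2 - 8 * s) * (1 + ln a)"
        using a ln1 by (subst block_rate_4) (auto simp: powr_mult powr_powr)
      also have "\<dots> \<le> real a powr (2 - 8 * s) * (2 * ln a)" using ln1 by (intro mult_left_mono) auto
      finally have "(e powr (1/4) * block_rate P s a) powr P \<le> e * (real a powr (2 - 8 * s) * (2 * ln a))"
        using e by simp
      also have "\<dots> = 10 powr (-8 * s) / 48 * (real a powr (2 - 8 * s) * ln a)" by (simp add: e_def)
      also have "\<dots> \<le> Lp_integral P (series_block s a b)"
        unfolding 3 using s0 a by (intro series_block_L4_ge) auto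
      finally show "(e powr (1/4) * block_rate P s a) powr P \<le> Lp_integral P (series_block s a b)" .
    qed (use e in auto)
  next
    case 4
    \<comment> \<open>The 8 comes from the kernel degree 8 a^2: its P-th root also supplies the
      power a^(-2/P) that completes the rate.\<close>
    define c where "c = 2 powr (-2 * s) / 4 * 8 powr (-1/P)"
    have c: "c > 0" by (simp add: c_def)
    show ?thesis
    proof (intro exI[of _ c] conjI allI impI c)
      fix a b :: nat assume a: "4 \<le> a" "10 * a \<le> b"
      have "block_rate P s a = real a powr (1 - 2 * s) * real a powr (-2/P)"
        unfolding powr_add[symmetric] using 4 a by (subst block_rate_greater_4) (auto simp: algebra_simps)
      then have "c * block_rate P s a = (2 powr (-2 * s) / 4 * real a powr (1 - 2 * s)) * (8 powr (-1/P) * real a powr (-2/P))"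
        by (simp add: c_def mult_ac)
      then have "(c * block_rate P s a) powr P = (2 powr (-2 * s) / 4 * real a powr (1 - 2 * s)) powr P * ((8 powr (-1/P)) powr P * (real a powr (-2/P)) powr P)"
        by (simp only: powr_mult)
      also have "(8 powr (-1/P)) powr P * (real a powr (-2/P)) powr P = 1 / (8 * (real a)\<^sup>2)"
        using 4 a by (simp add: powr_powr) (simp add: powr_minus_divide)
      finally show "(c * block_rate P s a) powr P \<le> Lp_integral P (series_block s a b)"
        using series_block_Lp_ge[of s a b P] s0 a 4 by simp
    qed
  qed
qed

section \<open>Absolute convergence and the value at zero\<close>

lemma sum_powr_tail_le:
  fixes s :: real
  assumes s: "s > 1/2" and ab: "1 \<le> a" "a \<le> b"
  shows "(\<Sum>n\<in>{a..<b}. real n powr (-2 * s)) \<le> 1 / (1 - 1 / (2 * s)) * real a powr (1 - 2 * s)"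
proof -
  define c where "c = (\<lambda>n::nat. real n powr (-2 * s))"
  have dec: "c (Suc n) \<le> c n" if "n \<ge> 1" for n
    unfolding c_def using that s by (intro powr_mono2') auto
  \<comment> \<open>Abel summation with all phases equal to 1: the partial sums are lengths, so the
    telescoping estimate applies with exponent 1, admissible since 2 s > 1.\<close>
  have "(\<Sum>n\<in>{a..<b}. c n) = (\<Sum>n\<in>{a..<b}. (c n - c (Suc n)) * real (Suc n - a)) + c b * real (b - a)"
    using sum_by_parts[OF ab(2), of c "\<lambda>_. 1 :: real"] by simp
  also have "\<dots> \<le> (\<Sum>n\<in>{a..<b}. (c n - c (Suc n)) * real n powr 1) + c b * real b powr 1"
    using ab dec by (intro add_mono sum_mono mult_left_mono) (auto simp: c_def)
  also have "\<dots> \<le> 1 / (1 - 1 / (2 * s)) * real a powr (1 - 2 * s)"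
    unfolding c_def using s ab by (intro sum_powr_differences_le) auto
  finally show ?thesis by (simp add: c_def)
qed

lemma norm_series_block_le:
  assumes "s > 1/2" "1 \<le> a"
  shows "norm (series_block s a b x) \<le> 1 / (1 - 1 / (2 * s)) * real a powr (1 - 2 * s)"
proof (cases "a \<le> b")
  case True
  have "norm (series_block s a b x) \<le> (\<Sum>n\<in>{a..<b}. real n powr (-2 * s))"
    unfolding series_block_def by (intro order_trans[OF norm_sum] sum_mono) (simp add: norm_mult)
  then show ?thesis using sum_powr_tail_le[OF assms True] by linarith
next
  case False
  then show ?thesis using assms by (simp add: series_block_def)
qed

lemma norm_series_block_0_ge:
  assumes s: "s > 0" and a: "1 \<le> a" "2 * a \<le> b"
  shows "2 powr (-2 * s) * real a powr (1 - 2 * s) \<le> norm (series_block s a b 0)"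
proof -
  have "2 powr (-2 * s) * real a powr (1 - 2 * s) = (\<Sum>n\<in>{a..<2 * a}. real (2 * a) powr (-2 * s))"
    using a powr_add[of "real a" 1 "-2 * s"] by (simp add: powr_mult)
  also have "\<dots> \<le> (\<Sum>n\<in>{a..<2 * a}. real n powr (-2 * s))"
    using s a by (intro sum_mono powr_mono2') auto
  also have "\<dots> \<le> (\<Sum>n\<in>{a..<b}. real n powr (-2 * s))"
    using a by (intro sum_mono2) auto
  also have "\<dots> = norm (of_real (\<Sum>n\<in>{a..<b}. real n powr (-2 * s)) :: complex)"
    by (simp only: norm_of_real) (simp add: sum_nonneg)
  also have "of_real (\<Sum>n\<in>{a..<b}. real n powr (-2 * s)) = series_block s a b 0"
    by (simp add: series_block_def)
  finally show ?thesis .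
qed

subsection \<open>Passing to the limit\<close>

text \<open>The P-th power of the norm as an extended integral: it makes sense for limits that are
  merely measurable, and spares the roots.\<close>

definition Lp_nn :: "real \<Rightarrow> (real \<Rightarrow> complex) \<Rightarrow> ennreal" where
  "Lp_nn P f = (\<integral>\<^sup>+ x. ennreal (norm (f x) powr P) \<partial>lebesgue_on {0..1})"

lemma Lp_nn_continuous:
  assumes "continuous_on {0..1} g" "P > 0"
  shows "Lp_nn P g = ennreal (Lp_integral P g)"
proof -
  have "((\<lambda>x. norm (g x) powr P) has_integral Lp_integral P g) {0..1}"
    unfolding Lp_integral_def by (rule integrable_integral[OF norm_powr_integrable[OF assms]])
  then have "(\<integral>\<^sup>+x. ennreal (norm (g x) powr P) * indicator {0..1} x \<partial>lborel) = ennreal (Lp_integral P g)"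
    by (intro nn_integral_has_integral_lebesgue') auto
  then show ?thesis
    unfolding Lp_nn_def by (subst nn_integral_restrict_space) (auto simp: nn_integral_completion)
qed

lemma Lp_norm_le_iff:
  assumes "P > 0" "B \<ge> 0"
  shows "Lp_norm (ennreal P) f \<le> ennreal B \<longleftrightarrow> Lp_nn P f \<le> ennreal (B powr P)"
proof (cases "Lp_nn P f")
  case (real y)
  have "y powr (1/P) \<le> B \<longleftrightarrow> y \<le> B powr P"
  proof
    assume "y powr (1/P) \<le> B"
    then have "(y powr (1/P)) powr P \<le> B powr P" using assms by (intro powr_mono2) auto
    then show "y \<le> B powr P" using assms real by (simp add: powr_powr)
  next
    assume "y \<le> B powr P"
    then have "y powr (1/P) \<le> (B powr P) powr (1/P)" using assms real by (intro powr_mono2) auto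
    then show "y powr (1/P) \<le> B" using assms by (simp add: powr_powr)
  qed
  then show ?thesis using assms real by (simp add: Lp_norm_def Lp_nn_def[symmetric])
next
  case top
  then show ?thesis using assms by (simp add: Lp_norm_def Lp_nn_def[symmetric] top_unique)
qed

lemma le_Lp_norm_iff:
  assumes "P > 0" "B \<ge> 0"
  shows "ennreal B \<le> Lp_norm (ennreal P) f \<longleftrightarrow> ennreal (B powr P) \<le> Lp_nn P f"
proof (cases "Lp_nn P f")
  case (real y)
  have "B \<le> y powr (1/P) \<longleftrightarrow> B powr P \<le> y"
  proof
    assume "B \<le> y powr (1/P)"
    then have "B powr P \<le> (y powr (1/P)) powr P" using assms by (intro powr_mono2) auto
    then show "B powr P \<le> y" using assms real by (simp add: powr_powr)
  next
    assume "B powr P \<le> y"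
    then have "(B powr P) powr (1/P) \<le> y powr (1/P)" using assms real by (intro powr_mono2) auto
    then show "B \<le> y powr (1/P)" using assms by (simp add: powr_powr)
  qed
  then show ?thesis using assms real by (simp add: Lp_norm_def Lp_nn_def[symmetric])
next
  case top
  then show ?thesis using assms by (simp add: Lp_norm_def Lp_nn_def[symmetric])
qed

text \<open>Follows from |h| <= 2 max(|u|, |v|), and so holds for P < 1 as well, where Minkowski's
  inequality fails.\<close>

lemma Lp_nn_quasi_triangle:
  assumes P: "P > 0" and u: "u \<in> borel_measurable lebesgue" and v: "v \<in> borel_measurable lebesgue"
    and le: "\<And>x. norm (h x) \<le> norm (u x) + norm (v x)"
  shows "Lp_nn P h \<le> ennreal (2 powr P) * (Lp_nn P u + Lp_nn P v)"
proof -
  have [measurable]: "u \<in> borel_measurable (lebesgue_on {0..1})" "v \<in> borel_measurable (lebesgue_on {0..1})"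
    using u v by (auto intro: measurable_restrict_space1)
  have pw: "ennreal (norm (h x) powr P) \<le> ennreal (2 powr P) * (ennreal (norm (u x) powr P) + ennreal (norm (v x) powr P))" for x
  proof -
    define m where "m = max (norm (u x)) (norm (v x))"
    have "norm (h x) \<le> 2 * m" using le[of x] by (simp add: m_def)
    then have "norm (h x) powr P \<le> (2 * m) powr P" using P by (intro powr_mono2) auto
    also have "\<dots> = 2 powr P * m powr P" by (simp add: powr_mult)
    also have "\<dots> \<le> 2 powr P * (norm (u x) powr P + norm (v x) powr P)"
      by (intro mult_left_mono) (auto simp: m_def max_def)
    finally show ?thesis by (simp add: ennreal_plus[symmetric] ennreal_mult[symmetric] del: ennreal_plus)
  qed
  have "Lp_nn P h \<le> (\<integral>\<^sup>+ x. ennreal (2 powr P) * (ennreal (norm (u x) powr P) + ennreal (norm (v x) powr P)) \<partial>lebesgue_on {0..1})"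
    unfolding Lp_nn_def by (intro nn_integral_mono pw)
  also have "\<dots> = ennreal (2 powr P) * (Lp_nn P u + Lp_nn P v)"
    unfolding Lp_nn_def by (subst nn_integral_cmult) (auto simp: nn_integral_add)
  finally show ?thesis .
qed

lemma measurable_series_block [measurable]: "series_block s a b \<in> borel_measurable lebesgue"
proof -
  have "series_block s a b \<in> borel_measurable borel"
    by (intro borel_measurable_continuous_onI continuous_on_series_block)
  then show ?thesis by (intro measurable_completion) simp
qed

text \<open>A single block close enough to f suffices. The threshold \<eta> makes the error 2^P
  \<eta> equal to l/2 in the lower bound, and \<eta> <= u takes care of the upper one.\<close>

lemma limit_Lp_nn_bounds:
  assumes P: "P > 0" and f: "f \<in> borel_measurable lebesgue"
    and lim: "(\<lambda>b. Lp_norm (ennreal P) (\<lambda>x. series_block s a b x - f x)) \<longlonglongrightarrow> 0"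
    and l: "0 < l" and J: "\<And>b. b \<ge> b0 \<Longrightarrow> l \<le> Lp_integral P (series_block s a b) \<and> Lp_integral P (series_block s a b) \<le> u"
  shows "ennreal (l / 2 powr (P + 1)) \<le> Lp_nn P f" "Lp_nn P f \<le> ennreal (2 powr (P + 1) * u)"
proof -
  define \<eta> where "\<eta> = l / 2 powr (P + 1)"
  define \<epsilon> where "\<epsilon> = \<eta> powr (1/P)"
  have \<eta>: "\<eta> > 0" using l by (simp add: \<eta>_def)
  then have \<epsilon>: "\<epsilon> > 0" "\<epsilon> powr P = \<eta>" using P by (auto simp: \<epsilon>_def powr_powr)
  have "\<forall>\<^sub>F b in sequentially. Lp_norm (ennreal P) (\<lambda>x. series_block s a b x - f x) < ennreal \<epsilon>"
    using \<epsilon> by (intro order_tendstoD(2)[OF lim]) simp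
  from eventually_happens'[OF sequentially_bot eventually_conj[OF this eventually_ge_at_top[of b0]]]
  obtain b where b: "b \<ge> b0" and "Lp_norm (ennreal P) (\<lambda>x. series_block s a b x - f x) < ennreal \<epsilon>"
    by blast
  then have "Lp_norm (ennreal P) (\<lambda>x. series_block s a b x - f x) \<le> ennreal \<epsilon>" by (intro less_imp_le)
  then have D: "Lp_nn P (\<lambda>x. series_block s a b x - f x) \<le> ennreal \<eta>"
    using \<epsilon> P by (subst (asm) Lp_norm_le_iff) auto
  have S: "Lp_nn P (series_block s a b) = ennreal (Lp_integral P (series_block s a b))"
    by (intro Lp_nn_continuous continuous_on_series_block P)
  have Jl: "l \<le> Lp_integral P (series_block s a b)" and Ju: "Lp_integral P (series_block s a b) \<le> u" using J[OF b] by auto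
  have dm: "(\<lambda>x. series_block s a b x - f x) \<in> borel_measurable lebesgue"
    using f by measurable
  have two: "2 powr (P + 1) = 2 * 2 powr P" by (simp add: powr_add)
  have "1 \<le> 2 powr P" using P by (simp add: ge_one_powr_ge_zero)
  then have "l * 1 \<le> l * 2 powr (P + 1)" using l unfolding two by (intro mult_left_mono) auto
  then have "\<eta> \<le> l" by (simp add: \<eta>_def divide_le_eq)
  then have \<eta>u: "\<eta> \<le> u" using Jl Ju by linarith
  have "Lp_nn P f \<le> ennreal (2 powr P) * (Lp_nn P (series_block s a b) + Lp_nn P (\<lambda>x. series_block s a b x - f x))"
  proof (rule Lp_nn_quasi_triangle[OF P measurable_series_block dm])
    fix x show "norm (f x) \<le> norm (series_block s a b x) + norm (series_block s a b x - f x)"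
      using norm_triangle_ineq2[of "f x" "series_block s a b x"] by (simp add: norm_minus_commute)
  qed
  also have "\<dots> \<le> ennreal (2 powr P) * (ennreal u + ennreal u)"
    unfolding S using D \<eta>u Ju by (intro mult_left_mono add_mono ennreal_leI) (auto intro: order_trans ennreal_leI)
  also have "\<dots> = ennreal (2 powr (P + 1) * u)"
    using \<eta>u \<eta> unfolding two by (simp add: ennreal_plus[symmetric] ennreal_mult[symmetric] del: ennreal_plus)
  finally show "Lp_nn P f \<le> ennreal (2 powr (P + 1) * u)" .
  have le: "Lp_nn P (series_block s a b) \<le> ennreal (2 powr P) * (Lp_nn P f + Lp_nn P (\<lambda>x. series_block s a b x - f x))"
  proof (rule Lp_nn_quasi_triangle[OF P f dm])
    fix x show "norm (series_block s a b x) \<le> norm (f x) + norm (series_block s a b x - f x)"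
      using norm_triangle_ineq[of "f x" "series_block s a b x - f x"] by simp
  qed
  show "ennreal (l / 2 powr (P + 1)) \<le> Lp_nn P f"
  proof (cases "Lp_nn P f")
    case (real y)
    have "ennreal l \<le> Lp_nn P (series_block s a b)" unfolding S using Jl by (rule ennreal_leI)
    also have "\<dots> \<le> ennreal (2 powr P) * (ennreal y + ennreal \<eta>)"
      using le D unfolding real by (intro order_trans[OF le] mult_left_mono add_mono) (auto simp: real)
    also have "\<dots> = ennreal (2 powr P * (y + \<eta>))"
      using real \<eta> by (simp add: ennreal_plus[symmetric] ennreal_mult[symmetric] del: ennreal_plus)
    finally have "l \<le> 2 powr P * (y + \<eta>)" using real \<eta> by simp
    moreover have "2 powr P * \<eta> = l / 2" unfolding \<eta>_def two by simp
    ultimately have "l / 2 \<le> 2 powr P * y" by (simp add: distrib_left)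
    then have "\<eta> \<le> y" unfolding \<eta>_def two by (simp add: field_simps)
    then show ?thesis unfolding real \<eta>_def[symmetric] by (rule ennreal_leI)
  next
    case top then show ?thesis by simp
  qed
qed

section \<open>Existence of the limit through almost everywhere convergence\<close>

lemma series_block_diff:
  "a \<le> b \<Longrightarrow> b \<le> c \<Longrightarrow> series_block s a c x = series_block s a b x + series_block s b c x"
  unfolding series_block_def by (rule sum.atLeastLessThan_concat[symmetric])

text \<open>The L^1 norms of the dyadic blocks decay geometrically because s > 1/4, so the blocks
  are absolutely summable almost everywhere. Working in L^1 yields one candidate g for all
  exponents, including p < 1 and p = infinity.\<close>

lemma AE_dyadic_convergence:
  assumes s: "s > 1/4"
  shows "\<exists>g. g \<in> borel_measurable lebesgue \<and>
    (AE x in lebesgue_on {0..1}. (\<lambda>k. series_block s 1 (2 ^ k) x) \<longlonglongrightarrow> g x)"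
proof -
  have "2 * s > max (1/2) (1 - 2 / max 1 3)" using s by simp
  from block_upper_bound[OF _ this] obtain K where K: "K > 0"
    and up: "\<And>a b. 1 \<le> a \<Longrightarrow> Lp_integral 1 (series_block s a b) \<le> (K * block_rate 1 s a) powr 1" by auto
  define q where "q = 2 powr (1/2 - 2 * s)"
  have q: "0 < q" "q < 1" using s by (auto simp: q_def powr_less_one)
  define D where "D = (\<lambda>k. series_block s (2 ^ k) (2 ^ Suc k))"
  have ID: "Lp_integral 1 (D k) \<le> K * q ^ k" for k
  proof -
    have "Lp_integral 1 (D k) \<le> (K * block_rate 1 s (2 ^ k)) powr 1" unfolding D_def by (intro up) simp
    also have "block_rate 1 s (2 ^ k) = (2 ^ k) powr (1/2 - 2 * s)" by (subst block_rate_less_4) auto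
    also have "\<dots> = q ^ k" unfolding q_def by (simp add: powr_power powr_powr mult.commute flip: powr_realpow)
    also have "(K * q ^ k) powr 1 = K * q ^ k" using K q by simp
    finally show ?thesis .
  qed
  have [measurable]: "D k \<in> borel_measurable (lebesgue_on {0..1})" for k
    unfolding D_def by (intro measurable_restrict_space1 measurable_series_block)
  have sm: "summable (\<lambda>k. K * q ^ k)" using q by (intro summable_mult summable_geometric) auto
  have "(\<integral>\<^sup>+ x. (\<Sum>k. ennreal (norm (D k x))) \<partial>lebesgue_on {0..1}) = (\<Sum>k. \<integral>\<^sup>+ x. ennreal (norm (D k x)) \<partial>lebesgue_on {0..1})"
    by (intro nn_integral_suminf) measurable
  also have "\<dots> \<le> (\<Sum>k. ennreal (K * q ^ k))"
  proof (intro suminf_le)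
    fix k
    have "(\<integral>\<^sup>+ x. ennreal (norm (D k x)) \<partial>lebesgue_on {0..1}) = Lp_nn 1 (D k)" by (simp add: Lp_nn_def)
    also have "\<dots> = ennreal (Lp_integral 1 (D k))" unfolding D_def by (intro Lp_nn_continuous continuous_on_series_block) auto
    also have "\<dots> \<le> ennreal (K * q ^ k)" using ID by (intro ennreal_leI)
    finally show "(\<integral>\<^sup>+ x. ennreal (norm (D k x)) \<partial>lebesgue_on {0..1}) \<le> ennreal (K * q ^ k)" .
  qed auto
  also have "\<dots> = ennreal (\<Sum>k. K * q ^ k)" using sm K q by (intro suminf_ennreal2) auto
  finally have fin: "(\<integral>\<^sup>+ x. (\<Sum>k. ennreal (norm (D k x))) \<partial>lebesgue_on {0..1}) \<noteq> \<infinity>"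
    by (auto simp: top_unique)
  have "AE x in lebesgue_on {0..1}. (\<Sum>k. ennreal (norm (D k x))) \<noteq> \<infinity>"
    using fin by (intro nn_integral_PInf_AE) measurable
  then have AEc: "AE x in lebesgue_on {0..1}. convergent (\<lambda>k. series_block s 1 (2 ^ k) x)"
  proof (rule AE_mp[OF _ AE_I2], intro impI)
    fix x assume "(\<Sum>k. ennreal (norm (D k x))) \<noteq> \<infinity>"
    then have "summable (\<lambda>k. norm (D k x))" by (intro summable_suminf_not_top) auto
    then have "summable (\<lambda>k. D k x)" by (rule summable_norm_cancel)
    then have "convergent (\<lambda>n. \<Sum>k<n. D k x)" by (simp add: summable_iff_convergent)
    moreover have "(\<Sum>k<n. D k x) = series_block s 1 (2 ^ n) x" for n
    proof (induction n)
      case 0 then show ?case by (simp add: series_block_def)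
    next
      case (Suc n)
      then show ?case using series_block_diff[of 1 "2 ^ n" "2 ^ Suc n" s x] by (simp add: D_def)
    qed
    ultimately show "convergent (\<lambda>k. series_block s 1 (2 ^ k) x)" by simp
  qed
  \<comment> \<open>\<open>lim\<close> is total, with an unspecified value where there is no
    convergence, so g is a function on the whole line.\<close>
  define g where "g = (\<lambda>x. lim (\<lambda>k. series_block s 1 (2 ^ k) x))"
  have "g \<in> borel_measurable lebesgue" unfolding g_def by measurable
  moreover have "AE x in lebesgue_on {0..1}. (\<lambda>k. series_block s 1 (2 ^ k) x) \<longlonglongrightarrow> g x"
    using AEc unfolding g_def convergent_LIMSEQ_iff .
  ultimately show ?thesis by blast
qed

lemma AE_remainder_limit:
  assumes "AE x in lebesgue_on {0..1}. (\<lambda>k. series_block s 1 (2 ^ k) x) \<longlonglongrightarrow> g x" and "1 \<le> b"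
  shows "AE x in lebesgue_on {0..1}. (\<lambda>k. norm (series_block s b (2 ^ k) x)) \<longlonglongrightarrow> norm (series_block s 1 b x - g x)"
  using assms(1)
proof (rule AE_mp[OF _ AE_I2], intro impI)
  fix x assume lim: "(\<lambda>k. series_block s 1 (2 ^ k) x) \<longlonglongrightarrow> g x"
  have "(\<lambda>k. norm (series_block s 1 (2 ^ k) x - series_block s 1 b x)) \<longlonglongrightarrow> norm (g x - series_block s 1 b x)"
    by (intro tendsto_norm tendsto_diff lim tendsto_const)
  moreover have "\<forall>\<^sub>F k in sequentially. norm (series_block s 1 (2 ^ k) x - series_block s 1 b x) = norm (series_block s b (2 ^ k) x)"
  proof (rule eventually_sequentiallyI[of b])
    fix k assume "k \<ge> b"
    then have "b \<le> 2 ^ k" by (meson le_trans less_exp less_imp_le)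
    then show "norm (series_block s 1 (2 ^ k) x - series_block s 1 b x) = norm (series_block s b (2 ^ k) x)"
      using series_block_diff[of 1 b "2 ^ k" s x] assms(2) by simp
  qed
  ultimately show "(\<lambda>k. norm (series_block s b (2 ^ k) x)) \<longlonglongrightarrow> norm (series_block s 1 b x - g x)"
    by (simp add: norm_minus_commute Lim_transform_eventually)
qed

text \<open>Fatou's lemma along the dyadic partial sums: a bound uniform in the upper end of the
  blocks passes to the remainder, whatever the exponent.\<close>

lemma Lp_nn_remainder_le:
  assumes g: "AE x in lebesgue_on {0..1}. (\<lambda>k. series_block s 1 (2 ^ k) x) \<longlonglongrightarrow> g x" and b: "1 \<le> b" and P: "P > 0"
    and B: "\<And>c. Lp_integral P (series_block s b c) \<le> B"
  shows "Lp_nn P (\<lambda>x. series_block s 1 b x - g x) \<le> ennreal B"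
proof -
  have [measurable]: "series_block s b c \<in> borel_measurable (lebesgue_on {0..1})" for c
    by (intro measurable_restrict_space1 measurable_series_block)
  have "Lp_nn P (\<lambda>x. series_block s 1 b x - g x)
      = (\<integral>\<^sup>+ x. liminf (\<lambda>k. ennreal (norm (series_block s b (2 ^ k) x) powr P)) \<partial>lebesgue_on {0..1})"
    unfolding Lp_nn_def
  proof (rule nn_integral_cong_AE, rule AE_mp[OF AE_remainder_limit[OF g b] AE_I2], intro impI)
    fix x assume "(\<lambda>k. norm (series_block s b (2 ^ k) x)) \<longlonglongrightarrow> norm (series_block s 1 b x - g x)"
    then have "(\<lambda>k. ennreal (norm (series_block s b (2 ^ k) x) powr P)) \<longlonglongrightarrow> ennreal (norm (series_block s 1 b x - g x) powr P)"
      using P by (intro tendsto_ennrealI tendsto_powr2) auto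
    then show "ennreal (norm (series_block s 1 b x - g x) powr P) = liminf (\<lambda>k. ennreal (norm (series_block s b (2 ^ k) x) powr P))"
      by (rule lim_imp_Liminf[OF sequentially_bot, symmetric])
  qed
  also have "\<dots> \<le> liminf (\<lambda>k. Lp_nn P (series_block s b (2 ^ k)))"
    unfolding Lp_nn_def by (intro nn_integral_liminf) measurable
  also have "\<dots> \<le> limsup (\<lambda>k. Lp_nn P (series_block s b (2 ^ k)))" by (intro Liminf_le_Limsup) auto
  also have "\<dots> \<le> ennreal B"
    using B P by (intro Limsup_bounded always_eventually allI)
      (auto simp: Lp_nn_continuous continuous_on_series_block intro!: ennreal_leI)
  finally show ?thesis .
qed

subsection \<open>From frequency cutoffs to index cutoffs\<close>

text \<open>Here \<open>a\<close> is the ceiling of the square root of N. With k = a - 1 one has k^2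
  < N and, for k >= 1, a <= 2 k, which gives the factor 4.\<close>

lemma nat_sqrt_ceiling:
  assumes "N \<ge> 1"
  obtains a :: nat where "1 \<le> a" "N \<le> a\<^sup>2" "a\<^sup>2 \<le> 4 * N" "\<And>n. N \<le> n\<^sup>2 \<longleftrightarrow> a \<le> n"
proof -
  define a where "a = (LEAST n. N \<le> n\<^sup>2)"
  have "N \<le> N\<^sup>2" by (simp add: power2_eq_square)
  then have 1: "N \<le> a\<^sup>2" unfolding a_def by (rule LeastI)
  have least: "a \<le> n" if "N \<le> n\<^sup>2" for n unfolding a_def using that by (rule Least_le)
  have iff: "N \<le> n\<^sup>2 \<longleftrightarrow> a \<le> n" for n
  proof
    assume "a \<le> n"
    then have "a\<^sup>2 \<le> n\<^sup>2" by (rule power_mono) simp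
    then show "N \<le> n\<^sup>2" using 1 by linarith
  qed (rule least)
  have a1: "1 \<le> a" using 1 assms by (cases a) auto
  then obtain k where k: "a = Suc k" by (cases a) auto
  have "k\<^sup>2 < N" using iff[of k] k by auto
  have "a\<^sup>2 \<le> 4 * N"
  proof (cases "k = 0")
    case True then show ?thesis using k assms by simp
  next
    case False
    then have "a \<le> 2 * k" using k by simp
    then have "a\<^sup>2 \<le> (2 * k)\<^sup>2" by (rule power_mono) simp
    then show ?thesis using \<open>k\<^sup>2 < N\<close> by (simp add: power_mult_distrib)
  qed
  then show ?thesis using that a1 1 iff by blast
qed

lemma tail_partial_eq_series_block:
  assumes "1 \<le> a" "\<And>n. N \<le> n\<^sup>2 \<longleftrightarrow> a \<le> n"
  shows "tail_partial s N M = series_block s a (Suc M)"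
proof
  fix x
  have "{n. 1 \<le> n \<and> n \<le> M \<and> N \<le> n\<^sup>2} = {a..<Suc M}" unfolding assms(2) using assms(1) by auto
  then show "tail_partial s N M x = series_block s a (Suc M) x"
    by (simp add: tail_partial_def series_block_def unit_char_def mult.assoc)
qed

lemma is_tail_limit_iff:
  assumes "1 \<le> a" "\<And>n. N \<le> n\<^sup>2 \<longleftrightarrow> a \<le> n"
  shows "is_tail_limit p s N f \<longleftrightarrow> f \<in> borel_measurable lebesgue \<and>
     (\<lambda>b. Lp_norm p (\<lambda>x. series_block s a b x - f x)) \<longlonglongrightarrow> 0"
  unfolding is_tail_limit_def tail_partial_eq_series_block[OF assms]
  using filterlim_sequentially_Suc[of "\<lambda>b. Lp_norm p (\<lambda>x. series_block s a b x - f x)"] by simp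

lemma powr_square_comparison:
  assumes e: "e < 0" and N: "1 \<le> N" and a: "real N \<le> (real a)\<^sup>2" "(real a)\<^sup>2 \<le> 4 * real N"
  shows "4 powr e * real N powr e \<le> real a powr (2 * e)" "real a powr (2 * e) \<le> real N powr e"
proof -
  have a0: "real a \<noteq> 0"
  proof
    assume "real a = 0"
    then show False using a(1) N by simp
  qed
  then have eq: "real a powr (2 * e) = ((real a)\<^sup>2) powr e" by (simp add: powr_powr[symmetric])
  have "(4 * real N) powr e \<le> ((real a)\<^sup>2) powr e" using e a a0 by (intro powr_mono2') auto
  then show "4 powr e * real N powr e \<le> real a powr (2 * e)" unfolding eq by (simp add: powr_mult)
  show "real a powr (2 * e) \<le> real N powr e" unfolding eq using e a N by (intro powr_mono2') auto
qed

text \<open>Since a^2 lies between N and 4 N, powers of a with exponent 2 e become powers of N with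
  exponent e, up to the factor 4^e. For P = 4, N >= 16 gives ln N >= 1 and a <= N, so the logarithms
  agree within constant factors.\<close>

lemma rate_comparison:
  assumes P: "P > 0" and s: "P \<le> 4 \<Longrightarrow> s > 1/4" "P > 4 \<Longrightarrow> s > 1/2 - 1/P"
  shows "\<exists>c C. 0 < c \<and> 0 < C \<and> (\<forall>N a. 16 \<le> N \<longrightarrow> N \<le> a\<^sup>2 \<longrightarrow> a\<^sup>2 \<le> 4 * N \<longrightarrow>
    c * rate (ennreal P) s N \<le> block_rate P s a \<and> block_rate P s a \<le> C * rate (ennreal P) s N)"
proof -
  have lt: "ennreal P < 4 \<longleftrightarrow> P < 4" "ennreal P = 4 \<longleftrightarrow> P = 4"
    using P ennreal_less_iff[of P 4] ennreal_inj[of P 4] by auto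
  have cast: "real N \<le> (real a)\<^sup>2" "(real a)\<^sup>2 \<le> 4 * real N" "a \<ge> 1"
    if "16 \<le> N" "N \<le> a\<^sup>2" "a\<^sup>2 \<le> 4 * N" for N a :: nat
  proof -
    show "real N \<le> (real a)\<^sup>2" using that(2) by (metis of_nat_le_iff of_nat_power)
    have "real (a\<^sup>2) \<le> real (4 * N)" using that(3) by (simp only: of_nat_le_iff)
    then show "(real a)\<^sup>2 \<le> 4 * real N" by simp
    show "a \<ge> 1" using that by (cases a) auto
  qed
  consider "P < 4" | "P = 4" | "P > 4" by linarith
  then show ?thesis
  proof cases
    case 1
    define e where "e = 1/4 - s"
    have e: "e < 0" "1/2 - 2 * s = 2 * e" using s 1 by (auto simp: e_def)
    show ?thesis
    proof (rule exI[of _ "4 powr e"], rule exI[of _ "1::real"], intro conjI allI impI)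
      fix N a :: nat assume h: "16 \<le> N" "N \<le> a\<^sup>2" "a\<^sup>2 \<le> 4 * N"
      note c = cast[OF h]
      have br: "block_rate P s a = real a powr (2 * e)" using block_rate_less_4[OF 1 c(3)] e by simp
      have rt: "rate (ennreal P) s N = real N powr e" using 1 lt by (simp add: rate_def e_def)
      show "4 powr e * rate (ennreal P) s N \<le> block_rate P s a" "block_rate P s a \<le> 1 * rate (ennreal P) s N"
        unfolding br rt using powr_square_comparison[OF e(1) _ c(1,2)] h by auto
    qed auto
  next
    case 2
    define e where "e = 1/4 - s"
    have e: "e < 0" "1/2 - 2 * s = 2 * e" using s 2 by (auto simp: e_def)
    show ?thesis
    proof (rule exI[of _ "4 powr e * (1/2) powr (1/4)"], rule exI[of _ "2 powr (1/4)"], intro conjI allI impI)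
      fix N a :: nat assume h: "16 \<le> N" "N \<le> a\<^sup>2" "a\<^sup>2 \<le> 4 * N"
      note c = cast[OF h]
      have "exp 1 \<le> real N" using exp_le h by linarith
      then have ln1: "1 \<le> ln (real N)" using h by (simp add: ln_ge_iff)
      have a0: "real a > 0" using c by simp
      have "ln (real N) \<le> ln ((real a)\<^sup>2)" using c h by (intro ln_mono) auto
      then have l1: "ln (real N) \<le> 2 * ln (real a)" using a0 by (simp add: ln_realpow)
      have "ln ((real a)\<^sup>2) \<le> ln (real N * real N)"
        using c h a0 by (intro ln_mono order_trans[OF c(2)] mult_right_mono) auto
      then have l2: "ln (real a) \<le> ln (real N)" using a0 h by (simp add: ln_realpow ln_mult)
      have br: "block_rate P s a = real a powr (2 * e) * (1 + ln a) powr (1/4)"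
        using block_rate_4[OF c(3)] e 2 by simp
      have rt: "rate (ennreal P) s N = real N powr e * ln N powr (1/4)"
        using 2 lt by (simp add: rate_def e_def)
      note cmp = powr_square_comparison[OF e(1) _ c(1,2)]
      have "(1/2 * ln N) powr (1/4) \<le> (1 + ln a) powr (1/4)" using l1 ln1 by (intro powr_mono2) auto
      then have "(1/2) powr (1/4) * ln N powr (1/4) \<le> (1 + ln a) powr (1/4)" unfolding powr_mult .
      then have "(4 powr e * real N powr e) * ((1/2) powr (1/4) * ln N powr (1/4)) \<le> real a powr (2 * e) * (1 + ln a) powr (1/4)"
        using cmp(1) h by (intro mult_mono) auto
      then show "4 powr e * (1/2) powr (1/4) * rate (ennreal P) s N \<le> block_rate P s a"
        unfolding br rt by (simp only: mult_ac)
      have "(1 + ln a) powr (1/4) \<le> (2 * ln N) powr (1/4)" using l2 ln1 c by (intro powr_mono2) auto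
      then have "(1 + ln a) powr (1/4) \<le> 2 powr (1/4) * ln N powr (1/4)" unfolding powr_mult .
      then have "real a powr (2 * e) * (1 + ln a) powr (1/4) \<le> real N powr e * (2 powr (1/4) * ln N powr (1/4))"
        using cmp(2) h by (intro mult_mono) auto
      then show "block_rate P s a \<le> 2 powr (1/4) * rate (ennreal P) s N"
        unfolding br rt by (simp only: mult_ac)
    qed auto
  next
    case 3
    define e where "e = 1/2 - 1/P - s"
    have e: "e < 0" "1 - 2/P - 2 * s = 2 * e" using s 3 by (auto simp: e_def)
    show ?thesis
    proof (rule exI[of _ "4 powr e"], rule exI[of _ "1::real"], intro conjI allI impI)
      fix N a :: nat assume h: "16 \<le> N" "N \<le> a\<^sup>2" "a\<^sup>2 \<le> 4 * N"
      note c = cast[OF h]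
      have br: "block_rate P s a = real a powr (2 * e)" using block_rate_greater_4[OF 3 c(3)] e by simp
      have rt: "rate (ennreal P) s N = real N powr e"
        using 3 lt by (simp add: rate_def inv_exp_def e_def)
      show "4 powr e * rate (ennreal P) s N \<le> block_rate P s a" "block_rate P s a \<le> 1 * rate (ennreal P) s N"
        unfolding br rt using powr_square_comparison[OF e(1) _ c(1,2)] h by auto
    qed auto
  qed
qed

lemma tail_norm_bounds_finite:
  assumes P: "P > 0" and s: "P \<le> 4 \<Longrightarrow> s > 1/4" "P > 4 \<Longrightarrow> s > 1/2 - 1/P"
  shows "\<exists>c C N0. 0 < c \<and> 0 < C \<and>
           (\<forall>N \<ge> N0.
              (\<exists>f. is_tail_limit (ennreal P) s N f) \<and>
              (\<forall>f. is_tail_limit (ennreal P) s N f \<longrightarrow>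
                   ennreal (c * rate (ennreal P) s N) \<le> Lp_norm (ennreal P) f \<and>
                   Lp_norm (ennreal P) f \<le> ennreal (C * rate (ennreal P) s N)))"
proof -
  note adm = admissible_exponent[OF s]
  obtain K where K: "K > 0" and up: "\<And>a b. 1 \<le> a \<Longrightarrow> Lp_integral P (series_block s a b) \<le> (K * block_rate P s a) powr P"
    using block_upper_bound[OF P adm(2)] by blast
  obtain k where k: "k > 0" and low: "\<And>a b. 4 \<le> a \<Longrightarrow> 10 * a \<le> b \<Longrightarrow> (k * block_rate P s a) powr P \<le> Lp_integral P (series_block s a b)"
    using block_lower_bound[OF P s] by blast
  obtain c1 C1 where c1: "c1 > 0" "C1 > 0" and cmp: "\<And>N a. 16 \<le> N \<Longrightarrow> N \<le> a\<^sup>2 \<Longrightarrow> a\<^sup>2 \<le> 4 * N \<Longrightarrow>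
    c1 * rate (ennreal P) s N \<le> block_rate P s a \<and> block_rate P s a \<le> C1 * rate (ennreal P) s N"
    using rate_comparison[OF P s] by blast
  obtain g where g: "g \<in> borel_measurable lebesgue"
    and glim: "AE x in lebesgue_on {0..1}. (\<lambda>k. series_block s 1 (2 ^ k) x) \<longlonglongrightarrow> g x"
    using AE_dyadic_convergence[OF adm(1)] by blast
  \<comment> \<open>The factor 2^(P+1) lost between blocks and their limit, at the level of
    norms.\<close>
  define T where "T = 2 powr ((P + 1) / P)"
  have T: "T > 0" "T powr P = 2 powr (P + 1)" using P by (auto simp: T_def powr_powr)
  have main: "(\<exists>f. is_tail_limit (ennreal P) s N f) \<and>
      (\<forall>f. is_tail_limit (ennreal P) s N f \<longrightarrow>
         ennreal (k * c1 / T * rate (ennreal P) s N) \<le> Lp_norm (ennreal P) f \<and>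
         Lp_norm (ennreal P) f \<le> ennreal (K * C1 * T * rate (ennreal P) s N))" if N: "N \<ge> 16" for N
  proof -
    obtain a where a: "1 \<le> a" "N \<le> a\<^sup>2" "a\<^sup>2 \<le> 4 * N" and iff: "\<And>n. N \<le> n\<^sup>2 \<longleftrightarrow> a \<le> n"
      using nat_sqrt_ceiling[of N] N by auto
    \<comment> \<open>The lower bounds for blocks require a >= 4, which is why N starts at
      16.\<close>
    have a4: "4 \<le> a"
    proof (rule ccontr)
      assume "\<not> 4 \<le> a"
      then have "a\<^sup>2 \<le> 3\<^sup>2" by (intro power_mono) auto
      then show False using a N by simp
    qed
    define \<rho> where "\<rho> = block_rate P s a"
    have \<rho>: "\<rho> > 0" unfolding \<rho>_def by (rule block_rate_pos[OF a(1)])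
    note cmpN = cmp[OF N a(2,3), folded \<rho>_def]
    show ?thesis
    proof (intro conjI allI impI)
      \<comment> \<open>The limit of the tail is g without the terms below a. Its distance to the
        block from a to b is the remainder of g after b, of size O(\<open>block_rate P s b\<close>),
        which tends to 0.\<close>
      define f where "f = (\<lambda>x. g x - series_block s 1 a x)"
      have "Lp_norm (ennreal P) (\<lambda>x. series_block s a b x - f x) \<le> ennreal (K * block_rate P s b)" if "b \<ge> a" for b
      proof -
        have b1: "1 \<le> b" using that a by simp
        have "(\<lambda>x. series_block s a b x - f x) = (\<lambda>x. series_block s 1 b x - g x)"
          using series_block_diff[OF a(1) that] by (auto simp: f_def)
        then show ?thesis
          using Lp_nn_remainder_le[OF glim b1 P up[OF b1]] P K block_rate_pos[OF b1, of P s]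
          by (subst Lp_norm_le_iff) auto
      qed
      then have ev: "\<forall>\<^sub>F b in sequentially. Lp_norm (ennreal P) (\<lambda>x. series_block s a b x - f x) \<le> ennreal (K * block_rate P s b)"
        by (rule eventually_sequentiallyI)
      have "(\<lambda>b. ennreal (K * block_rate P s b)) \<longlonglongrightarrow> ennreal (K * 0)"
        by (intro tendsto_ennrealI tendsto_mult tendsto_const block_rate_tendsto_0 adm)
      then have "(\<lambda>b. ennreal (K * block_rate P s b)) \<longlonglongrightarrow> 0" by simp
      then have "(\<lambda>b. Lp_norm (ennreal P) (\<lambda>x. series_block s a b x - f x)) \<longlonglongrightarrow> 0"
        by (intro tendsto_sandwich[OF _ ev tendsto_const]) auto
      moreover have "f \<in> borel_measurable lebesgue" unfolding f_def using g by measurable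
      ultimately show "\<exists>f. is_tail_limit (ennreal P) s N f"
        using is_tail_limit_iff[OF a(1) iff] by blast
    next
      fix f assume "is_tail_limit (ennreal P) s N f"
      then have f: "f \<in> borel_measurable lebesgue"
        and lim: "(\<lambda>b. Lp_norm (ennreal P) (\<lambda>x. series_block s a b x - f x)) \<longlonglongrightarrow> 0"
        using is_tail_limit_iff[OF a(1) iff] by auto
      have l: "0 < (k * \<rho>) powr P" using k \<rho> by simp
      note bnd = limit_Lp_nn_bounds[OF P f lim l, of "10 * a" "(K * \<rho>) powr P"]
      have J: "(k * \<rho>) powr P \<le> Lp_integral P (series_block s a b) \<and> Lp_integral P (series_block s a b) \<le> (K * \<rho>) powr P"
        if "b \<ge> 10 * a" for b
        unfolding \<rho>_def using low[OF a4 that] up[OF a(1)] by blast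
      have lo: "ennreal (k * \<rho> / T) \<le> Lp_norm (ennreal P) f"
      proof -
        have "(k * \<rho> / T) powr P = (k * \<rho>) powr P / 2 powr (P + 1)"
          unfolding T(2)[symmetric] by (rule powr_divide)
        then show ?thesis using bnd(1)[OF J] k \<rho> T P by (subst le_Lp_norm_iff) auto
      qed
      have hi: "Lp_norm (ennreal P) f \<le> ennreal (T * (K * \<rho>))"
      proof -
        have "(T * (K * \<rho>)) powr P = 2 powr (P + 1) * (K * \<rho>) powr P"
          unfolding T(2)[symmetric] by (rule powr_mult)
        then show ?thesis using bnd(2)[OF J] K \<rho> T P by (subst Lp_norm_le_iff) auto
      qed
      have "k * c1 / T * rate (ennreal P) s N = k / T * (c1 * rate (ennreal P) s N)" by simp
      also have "\<dots> \<le> k / T * \<rho>" using cmpN k T by (intro mult_left_mono) auto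
      finally have "ennreal (k * c1 / T * rate (ennreal P) s N) \<le> ennreal (k * \<rho> / T)" by (intro ennreal_leI) simp
      then show "ennreal (k * c1 / T * rate (ennreal P) s N) \<le> Lp_norm (ennreal P) f" using lo by (rule order_trans)
      have "T * (K * \<rho>) \<le> T * (K * (C1 * rate (ennreal P) s N))" using cmpN K T by (intro mult_left_mono) auto
      also have "\<dots> = K * C1 * T * rate (ennreal P) s N" by simp
      finally show "Lp_norm (ennreal P) f \<le> ennreal (K * C1 * T * rate (ennreal P) s N)"
        by (intro order_trans[OF hi] ennreal_leI)
    qed
  qed
  have pos: "k * c1 / T > 0" "K * C1 * T > 0" using k K c1 T by auto
  show ?thesis
    by (rule exI[of _ "k * c1 / T"], rule exI[of _ "K * C1 * T"], rule exI[of _ 16])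
      (intro conjI pos allI impI main)
qed

subsection \<open>The uniform norm\<close>

lemma Lp_norm_top: "Lp_norm \<infinity> f = Inf {C :: ennreal. AE x in lebesgue_on {0..1}. ennreal (norm (f x)) \<le> C}"
  by (simp add: Lp_norm_def)

text \<open>The bound holds on a closed set that contains almost all of (0, 1), hence all of it, and
  then the boundary point 0, where the blocks are largest.\<close>

lemma continuous_AE_norm_bound_at_0:
  fixes g :: "real \<Rightarrow> complex"
  assumes g: "continuous_on UNIV g" and AE: "AE x in lebesgue_on {0..1}. norm (g x) \<le> B"
  shows "norm (g 0) \<le> B"
proof -
  define C where "C = {x. norm (g x) \<le> B}"
  have C: "closed C" unfolding C_def by (intro closed_Collect_le continuous_intros g)
  have "AE x in lebesgue. x \<in> {0..1} \<longrightarrow> norm (g x) \<le> B"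
    using AE by (subst (asm) AE_restrict_space_iff) auto
  then have "AE x \<in> {0<..<1} in lebesgue. x \<in> C" by (rule AE_mp[OF _ AE_I2]) (auto simp: C_def)
  from mem_closed_if_AE_lebesgue_open[OF open_greaterThanLessThan C this]
  have "{0<..<1} \<subseteq> C" by (rule subsetI)
  then have "closure {0<..<1} \<subseteq> C" using C by (rule closure_minimal)
  moreover have "(0::real) \<in> closure {0<..<1}" by simp
  ultimately have "0 \<in> C" by blast
  then show ?thesis by (simp add: C_def)
qed

lemma tail_norm_bounds_infinite:
  assumes s: "s > 1/2"
  shows "\<exists>c C N0. 0 < c \<and> 0 < C \<and>
           (\<forall>N \<ge> N0.
              (\<exists>f. is_tail_limit \<infinity> s N f) \<and>
              (\<forall>f. is_tail_limit \<infinity> s N f \<longrightarrow>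
                   ennreal (c * rate \<infinity> s N) \<le> Lp_norm \<infinity> f \<and>
                   Lp_norm \<infinity> f \<le> ennreal (C * rate \<infinity> s N)))"
proof -
  define K where "K = 1 / (1 - 1 / (2 * s))"
  have K: "K > 0" unfolding K_def using s by (simp add: field_simps)
  define e where "e = 1/2 - s"
  have e: "e < 0" "1 - 2 * s = 2 * e" using s by (auto simp: e_def)
  define k where "k = 2 powr (-2 * s)"
  have k: "k > 0" by (simp add: k_def)
  have rt: "rate \<infinity> s N = real N powr e" for N by (simp add: rate_def inv_exp_def e_def)
  have s4: "s > 1/4" using s by simp
  obtain g where g: "g \<in> borel_measurable lebesgue"
    and glim: "AE x in lebesgue_on {0..1}. (\<lambda>k. series_block s 1 (2 ^ k) x) \<longlonglongrightarrow> g x"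
    using AE_dyadic_convergence[OF s4] by blast
  have up: "norm (series_block s a b x) \<le> K * real a powr (2 * e)" if "1 \<le> a" for a b x
    using norm_series_block_le[OF s that, of b x] unfolding K_def e(2) .
  have main: "(\<exists>f. is_tail_limit \<infinity> s N f) \<and>
      (\<forall>f. is_tail_limit \<infinity> s N f \<longrightarrow>
         ennreal (k / 2 * 4 powr e * rate \<infinity> s N) \<le> Lp_norm \<infinity> f \<and>
         Lp_norm \<infinity> f \<le> ennreal ((K + k / 2) * rate \<infinity> s N))" if N: "N \<ge> 1" for N
  proof -
    obtain a where a: "1 \<le> a" "N \<le> a\<^sup>2" "a\<^sup>2 \<le> 4 * N" and iff: "\<And>n. N \<le> n\<^sup>2 \<longleftrightarrow> a \<le> n"
      using nat_sqrt_ceiling[OF N] by blast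
    have "real N \<le> real (a\<^sup>2)" "real (a\<^sup>2) \<le> real (4 * N)" using a by (simp_all only: of_nat_le_iff)
    then have aN: "real N \<le> (real a)\<^sup>2" "(real a)\<^sup>2 \<le> 4 * real N" by simp_all
    define \<rho> where "\<rho> = real a powr (2 * e)"
    have \<rho>: "\<rho> > 0" using a by (simp add: \<rho>_def)
    note cmp = powr_square_comparison[OF e(1) N aN, folded \<rho>_def rt]
    show ?thesis
    proof (intro conjI allI impI)
      define f where "f = (\<lambda>x. g x - series_block s 1 a x)"
      have "Lp_norm \<infinity> (\<lambda>x. series_block s a b x - f x) \<le> ennreal (K * real b powr (2 * e))" if "b \<ge> a" for b
      proof -
        have b1: "1 \<le> b" using that a by simp
        have eq: "(\<lambda>x. series_block s a b x - f x) = (\<lambda>x. series_block s 1 b x - g x)"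
          using series_block_diff[OF a(1) that] by (auto simp: f_def)
        have "AE x in lebesgue_on {0..1}. ennreal (norm (series_block s 1 b x - g x)) \<le> ennreal (K * real b powr (2 * e))"
        proof (rule AE_mp[OF AE_remainder_limit[OF glim b1] AE_I2], intro impI ennreal_leI)
          fix x assume "(\<lambda>k. norm (series_block s b (2 ^ k) x)) \<longlonglongrightarrow> norm (series_block s 1 b x - g x)"
          then show "norm (series_block s 1 b x - g x) \<le> K * real b powr (2 * e)"
            by (rule LIMSEQ_le_const2) (use up[OF b1] in blast)
        qed
        then show ?thesis unfolding eq Lp_norm_top by (intro Inf_lower) simp
      qed
      then have ev: "\<forall>\<^sub>F b in sequentially. Lp_norm \<infinity> (\<lambda>x. series_block s a b x - f x) \<le> ennreal (K * real b powr (2 * e))"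
        by (rule eventually_sequentiallyI)
      have "(\<lambda>b. ennreal (K * real b powr (2 * e))) \<longlonglongrightarrow> ennreal (K * 0)"
        using e by (intro tendsto_ennrealI tendsto_mult tendsto_const tendsto_neg_powr filterlim_real_sequentially) auto
      then have "(\<lambda>b. ennreal (K * real b powr (2 * e))) \<longlonglongrightarrow> 0" by simp
      then have "(\<lambda>b. Lp_norm \<infinity> (\<lambda>x. series_block s a b x - f x)) \<longlonglongrightarrow> 0"
        by (intro tendsto_sandwich[OF _ ev tendsto_const]) auto
      moreover have "f \<in> borel_measurable lebesgue" unfolding f_def using g by measurable
      ultimately show "\<exists>f. is_tail_limit \<infinity> s N f"
        using is_tail_limit_iff[OF a(1) iff] by blast
    next
      fix f assume "is_tail_limit \<infinity> s N f"
      then have lim: "(\<lambda>b. Lp_norm \<infinity> (\<lambda>x. series_block s a b x - f x)) \<longlonglongrightarrow> 0"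
        using is_tail_limit_iff[OF a(1) iff] by auto
      \<comment> \<open>Half of the lower bound k \<rho> for the block at 0, so that the limit
        retains the other half.\<close>
      define \<epsilon> where "\<epsilon> = k / 2 * \<rho>"
      have \<epsilon>: "\<epsilon> > 0" using k \<rho> by (simp add: \<epsilon>_def)
      have "\<forall>\<^sub>F b in sequentially. Lp_norm \<infinity> (\<lambda>x. series_block s a b x - f x) < ennreal \<epsilon>"
        using \<epsilon> by (intro order_tendstoD(2)[OF lim]) simp
      from eventually_happens'[OF sequentially_bot eventually_conj[OF this eventually_ge_at_top[of "2 * a"]]]
      obtain b where b: "2 * a \<le> b" and "Lp_norm \<infinity> (\<lambda>x. series_block s a b x - f x) < ennreal \<epsilon>" by blast
      then obtain C0 where C0: "C0 < ennreal \<epsilon>" "AE x in lebesgue_on {0..1}. ennreal (norm (series_block s a b x - f x)) \<le> C0"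
        unfolding Lp_norm_top Inf_less_iff by blast
      have AEd: "AE x in lebesgue_on {0..1}. norm (series_block s a b x - f x) \<le> \<epsilon>"
        using C0(2)
      proof (rule AE_mp[OF _ AE_I2], intro impI)
        fix x assume "ennreal (norm (series_block s a b x - f x)) \<le> C0"
        then have "ennreal (norm (series_block s a b x - f x)) < ennreal \<epsilon>" using C0(1) by (rule le_less_trans)
        then show "norm (series_block s a b x - f x) \<le> \<epsilon>" by (simp add: ennreal_less_iff)
      qed
      have "AE x in lebesgue_on {0..1}. ennreal (norm (f x)) \<le> ennreal ((K + k / 2) * \<rho>)"
        using AEd
      proof (rule AE_mp[OF _ AE_I2], intro impI ennreal_leI)
        fix x assume "norm (series_block s a b x - f x) \<le> \<epsilon>"
        moreover have "norm (f x) \<le> norm (series_block s a b x) + norm (series_block s a b x - f x)"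
          using norm_triangle_ineq2[of "f x" "series_block s a b x"] by (simp add: norm_minus_commute)
        ultimately show "norm (f x) \<le> (K + k / 2) * \<rho>"
          using up[OF a(1), of b x] unfolding \<epsilon>_def \<rho>_def[symmetric] distrib_right by linarith
      qed
      then have "Lp_norm \<infinity> f \<le> ennreal ((K + k / 2) * \<rho>)" unfolding Lp_norm_top by (intro Inf_lower) simp
      also have "\<dots> \<le> ennreal ((K + k / 2) * rate \<infinity> s N)"
        using cmp K k by (intro ennreal_leI mult_left_mono) auto
      finally show "Lp_norm \<infinity> f \<le> ennreal ((K + k / 2) * rate \<infinity> s N)" .
      have "ennreal (k / 2 * \<rho>) \<le> Lp_norm \<infinity> f"
        unfolding Lp_norm_top
      proof (rule Inf_greatest)
        fix C assume "C \<in> {C. AE x in lebesgue_on {0..1}. ennreal (norm (f x)) \<le> C}"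
        then have AEf: "AE x in lebesgue_on {0..1}. ennreal (norm (f x)) \<le> C" by simp
        show "ennreal (k / 2 * \<rho>) \<le> C"
        proof (cases C)
          case (real y)
          \<comment> \<open>The limit is determined only almost everywhere, so its value at 0
            carries no information; the essential bound is moved to the continuous block, which can
            be evaluated there.\<close>
          have "AE x in lebesgue_on {0..1}. norm (series_block s a b x) \<le> y + \<epsilon>"
            using AEf AEd
          proof eventually_elim
            fix x assume 1: "ennreal (norm (f x)) \<le> C" and 2: "norm (series_block s a b x - f x) \<le> \<epsilon>"
            have "norm (f x) \<le> y" using 1 real by simp
            then show "norm (series_block s a b x) \<le> y + \<epsilon>"
              using 2 norm_triangle_ineq[of "f x" "series_block s a b x - f x"] by simp
          qed
          then have "norm (series_block s a b 0) \<le> y + \<epsilon>"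
            by (rule continuous_AE_norm_bound_at_0[OF continuous_on_series_block])
          moreover have "k * \<rho> \<le> norm (series_block s a b 0)"
            using norm_series_block_0_ge[OF _ a(1) b, of s] s unfolding k_def \<rho>_def e(2) by simp
          ultimately have "k / 2 * \<rho> \<le> y" unfolding \<epsilon>_def by simp
          then show ?thesis unfolding real by (rule ennreal_leI)
        qed simp
      qed
      moreover have "k / 2 * 4 powr e * rate \<infinity> s N \<le> k / 2 * \<rho>"
        using mult_left_mono[OF cmp(1), of "k / 2"] k by (simp add: mult.assoc)
      ultimately show "ennreal (k / 2 * 4 powr e * rate \<infinity> s N) \<le> Lp_norm \<infinity> f"
        by (meson ennreal_leI order_trans)
    qed
  qed
  have pos: "k / 2 * 4 powr e > 0" "K + k / 2 > 0" using k K by auto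
  show ?thesis
    by (rule exI[of _ "k / 2 * 4 powr e"], rule exI[of _ "K + k / 2"], rule exI[of _ 1])
      (intro conjI pos allI impI main)
qed

theorem theorem5p1:
  fixes p :: ennreal and s :: real
  assumes "0 < p"
    and "p \<le> 4 \<Longrightarrow> s > 1/4"
    and "p > 4 \<Longrightarrow> s > 1/2 - inv_exp p"
  shows "\<exists>c C N0. 0 < c \<and> 0 < C \<and>
           (\<forall>N \<ge> N0.
              (\<exists>f. is_tail_limit p s N f) \<and>
              (\<forall>f. is_tail_limit p s N f \<longrightarrow>
                   ennreal (c * rate p s N) \<le> Lp_norm p f \<and>
                   Lp_norm p f \<le> ennreal (C * rate p s N)))"
proof (cases p)
  case (real P)
  have P: "P > 0" using assms(1) real by simp
  have le: "ennreal P \<le> 4 \<longleftrightarrow> P \<le> 4" "4 < ennreal P \<longleftrightarrow> 4 < P"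
    using P ennreal_le_iff[of 4 P] ennreal_less_iff[of 4 P] by (auto simp flip: not_less)
  show ?thesis unfolding real(2)
  proof (rule tail_norm_bounds_finite[OF P])
    show "s > 1/4" if "P \<le> 4" using assms(2) that le real by simp
    show "s > 1/2 - 1/P" if "P > 4" using assms(3) that le real by (simp add: inv_exp_def)
  qed
next
  case top
  then have "s > 1/2" using assms(3) by (simp add: inv_exp_def)
  then show ?thesis unfolding top infinity_ennreal_def[symmetric] by (rule tail_norm_bounds_infinite)
qed

end
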